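(* Let $X,Y$ be complex Banach spaces and let $\phi\in\mathcal{H}L(B_Y,X)$ with $\phi(B_Y)\subseteq B_X$. Consider the following statements: (1) $C_\phi\colon\mathcal{H}L(B_X)\to\mathcal{H}L(B_Y)$ is compact. (2) $C_\phi\colon\mathcal{H}L(B_X)\to\mathcal{H}L(B_Y)$ does not fix any copy of $\ell_\infty$ and $\phi(B_Y)$ is relatively compact. (3) $\|\phi(y)\|<1$ for every $y\in\overline{B}_Y$ and $\phi(B_Y)$ is relatively compact. (4) $C_\phi\colon\mathcal{H}^\infty(B_X)\to\mathcal{H}^\infty(B_Y)$ is compact. Then $(1)\Rightarrow(2)\Rightarrow(3)$. If $\dim(Y)<\infty$, then $(3)\Rightarrow(4)$. If $\dim(X)<\infty$, then $(4)\Rightarrow(1)$. Thus, for $X$ and $Y$ finite-dimensional, all the statements are equivalent.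
   Context: $B_X$ and $\overline{B}_X$ denote the open and closed unit balls of $X$. $\mathcal{H}L(B_Y,X)$ is the Banach space of all holomorphic Lipschitz maps $f\colon B_Y\to X$ (not necessarily vanishing at $0$), with norm $\|f\|_L=L(f)+\|f(0)\|$, where $L(f)$ is the Lipschitz constant; $\mathcal{H}L(B_X)=\mathcal{H}L(B_X,\mathbb C)$. $\mathcal{H}^\infty(B_X)$ is the Banach space of bounded holomorphic functions $B_X\to\mathbb C$ with the supremum norm. A map $\phi\in\mathcal{H}L(B_Y,X)$ is identified with its unique Lipschitz extension to $\overline{B}_Y$. $C_\phi$ denotes the operator $f\mapsto f\circ\phi$ acting between the indicated spaces. A bounded operator $T\colon E\to F$ between Banach spaces fixes a copy of $\ell_\infty$ if there is a subspace $G\subseteq E$ isomorphic to $\ell_\infty$ such that $T|_G$ is an isomorphism onto its image. Relative compactness of $\phi(B_Y)$ is in the norm topology of $X$. *)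

theory Defs
  imports "HOL-Analysis.Analysis"
begin

section \<open>Complex Banach spaces\<close>

class complex_normed_vector = real_normed_vector +
  fixes scaleC :: "complex \<Rightarrow> 'a \<Rightarrow> 'a"  (infixr \<open>*\<^sub>C\<close> 75)
  assumes scaleC_add_right: "c *\<^sub>C (x + y) = c *\<^sub>C x + c *\<^sub>C y"
    and scaleC_add_left: "(c + d) *\<^sub>C x = c *\<^sub>C x + d *\<^sub>C x"
    and scaleC_scaleC: "c *\<^sub>C d *\<^sub>C x = (c * d) *\<^sub>C x"
    and scaleC_of_real: "complex_of_real r *\<^sub>C x = r *\<^sub>R x"
    and norm_scaleC: "norm (c *\<^sub>C x) = cmod c * norm x"

class complex_banach = complex_normed_vector + banach

lemma scaleC_one: "1 *\<^sub>C x = (x :: 'a::complex_normed_vector)"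
  using scaleC_of_real[of 1 x] by simp

global_interpretation complex_vector:
  vector_space "scaleC :: complex \<Rightarrow> 'a \<Rightarrow> 'a::complex_normed_vector"
  by unfold_locales
    (simp_all add: scaleC_add_right scaleC_add_left scaleC_scaleC scaleC_one)

instantiation complex :: complex_banach
begin

definition scaleC_complex :: "complex \<Rightarrow> complex \<Rightarrow> complex" where
  "scaleC_complex c x = c * x"

instance
  by standard (simp_all add: scaleC_complex_def algebra_simps norm_mult scaleR_conv_of_real)

end

lemma bounded_linear_scaleC: "bounded_linear (\<lambda>x :: 'a::complex_normed_vector. c *\<^sub>C x)"
proof (rule bounded_linear_intro)
  fix x y :: 'a and r :: real
  show "c *\<^sub>C (x + y) = c *\<^sub>C x + c *\<^sub>C y"
    by (rule scaleC_add_right)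
  show "c *\<^sub>C r *\<^sub>R x = r *\<^sub>R c *\<^sub>C x"
    by (metis scaleC_of_real scaleC_scaleC mult.commute)
  show "norm (c *\<^sub>C x) \<le> norm x * cmod c"
    by (simp add: norm_scaleC)
qed

definition finite_cdim :: "'a::complex_normed_vector itself \<Rightarrow> bool" where
  "finite_cdim _ \<longleftrightarrow> (\<exists>B :: 'a set. finite B \<and> complex_vector.span B = UNIV)"

text \<open>The complex space \<open>\<ell>\<^sub>\<infinity>\<close> is \<^typ>\<open>nat \<Rightarrow>\<^sub>C complex\<close>: since \<^typ>\<open>nat\<close> is discrete, these are exactly
  the bounded sequences, with the supremum norm.\<close>

setup_lifting type_definition_bcontfun

instantiation bcontfun :: (topological_space, complex_normed_vector) complex_normed_vector
begin

lift_definition scaleC_bcontfun :: "complex \<Rightarrow> ('a \<Rightarrow>\<^sub>C 'b) \<Rightarrow> 'a \<Rightarrow>\<^sub>C 'b"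
  is "\<lambda>c f x. c *\<^sub>C f x"
proof -
  fix c :: complex and f :: "'a \<Rightarrow> 'b"
  assume f: "f \<in> bcontfun"
  have "continuous_on UNIV (\<lambda>x. c *\<^sub>C f x)"
    using f by (intro bounded_linear.continuous_on[OF bounded_linear_scaleC])
      (simp add: bcontfun_def)
  moreover have "bounded (range (\<lambda>x. c *\<^sub>C f x))"
    using bounded_linear_image[OF _ bounded_linear_scaleC[of c], of "range f"] f
    by (simp add: bcontfun_def image_image)
  ultimately show "(\<lambda>x. c *\<^sub>C f x) \<in> bcontfun"
    by (simp add: bcontfun_def)
qed

instance
proof
  fix c d :: complex and r :: real and f g :: "'a \<Rightarrow>\<^sub>C 'b"
  show "c *\<^sub>C (f + g) = c *\<^sub>C f + c *\<^sub>C g"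
    by (rule bcontfun_eqI) (simp add: scaleC_bcontfun.rep_eq plus_bcontfun.rep_eq scaleC_add_right)
  show "(c + d) *\<^sub>C f = c *\<^sub>C f + d *\<^sub>C f"
    by (rule bcontfun_eqI) (simp add: scaleC_bcontfun.rep_eq plus_bcontfun.rep_eq scaleC_add_left)
  show "c *\<^sub>C d *\<^sub>C f = (c * d) *\<^sub>C f"
    by (rule bcontfun_eqI) (simp add: scaleC_bcontfun.rep_eq scaleC_scaleC)
  show "complex_of_real r *\<^sub>C f = r *\<^sub>R f"
    by (rule bcontfun_eqI) (simp add: scaleC_bcontfun.rep_eq scaleR_bcontfun.rep_eq scaleC_of_real)
  have le: "norm (a *\<^sub>C h) \<le> cmod a * norm h" for a and h :: "'a \<Rightarrow>\<^sub>C 'b"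
    by (rule norm_bound)
      (simp add: scaleC_bcontfun.rep_eq norm_scaleC mult_left_mono norm_bounded)
  show "norm (c *\<^sub>C f) = cmod c * norm f"
  proof (cases "c = 0")
    case True
    then show ?thesis using le[of 0 f] by simp
  next
    case False
    have "f = inverse c *\<^sub>C c *\<^sub>C f"
      using False by (intro bcontfun_eqI) (simp add: scaleC_bcontfun.rep_eq scaleC_scaleC scaleC_one)
    then have "norm f \<le> cmod (inverse c) * norm (c *\<^sub>C f)"
      by (metis le)
    then have "cmod c * norm f \<le> norm (c *\<^sub>C f)"
      using False by (simp add: norm_inverse norm_divide field_simps)
    with le[of c f] show ?thesis by simp
  qed
qed

end

section \<open>Operators\<close>

definition bounded_clinear :: "('a::complex_normed_vector \<Rightarrow> 'b::complex_normed_vector) \<Rightarrow> bool" where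
  "bounded_clinear T \<longleftrightarrow>
     Vector_Spaces.linear scaleC scaleC T \<and> (\<exists>K. \<forall>x. norm (T x) \<le> K * norm x)"

definition compact_operator :: "('a::complex_normed_vector \<Rightarrow> 'b::complex_normed_vector) \<Rightarrow> bool" where
  "compact_operator T \<longleftrightarrow> bounded_clinear T \<and> compact (closure (T ` cball 0 1))"

definition clinear_iso ::
  "('a::complex_normed_vector \<Rightarrow> 'b::complex_normed_vector) \<Rightarrow> 'a set \<Rightarrow> 'b set \<Rightarrow> bool" where
  "clinear_iso T G H \<longleftrightarrow>
     complex_vector.subspace G \<and> complex_vector.subspace H \<and>
     (\<forall>x\<in>G. \<forall>y\<in>G. T (x + y) = T x + T y) \<and>
     (\<forall>c. \<forall>x\<in>G. T (c *\<^sub>C x) = c *\<^sub>C T x) \<and>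
     (\<exists>S. homeomorphism G H T S)"

definition fixes_copy_of_linf ::
  "('a::complex_normed_vector \<Rightarrow> 'b::complex_normed_vector) \<Rightarrow> bool" where
  "fixes_copy_of_linf T \<longleftrightarrow>
     (\<exists>G. (\<exists>J :: (nat \<Rightarrow>\<^sub>C complex) \<Rightarrow> 'a. clinear_iso J UNIV G) \<and> clinear_iso T G (T ` G))"

section \<open>Holomorphic maps\<close>

text \<open>Complex Frechet differentiability: \<open>has_derivative\<close> supplies a bounded real-linear derivative,
  which is then required to be complex-homogeneous.\<close>

definition cholomorphic_on ::
  "('a::complex_normed_vector \<Rightarrow> 'b::complex_normed_vector) \<Rightarrow> 'a set \<Rightarrow> bool" where
  "cholomorphic_on f U \<longleftrightarrow>
     (\<forall>x\<in>U. \<exists>D. (f has_derivative D) (at x) \<and> (\<forall>c v. D (c *\<^sub>C v) = c *\<^sub>C D v))"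

lemma cholomorphic_on_complex:
  fixes f :: "complex \<Rightarrow> complex"
  assumes "open U"
  shows "cholomorphic_on f U \<longleftrightarrow> f holomorphic_on U"
proof -
  have "(\<exists>D. (f has_derivative D) (at x) \<and> (\<forall>c v. D (c *\<^sub>C v) = c *\<^sub>C D v)) \<longleftrightarrow>
      f field_differentiable at x" for x
  proof
    assume "\<exists>D. (f has_derivative D) (at x) \<and> (\<forall>c v. D (c *\<^sub>C v) = c *\<^sub>C D v)"
    then obtain D where D: "(f has_derivative D) (at x)" "\<And>c v. D (c *\<^sub>C v) = c *\<^sub>C D v"
      by blast
    have "D v = D 1 * v" for v
      using D(2)[of v 1] by (simp add: scaleC_complex_def mult.commute)
    then have "D = (\<lambda>v. D 1 * v)"
      by blast
    with D(1) have "(f has_field_derivative D 1) (at x)"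
      by (simp add: has_field_derivative_def)
    then show "f field_differentiable at x"
      by (auto simp: field_differentiable_def)
  next
    assume "f field_differentiable at x"
    then obtain d where "(f has_derivative (*) d) (at x)"
      by (auto simp: field_differentiable_def has_field_derivative_def)
    then show "\<exists>D. (f has_derivative D) (at x) \<and> (\<forall>c v. D (c *\<^sub>C v) = c *\<^sub>C D v)"
      by (intro exI[of _ "(*) d"]) (simp add: scaleC_complex_def mult_ac)
  qed
  then show ?thesis
    using assms
    by (simp add: cholomorphic_on_def holomorphic_on_open field_differentiable_def)
qed

lemma cholomorphic_on_const: "cholomorphic_on (\<lambda>_. c) U"
  unfolding cholomorphic_on_def by (auto intro!: exI[of _ "\<lambda>_. 0"])

lemma cholomorphic_on_add:
  assumes "cholomorphic_on f U" "cholomorphic_on g U"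
  shows "cholomorphic_on (\<lambda>x. f x + g x) U"
  unfolding cholomorphic_on_def
proof
  fix x assume "x \<in> U"
  with assms obtain D E where
    "(f has_derivative D) (at x)" "\<And>c v. D (c *\<^sub>C v) = c *\<^sub>C D v"
    "(g has_derivative E) (at x)" "\<And>c v. E (c *\<^sub>C v) = c *\<^sub>C E v"
    unfolding cholomorphic_on_def by metis
  then show "\<exists>D. ((\<lambda>x. f x + g x) has_derivative D) (at x) \<and> (\<forall>c v. D (c *\<^sub>C v) = c *\<^sub>C D v)"
    by (intro exI[of _ "\<lambda>v. D v + E v"]) (simp add: has_derivative_add scaleC_add_right)
qed

lemma cholomorphic_on_scaleC:
  assumes "cholomorphic_on f U"
  shows "cholomorphic_on (\<lambda>x. a *\<^sub>C f x) U"
  unfolding cholomorphic_on_def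
proof
  fix x assume "x \<in> U"
  with assms obtain D where
    "(f has_derivative D) (at x)" "\<And>c v. D (c *\<^sub>C v) = c *\<^sub>C D v"
    unfolding cholomorphic_on_def by metis
  then show "\<exists>D. ((\<lambda>x. a *\<^sub>C f x) has_derivative D) (at x) \<and> (\<forall>c v. D (c *\<^sub>C v) = c *\<^sub>C D v)"
    by (intro exI[of _ "\<lambda>v. a *\<^sub>C D v"])
      (simp add: bounded_linear.has_derivative[OF bounded_linear_scaleC] scaleC_scaleC mult.commute)
qed

lemma cholomorphic_on_compose:
  assumes "cholomorphic_on g U" "cholomorphic_on f V" "g ` U \<subseteq> V"
  shows "cholomorphic_on (\<lambda>x. f (g x)) U"
  unfolding cholomorphic_on_def
proof
  fix x assume x: "x \<in> U"
  with assms(1) obtain D where D: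
    "(g has_derivative D) (at x)" "\<And>c v. D (c *\<^sub>C v) = c *\<^sub>C D v"
    unfolding cholomorphic_on_def by metis
  from x assms(2,3) obtain E where E:
    "(f has_derivative E) (at (g x))" "\<And>c v. E (c *\<^sub>C v) = c *\<^sub>C E v"
    unfolding cholomorphic_on_def by (metis imageI subsetD)
  show "\<exists>D. ((\<lambda>x. f (g x)) has_derivative D) (at x) \<and> (\<forall>c v. D (c *\<^sub>C v) = c *\<^sub>C D v)"
    using has_derivative_compose[OF D(1) E(1)] D(2) E(2)
    by (intro exI[of _ "\<lambda>v. E (D v)"]) simp
qed

lemma cholomorphic_on_cong:
  assumes "cholomorphic_on f U" "open U" "\<And>x. x \<in> U \<Longrightarrow> g x = f x"
  shows "cholomorphic_on g U"
  unfolding cholomorphic_on_def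
proof
  fix x assume x: "x \<in> U"
  with assms(1) obtain D where D:
    "(f has_derivative D) (at x)" "\<And>c v. D (c *\<^sub>C v) = c *\<^sub>C D v"
    unfolding cholomorphic_on_def by metis
  have "(g has_derivative D) (at x)"
    by (rule has_derivative_transform_within_open[OF D(1) assms(2) x]) (simp add: assms(3))
  with D(2) show "\<exists>D. (g has_derivative D) (at x) \<and> (\<forall>c v. D (c *\<^sub>C v) = c *\<^sub>C D v)"
    by blast
qed

section \<open>Holomorphic Lipschitz maps on the unit ball\<close>

text \<open>A map on the open unit ball is represented by its extension by \<open>0\<close> to the whole space. The
  value outside the ball never enters the norm or the holomorphy and Lipschitz conditions.\<close>

typedef (overloaded) ('a, 'b) hol_lip =
  "{f :: 'a::complex_normed_vector \<Rightarrow> 'b::complex_normed_vector.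
      cholomorphic_on f (ball 0 1) \<and> (\<exists>C. C-lipschitz_on (ball 0 1) f) \<and>
      (\<forall>x. x \<notin> ball 0 1 \<longrightarrow> f x = 0)}"
  morphisms hl_apply Abs_hol_lip
  by (rule exI[of _ "\<lambda>_. 0"]) (auto intro!: cholomorphic_on_const exI[of _ 0] lipschitz_onI)

setup_lifting type_definition_hol_lip

text \<open>The least Lipschitz constant on the open unit ball.\<close>

definition lip_const :: "('a::complex_normed_vector \<Rightarrow> 'b::complex_normed_vector) \<Rightarrow> real" where
  "lip_const f = Inf {C. C-lipschitz_on (ball 0 1) f}"

lemma lip_const_le: "C-lipschitz_on (ball 0 1) f \<Longrightarrow> lip_const f \<le> C"
  unfolding lip_const_def
  by (rule cInf_lower) (auto intro!: bdd_belowI[of _ 0] dest: lipschitz_on_nonneg)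

lemma lip_const_lipschitz:
  assumes "C-lipschitz_on (ball 0 1) f"
  shows "(lip_const f)-lipschitz_on (ball 0 1) f"
proof (rule lipschitz_onI)
  let ?S = "{C. C-lipschitz_on (ball 0 1) f}"
  have ne: "?S \<noteq> {}" using assms by blast
  show "0 \<le> lip_const f"
    unfolding lip_const_def using ne
    by (rule cInf_greatest) (auto dest: lipschitz_on_nonneg)
  fix x y :: 'a assume xy: "x \<in> ball 0 1" "y \<in> ball 0 1"
  show "dist (f x) (f y) \<le> lip_const f * dist x y"
  proof (cases "x = y")
    case False
    have "dist (f x) (f y) / dist x y \<le> lip_const f"
      unfolding lip_const_def using ne
    proof (rule cInf_greatest)
      fix D assume "D \<in> ?S"
      then have "dist (f x) (f y) \<le> D * dist x y"
        using xy by (auto dest: lipschitz_onD)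
      then show "dist (f x) (f y) / dist x y \<le> D"
        using False by (simp add: divide_le_eq)
    qed
    then show ?thesis using False by (simp add: divide_le_eq)
  qed simp
qed

lemma hl_lipschitz: "(lip_const (hl_apply f))-lipschitz_on (ball 0 1) (hl_apply f)"
  using hl_apply[of f] lip_const_lipschitz by blast

lemma hl_holomorphic: "cholomorphic_on (hl_apply f) (ball 0 1)"
  using hl_apply[of f] by blast

lemma hl_outside: "x \<notin> ball 0 1 \<Longrightarrow> hl_apply f x = 0"
  using hl_apply[of f] by blast

lemma hl_eqI: "(\<And>x. x \<in> ball 0 1 \<Longrightarrow> hl_apply f x = hl_apply g x) \<Longrightarrow> f = g"
  by (metis ext hl_apply_inject hl_outside)

lemma lipschitz_scaleC:
  "C-lipschitz_on U f \<Longrightarrow> (cmod a * C)-lipschitz_on U (\<lambda>x. a *\<^sub>C f x)"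
proof (rule lipschitz_onI)
  fix x y assume "C-lipschitz_on U f" "x \<in> U" "y \<in> U"
  then have "cmod a * dist (f x) (f y) \<le> cmod a * (C * dist x y)"
    by (intro mult_left_mono) (auto dest: lipschitz_onD)
  moreover have "dist (a *\<^sub>C f x) (a *\<^sub>C f y) = cmod a * dist (f x) (f y)"
    by (simp add: dist_norm norm_scaleC flip: complex_vector.scale_right_diff_distrib)
  ultimately show "dist (a *\<^sub>C f x) (a *\<^sub>C f y) \<le> cmod a * C * dist x y"
    by (simp add: mult.assoc)
qed (auto dest: lipschitz_on_nonneg)

instantiation hol_lip :: (complex_normed_vector, complex_normed_vector) complex_normed_vector
begin

lift_definition zero_hol_lip :: "('a, 'b) hol_lip" is "\<lambda>_. 0"
  by (auto intro!: cholomorphic_on_const exI[of _ 0] lipschitz_onI)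

lift_definition plus_hol_lip :: "('a, 'b) hol_lip \<Rightarrow> ('a, 'b) hol_lip \<Rightarrow> ('a, 'b) hol_lip"
  is "\<lambda>f g x. f x + g x"
  by (auto intro: cholomorphic_on_add lipschitz_on_add)

lift_definition scaleC_hol_lip :: "complex \<Rightarrow> ('a, 'b) hol_lip \<Rightarrow> ('a, 'b) hol_lip"
  is "\<lambda>c f x. c *\<^sub>C f x"
  by (auto intro: cholomorphic_on_scaleC lipschitz_scaleC)

definition scaleR_hol_lip :: "real \<Rightarrow> ('a, 'b) hol_lip \<Rightarrow> ('a, 'b) hol_lip" where
  "scaleR_hol_lip r f = complex_of_real r *\<^sub>C f"

definition uminus_hol_lip :: "('a, 'b) hol_lip \<Rightarrow> ('a, 'b) hol_lip" where
  "uminus_hol_lip f = (- 1) *\<^sub>C f"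

definition minus_hol_lip :: "('a, 'b) hol_lip \<Rightarrow> ('a, 'b) hol_lip \<Rightarrow> ('a, 'b) hol_lip" where
  "minus_hol_lip f g = f + - g"

definition norm_hol_lip :: "('a, 'b) hol_lip \<Rightarrow> real" where
  "norm_hol_lip f = lip_const (hl_apply f) + norm (hl_apply f 0)"

definition dist_hol_lip :: "('a, 'b) hol_lip \<Rightarrow> ('a, 'b) hol_lip \<Rightarrow> real" where
  "dist_hol_lip f g = norm (f - g)"

definition sgn_hol_lip :: "('a, 'b) hol_lip \<Rightarrow> ('a, 'b) hol_lip" where
  "sgn_hol_lip f = inverse (norm f) *\<^sub>R f"

definition uniformity_hol_lip :: "(('a, 'b) hol_lip \<times> ('a, 'b) hol_lip) filter" where
  "uniformity_hol_lip = (INF e\<in>{0<..}. principal {(x, y). dist x y < e})"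

definition open_hol_lip :: "('a, 'b) hol_lip set \<Rightarrow> bool" where
  "open_hol_lip S = (\<forall>x\<in>S. \<forall>\<^sub>F (x', y) in uniformity. x' = x \<longrightarrow> y \<in> S)"

lemma hl_apply_simps:
  "hl_apply (0 :: ('a, 'b) hol_lip) x = 0"
  "hl_apply (f + g :: ('a, 'b) hol_lip) x = hl_apply f x + hl_apply g x"
  "hl_apply (c *\<^sub>C f :: ('a, 'b) hol_lip) x = c *\<^sub>C hl_apply f x"
  "hl_apply (r *\<^sub>R f :: ('a, 'b) hol_lip) x = r *\<^sub>R hl_apply f x"
  "hl_apply (- f :: ('a, 'b) hol_lip) x = - hl_apply f x"
  "hl_apply (f - g :: ('a, 'b) hol_lip) x = hl_apply f x - hl_apply g x"
  by (simp_all add: zero_hol_lip.rep_eq plus_hol_lip.rep_eq scaleC_hol_lip.rep_eq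
      scaleR_hol_lip_def uminus_hol_lip_def minus_hol_lip_def scaleC_of_real scaleC_one)

lemma norm_scaleC_hol_lip: "norm (c *\<^sub>C f) = cmod c * norm (f :: ('a, 'b) hol_lip)"
proof -
  have le: "norm (a *\<^sub>C h) \<le> cmod a * norm h" for a and h :: "('a, 'b) hol_lip"
  proof -
    have "lip_const (hl_apply (a *\<^sub>C h)) \<le> cmod a * lip_const (hl_apply h)"
      by (rule lip_const_le)
        (use lipschitz_scaleC[OF hl_lipschitz] in \<open>simp add: scaleC_hol_lip.rep_eq\<close>)
    then show ?thesis
      by (simp add: norm_hol_lip_def hl_apply_simps norm_scaleC distrib_left)
  qed
  have nn: "0 \<le> norm h" for h :: "('a, 'b) hol_lip"
    using lipschitz_on_nonneg[OF hl_lipschitz[of h]] by (simp add: norm_hol_lip_def)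
  show ?thesis
  proof (cases "c = 0")
    case True
    then show ?thesis using le[of 0 f] nn[of "0 *\<^sub>C f"] by simp
  next
    case False
    have "f = inverse c *\<^sub>C c *\<^sub>C f"
      using False by (intro hl_eqI) (simp add: hl_apply_simps scaleC_scaleC scaleC_one)
    then have "norm f \<le> cmod (inverse c) * norm (c *\<^sub>C f)"
      by (metis le)
    then have "cmod c * norm f \<le> norm (c *\<^sub>C f)"
      using False by (simp add: norm_inverse norm_divide field_simps)
    with le[of c f] show ?thesis by simp
  qed
qed

instance
proof
  fix f g h :: "('a, 'b) hol_lip" and r s :: real and c d :: complex
  show "f + g + h = f + (g + h)" "f + g = g + f" "0 + f = f" "- f + f = 0" "f - g = f + - g"
    "r *\<^sub>R (f + g) = r *\<^sub>R f + r *\<^sub>R g" "(r + s) *\<^sub>R f = r *\<^sub>R f + s *\<^sub>R f"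
    "r *\<^sub>R s *\<^sub>R f = (r * s) *\<^sub>R f" "1 *\<^sub>R f = f"
    "c *\<^sub>C (f + g) = c *\<^sub>C f + c *\<^sub>C g" "(c + d) *\<^sub>C f = c *\<^sub>C f + d *\<^sub>C f"
    "c *\<^sub>C d *\<^sub>C f = (c * d) *\<^sub>C f" "complex_of_real r *\<^sub>C f = r *\<^sub>R f"
    by (rule hl_eqI; simp add: hl_apply_simps algebra_simps scaleC_add_right scaleC_add_left
        scaleC_scaleC scaleC_of_real)+
  show "dist f g = norm (f - g)"
    by (rule dist_hol_lip_def)
  show "sgn f = inverse (norm f) *\<^sub>R f"
    by (rule sgn_hol_lip_def)
  show "norm (c *\<^sub>C f) = cmod c * norm f"
    by (rule norm_scaleC_hol_lip)
  show "norm (r *\<^sub>R f) = \<bar>r\<bar> * norm f"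
    by (simp add: scaleR_hol_lip_def norm_scaleC_hol_lip)
  show "norm f = 0 \<longleftrightarrow> f = 0"
  proof
    assume 0: "norm f = 0"
    have L: "lip_const (hl_apply f) = 0" "hl_apply f 0 = 0"
      using 0 lipschitz_on_nonneg[OF hl_lipschitz[of f]] norm_ge_zero[of "hl_apply f 0"]
      unfolding norm_hol_lip_def by (linarith, simp add: add_nonneg_eq_0_iff)
    show "f = 0"
    proof (rule hl_eqI)
      fix x :: 'a assume "x \<in> ball 0 1"
      then have "dist (hl_apply f x) (hl_apply f 0) \<le> 0"
        using lipschitz_onD[OF hl_lipschitz[of f], of x 0] L(1) by simp
      then show "hl_apply f x = hl_apply (0 :: ('a, 'b) hol_lip) x"
        using L(2) by (simp add: hl_apply_simps)
    qed
  next
    assume "f = 0"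
    then have "f = 0 *\<^sub>C f"
      by (intro hl_eqI) (simp add: hl_apply_simps)
    then show "norm f = 0"
      using norm_scaleC_hol_lip[of 0 f] by simp
  qed
  show "norm (f + g) \<le> norm f + norm g"
  proof -
    have "lip_const (hl_apply (f + g)) \<le> lip_const (hl_apply f) + lip_const (hl_apply g)"
      by (rule lip_const_le)
        (use lipschitz_on_add[OF hl_lipschitz[of f] hl_lipschitz[of g]]
          in \<open>simp add: plus_hol_lip.rep_eq\<close>)
    then show ?thesis
      using norm_triangle_ineq[of "hl_apply f 0" "hl_apply g 0"]
      by (simp add: norm_hol_lip_def hl_apply_simps)
  qed
qed (rule uniformity_hol_lip_def open_hol_lip_def)+

end

text \<open>The Lipschitz extension to the closed unit ball, unique there; the choice only affects points
  outside the closed ball.\<close>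

definition lip_ext :: "('a::complex_normed_vector, 'b::complex_banach) hol_lip \<Rightarrow> 'a \<Rightarrow> 'b" where
  "lip_ext f = (SOME g. (\<exists>C. C-lipschitz_on (cball 0 1) g) \<and> (\<forall>x\<in>ball 0 1. g x = hl_apply f x))"

lemma lip_ext:
  fixes f :: "('a::complex_normed_vector, 'b::complex_banach) hol_lip"
  shows "(\<exists>C. C-lipschitz_on (cball 0 1) (lip_ext f)) \<and> (\<forall>x\<in>ball 0 1. lip_ext f x = hl_apply f x)"
proof -
  obtain g where "(lip_const (hl_apply f))-lipschitz_on (closure (ball 0 1)) g"
    "\<And>x. x \<in> ball 0 1 \<Longrightarrow> g x = hl_apply f x"
    using lipschitz_extend_closure[OF hl_lipschitz] by blast
  then have "\<exists>g. (\<exists>C. C-lipschitz_on (cball 0 1) g) \<and> (\<forall>x\<in>ball 0 1. g x = hl_apply f x)"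
    by auto
  then show ?thesis
    unfolding lip_ext_def by (rule someI_ex)
qed

lemma lip_ext_unique:
  assumes "C-lipschitz_on (cball 0 1) g" "\<And>x. x \<in> ball 0 1 \<Longrightarrow> g x = hl_apply f x"
    and "x \<in> cball 0 1"
  shows "g x = lip_ext f x"
proof -
  obtain D where D: "D-lipschitz_on (cball 0 1) (lip_ext f)"
    "\<And>x. x \<in> ball 0 1 \<Longrightarrow> lip_ext f x = hl_apply f x"
    using lip_ext by blast
  have "x \<in> closure (ball 0 1)"
    using assms(3) by simp
  moreover have "continuous_on (closure (ball 0 1)) (\<lambda>x. g x - lip_ext f x)"
    using assms(1) D(1) by (auto intro!: continuous_on_diff dest: lipschitz_on_continuous_on)
  ultimately have "g x - lip_ext f x = 0"
    by (rule continuous_constant_on_closure[rotated 2]) (simp add: assms(2) D(2))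
  then show ?thesis by simp
qed

section \<open>Bounded holomorphic functions on the unit ball\<close>

typedef (overloaded) 'a hol_inf =
  "{f :: 'a::complex_normed_vector \<Rightarrow> complex.
      cholomorphic_on f (ball 0 1) \<and> bounded (f ` ball 0 1) \<and>
      (\<forall>x. x \<notin> ball 0 1 \<longrightarrow> f x = 0)}"
  morphisms hi_apply Abs_hol_inf
  by (rule exI[of _ "\<lambda>_. 0"]) (auto intro!: cholomorphic_on_const simp: bounded_iff)

setup_lifting type_definition_hol_inf

lemma hi_holomorphic: "cholomorphic_on (hi_apply f) (ball 0 1)"
  using hi_apply[of f] by blast

lemma hi_bounded: "bounded (hi_apply f ` ball 0 1)"
  using hi_apply[of f] by blast

lemma hi_outside: "x \<notin> ball 0 1 \<Longrightarrow> hi_apply f x = 0"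
  using hi_apply[of f] by blast

lemma hi_eqI: "(\<And>x. x \<in> ball 0 1 \<Longrightarrow> hi_apply f x = hi_apply g x) \<Longrightarrow> f = g"
  by (metis ext hi_apply_inject hi_outside)

instantiation hol_inf :: (complex_normed_vector) complex_normed_vector
begin

lift_definition zero_hol_inf :: "'a hol_inf" is "\<lambda>_. 0"
  by (auto intro!: cholomorphic_on_const simp: bounded_iff)

lift_definition plus_hol_inf :: "'a hol_inf \<Rightarrow> 'a hol_inf \<Rightarrow> 'a hol_inf"
  is "\<lambda>f g x. f x + g x"
  by (auto intro: cholomorphic_on_add bounded_plus_comp)

lift_definition scaleC_hol_inf :: "complex \<Rightarrow> 'a hol_inf \<Rightarrow> 'a hol_inf"
  is "\<lambda>c f x. c *\<^sub>C f x"
  using bounded_linear_image[OF _ bounded_linear_scaleC]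
  by (fastforce intro: cholomorphic_on_scaleC simp: image_image)

definition scaleR_hol_inf :: "real \<Rightarrow> 'a hol_inf \<Rightarrow> 'a hol_inf" where
  "scaleR_hol_inf r f = complex_of_real r *\<^sub>C f"

definition uminus_hol_inf :: "'a hol_inf \<Rightarrow> 'a hol_inf" where
  "uminus_hol_inf f = (- 1) *\<^sub>C f"

definition minus_hol_inf :: "'a hol_inf \<Rightarrow> 'a hol_inf \<Rightarrow> 'a hol_inf" where
  "minus_hol_inf f g = f + - g"

definition norm_hol_inf :: "'a hol_inf \<Rightarrow> real" where
  "norm_hol_inf f = (SUP x\<in>ball 0 1. norm (hi_apply f x))"

definition dist_hol_inf :: "'a hol_inf \<Rightarrow> 'a hol_inf \<Rightarrow> real" where
  "dist_hol_inf f g = norm (f - g)"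

definition sgn_hol_inf :: "'a hol_inf \<Rightarrow> 'a hol_inf" where
  "sgn_hol_inf f = inverse (norm f) *\<^sub>R f"

definition uniformity_hol_inf :: "('a hol_inf \<times> 'a hol_inf) filter" where
  "uniformity_hol_inf = (INF e\<in>{0<..}. principal {(x, y). dist x y < e})"

definition open_hol_inf :: "'a hol_inf set \<Rightarrow> bool" where
  "open_hol_inf S = (\<forall>x\<in>S. \<forall>\<^sub>F (x', y) in uniformity. x' = x \<longrightarrow> y \<in> S)"

lemma hi_apply_simps:
  "hi_apply (0 :: 'a hol_inf) x = 0"
  "hi_apply (f + g :: 'a hol_inf) x = hi_apply f x + hi_apply g x"
  "hi_apply (c *\<^sub>C f :: 'a hol_inf) x = c *\<^sub>C hi_apply f x"
  "hi_apply (r *\<^sub>R f :: 'a hol_inf) x = r *\<^sub>R hi_apply f x"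
  "hi_apply (- f :: 'a hol_inf) x = - hi_apply f x"
  "hi_apply (f - g :: 'a hol_inf) x = hi_apply f x - hi_apply g x"
  by (simp_all add: zero_hol_inf.rep_eq plus_hol_inf.rep_eq scaleC_hol_inf.rep_eq
      scaleR_hol_inf_def uminus_hol_inf_def minus_hol_inf_def scaleC_of_real scaleC_one)

lemma hi_norm_le: "x \<in> ball 0 1 \<Longrightarrow> norm (hi_apply f x) \<le> norm (f :: 'a hol_inf)"
  unfolding norm_hol_inf_def using hi_bounded[of f]
  by (intro cSUP_upper) (auto simp: bounded_iff bdd_above_def)

lemma hi_norm_bound:
  "(\<And>x. x \<in> ball 0 1 \<Longrightarrow> norm (hi_apply f x) \<le> B) \<Longrightarrow> norm (f :: 'a hol_inf) \<le> B"
  unfolding norm_hol_inf_def by (rule cSUP_least) auto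

lemma norm_scaleC_hol_inf: "norm (c *\<^sub>C f) = cmod c * norm (f :: 'a hol_inf)"
proof -
  have le: "norm (a *\<^sub>C h) \<le> cmod a * norm h" for a and h :: "'a hol_inf"
    by (rule hi_norm_bound) (simp add: hi_apply_simps norm_scaleC hi_norm_le mult_left_mono)
  have nn: "0 \<le> norm h" for h :: "'a hol_inf"
    using order_trans[OF norm_ge_zero hi_norm_le[of 0 h]] by simp
  show ?thesis
  proof (cases "c = 0")
    case True
    then show ?thesis using le[of 0 f] nn[of "0 *\<^sub>C f"] by simp
  next
    case False
    have "f = inverse c *\<^sub>C c *\<^sub>C f"
      using False by (intro hi_eqI) (simp add: hi_apply_simps scaleC_scaleC scaleC_one)
    then have "norm f \<le> cmod (inverse c) * norm (c *\<^sub>C f)"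
      by (metis le)
    then have "cmod c * norm f \<le> norm (c *\<^sub>C f)"
      using False by (simp add: norm_inverse norm_divide field_simps)
    with le[of c f] show ?thesis by simp
  qed
qed

instance
proof
  fix f g h :: "'a hol_inf" and r s :: real and c d :: complex
  show "f + g + h = f + (g + h)" "f + g = g + f" "0 + f = f" "- f + f = 0" "f - g = f + - g"
    "r *\<^sub>R (f + g) = r *\<^sub>R f + r *\<^sub>R g" "(r + s) *\<^sub>R f = r *\<^sub>R f + s *\<^sub>R f"
    "r *\<^sub>R s *\<^sub>R f = (r * s) *\<^sub>R f" "1 *\<^sub>R f = f"
    "c *\<^sub>C (f + g) = c *\<^sub>C f + c *\<^sub>C g" "(c + d) *\<^sub>C f = c *\<^sub>C f + d *\<^sub>C f"
    "c *\<^sub>C d *\<^sub>C f = (c * d) *\<^sub>C f" "complex_of_real r *\<^sub>C f = r *\<^sub>R f"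
    by (rule hi_eqI; simp add: hi_apply_simps algebra_simps scaleC_add_right scaleC_add_left
        scaleC_scaleC scaleC_of_real)+
  show "dist f g = norm (f - g)"
    by (rule dist_hol_inf_def)
  show "sgn f = inverse (norm f) *\<^sub>R f"
    by (rule sgn_hol_inf_def)
  show "norm (c *\<^sub>C f) = cmod c * norm f"
    by (rule norm_scaleC_hol_inf)
  show "norm (r *\<^sub>R f) = \<bar>r\<bar> * norm f"
    by (simp add: scaleR_hol_inf_def norm_scaleC_hol_inf)
  show "norm f = 0 \<longleftrightarrow> f = 0"
  proof
    assume "norm f = 0"
    then show "f = 0"
      using hi_norm_le[of _ f] by (intro hi_eqI) (simp add: hi_apply_simps)
  next
    assume "f = 0"
    then have "f = 0 *\<^sub>C f"
      by (intro hi_eqI) (simp add: hi_apply_simps)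
    then show "norm f = 0"
      using norm_scaleC_hol_inf[of 0 f] by simp
  qed
  show "norm (f + g) \<le> norm f + norm g"
    by (rule hi_norm_bound)
      (simp add: hi_apply_simps, meson add_mono hi_norm_le mem_ball_0 norm_triangle_le)
qed (rule uniformity_hol_inf_def open_hol_inf_def)+

end

section \<open>Composition operators\<close>

text \<open>The operators \<open>f \<mapsto> f \<circ> \<phi>\<close>. They are meaningful only if \<open>\<phi>\<close> maps the open unit ball into
  the open unit ball; otherwise the result is set to \<open>0\<close>.\<close>

lift_definition comp_hol_lip ::
  "('y::complex_normed_vector, 'x::complex_normed_vector) hol_lip \<Rightarrow>
   ('x, 'z::complex_normed_vector) hol_lip \<Rightarrow> ('y, 'z) hol_lip"
  is "\<lambda>\<phi> f y. if \<phi> ` ball 0 1 \<subseteq> ball 0 1 \<and> y \<in> ball 0 1 then f (\<phi> y) else 0"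
proof -
  fix \<phi> :: "'y \<Rightarrow> 'x" and f :: "'x \<Rightarrow> 'z"
  let ?g = "\<lambda>y. if \<phi> ` ball 0 1 \<subseteq> ball 0 1 \<and> y \<in> ball 0 1 then f (\<phi> y) else 0"
  assume \<phi>: "cholomorphic_on \<phi> (ball 0 1) \<and> (\<exists>C. C-lipschitz_on (ball 0 1) \<phi>) \<and>
      (\<forall>x. x \<notin> ball 0 1 \<longrightarrow> \<phi> x = 0)"
    and f: "cholomorphic_on f (ball 0 1) \<and> (\<exists>C. C-lipschitz_on (ball 0 1) f) \<and>
      (\<forall>x. x \<notin> ball 0 1 \<longrightarrow> f x = 0)"
  have "cholomorphic_on ?g (ball 0 1) \<and> (\<exists>C. C-lipschitz_on (ball 0 1) ?g)"
  proof (cases "\<phi> ` ball 0 1 \<subseteq> ball 0 1")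
    case True
    from \<phi> f obtain C D where C: "C-lipschitz_on (ball 0 1) \<phi>" and D: "D-lipschitz_on (ball 0 1) f"
      by blast
    have "cholomorphic_on (\<lambda>y. f (\<phi> y)) (ball 0 1)"
      using \<phi> f True by (blast intro: cholomorphic_on_compose)
    then have "cholomorphic_on ?g (ball 0 1)"
      by (rule cholomorphic_on_cong) (use True in auto)
    moreover have "(D * C)-lipschitz_on (ball 0 1) (\<lambda>y. f (\<phi> y))"
      using C lipschitz_on_subset[OF D True] by (rule lipschitz_on_compose2)
    then have "(D * C)-lipschitz_on (ball 0 1) ?g"
      by (rule lipschitz_on_transform) (use True in auto)
    ultimately show ?thesis by blast
  next
    case False
    then show ?thesis
      by (auto simp only: simp_thms if_False intro!: cholomorphic_on_const exI[of _ 0] lipschitz_onI) auto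
  qed
  then show "cholomorphic_on ?g (ball 0 1) \<and> (\<exists>C. C-lipschitz_on (ball 0 1) ?g) \<and>
      (\<forall>x. x \<notin> ball 0 1 \<longrightarrow> ?g x = 0)"
    by simp
qed

lift_definition comp_hol_inf ::
  "('y::complex_normed_vector, 'x::complex_normed_vector) hol_lip \<Rightarrow> 'x hol_inf \<Rightarrow> 'y hol_inf"
  is "\<lambda>\<phi> f y. if \<phi> ` ball 0 1 \<subseteq> ball 0 1 \<and> y \<in> ball 0 1 then f (\<phi> y) else 0"
proof -
  fix \<phi> :: "'y \<Rightarrow> 'x" and f :: "'x \<Rightarrow> complex"
  let ?g = "\<lambda>y. if \<phi> ` ball 0 1 \<subseteq> ball 0 1 \<and> y \<in> ball 0 1 then f (\<phi> y) else 0"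
  assume \<phi>: "cholomorphic_on \<phi> (ball 0 1) \<and> (\<exists>C. C-lipschitz_on (ball 0 1) \<phi>) \<and>
      (\<forall>x. x \<notin> ball 0 1 \<longrightarrow> \<phi> x = 0)"
    and f: "cholomorphic_on f (ball 0 1) \<and> bounded (f ` ball 0 1) \<and>
      (\<forall>x. x \<notin> ball 0 1 \<longrightarrow> f x = 0)"
  have "cholomorphic_on ?g (ball 0 1) \<and> bounded (?g ` ball 0 1)"
  proof (cases "\<phi> ` ball 0 1 \<subseteq> ball 0 1")
    case True
    have "cholomorphic_on (\<lambda>y. f (\<phi> y)) (ball 0 1)"
      using \<phi> f True by (blast intro: cholomorphic_on_compose)
    then have "cholomorphic_on ?g (ball 0 1)"
      by (rule cholomorphic_on_cong) (use True in auto)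
    moreover have "?g ` ball 0 1 \<subseteq> f ` ball 0 1"
      using True by auto
    then have "bounded (?g ` ball 0 1)"
      using f bounded_subset by blast
    ultimately show ?thesis by blast
  next
    case False
    then show ?thesis
      by (auto simp only: simp_thms if_False bounded_iff intro!: cholomorphic_on_const)
  qed
  then show "cholomorphic_on ?g (ball 0 1) \<and> bounded (?g ` ball 0 1) \<and>
      (\<forall>x. x \<notin> ball 0 1 \<longrightarrow> ?g x = 0)"
    by simp
qed

lemma comp_hol_lip_apply:
  "hl_apply \<phi> ` ball 0 1 \<subseteq> ball 0 1 \<Longrightarrow> y \<in> ball 0 1 \<Longrightarrow>
    hl_apply (comp_hol_lip \<phi> f) y = hl_apply f (hl_apply \<phi> y)"
  by (simp add: comp_hol_lip.rep_eq)

lemma comp_hol_inf_apply: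
  "hl_apply \<phi> ` ball 0 1 \<subseteq> ball 0 1 \<Longrightarrow> y \<in> ball 0 1 \<Longrightarrow>
    hi_apply (comp_hol_inf \<phi> f) y = hi_apply f (hl_apply \<phi> y)"
  by (simp add: comp_hol_inf.rep_eq)

lemma bounded_clinear_comp_hol_lip:
  assumes "hl_apply \<phi> ` ball 0 1 \<subseteq> ball 0 1"
  shows "bounded_clinear (comp_hol_lip \<phi>)"
  unfolding bounded_clinear_def
proof
  note [simp] = hl_apply_simps comp_hol_lip_apply[OF assms]
  show "Vector_Spaces.linear scaleC scaleC (comp_hol_lip \<phi>)"
    by unfold_locales (rule hl_eqI; simp)+
  have "norm (comp_hol_lip \<phi> f) \<le> (lip_const (hl_apply \<phi>) + 1) * norm f" for f
  proof -
    let ?L = "lip_const (hl_apply \<phi>)" and ?M = "lip_const (hl_apply f)"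
    have L0: "0 \<le> ?L" and M0: "0 \<le> ?M"
      using hl_lipschitz lipschitz_on_nonneg by blast+
    have p0: "hl_apply \<phi> 0 \<in> ball 0 1"
      using assms by (meson centre_in_ball image_subset_iff zero_less_one)
    have "(?M * ?L)-lipschitz_on (ball 0 1) (\<lambda>y. hl_apply f (hl_apply \<phi> y))"
      by (rule lipschitz_on_compose2[OF hl_lipschitz lipschitz_on_subset[OF hl_lipschitz assms]])
    then have "(?M * ?L)-lipschitz_on (ball 0 1) (hl_apply (comp_hol_lip \<phi> f))"
      by (rule lipschitz_on_transform) simp
    then have 1: "lip_const (hl_apply (comp_hol_lip \<phi> f)) \<le> ?M * ?L"
      by (rule lip_const_le)
    have "dist (hl_apply f (hl_apply \<phi> 0)) (hl_apply f 0) \<le> ?M * dist (hl_apply \<phi> 0) 0"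
      by (rule lipschitz_onD[OF hl_lipschitz p0]) simp
    also have "\<dots> \<le> ?M * 1"
      using p0 M0 by (intro mult_left_mono) auto
    finally have "norm (hl_apply f (hl_apply \<phi> 0)) \<le> ?M + norm (hl_apply f 0)"
      using norm_triangle_sub[of "hl_apply f (hl_apply \<phi> 0)" "hl_apply f 0"]
      by (simp add: dist_norm)
    with 1 have "norm (comp_hol_lip \<phi> f) \<le> ?M * ?L + (?M + norm (hl_apply f 0))"
      by (simp add: norm_hol_lip_def)
    also have "\<dots> \<le> (?L + 1) * norm f"
      using L0 by (simp add: norm_hol_lip_def algebra_simps)
    finally show ?thesis .
  qed
  then show "\<exists>K. \<forall>f. norm (comp_hol_lip \<phi> f) \<le> K * norm f"
    by blast
qed

lemma bounded_clinear_comp_hol_inf: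
  assumes "hl_apply \<phi> ` ball 0 1 \<subseteq> ball 0 1"
  shows "bounded_clinear (comp_hol_inf \<phi>)"
  unfolding bounded_clinear_def
proof
  note [simp] = hi_apply_simps comp_hol_inf_apply[OF assms]
  show "Vector_Spaces.linear scaleC scaleC (comp_hol_inf \<phi>)"
    by unfold_locales (rule hi_eqI; simp)+
  have "norm (comp_hol_inf \<phi> f) \<le> 1 * norm f" for f
    using assms by (intro hi_norm_bound) (auto intro!: hi_norm_le)
  then show "\<exists>K. \<forall>f. norm (comp_hol_inf \<phi> f) \<le> K * norm f"
    by blast
qed

end

theory Submission
  imports Defs "HOL-Complex_Analysis.Conformal_Mappings"
begin

text \<open>Write \<open>C\<close> for the composition operator. Every step is about finite nets. The key fact is that a bounded
matrix \<open>q a b\<close> has finite nets for its rows, uniformly in the column index, if and only if it has them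
for its columns (\<open>finite_net_transpose\<close>, the combinatorial core of Schauder's theorem on adjoints and
of the Arzela-Ascoli theorem). It is applied to the evaluations \<open>q f y = f (\<phi> y)\<close>.

S1 implies S2. A compact operator is not bounded below on a copy of \<open>\<ell>\<^sub>\<infinity>\<close>, because the unit vectors stay
uniformly separated. Compactness of \<open>C\<close> gives nets for the functions \<open>f \<circ> \<phi>\<close>, hence nets for the points
\<open>\<phi> y\<close> in the metric of uniform distance over the unit ball of functions; by the Hahn-Banach theorem
this metric dominates the norm distance, so \<open>\<phi>\<close> has relatively compact range.

S2 implies S3. Suppose that \<open>\<phi>\<close> has norm 1 at some \<open>y\<^sub>0\<close> of the closed ball, and let \<open>f\<close> be a norming
functional at that value. Along the disc through \<open>y\<^sub>0\<close> one gets a holomorphic self-map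
\<open>h w = f (\<phi> (w y\<^sub>0))\<close> of the unit disc, continuous up to the boundary, with \<open>h 1 = 1\<close>. Schwarz's lemma gives
\<open>1 - Re (h r) \<ge> c (1 - r)\<close>, so by the mean value theorem \<open>h'\<close> is bounded below in modulus at points
\<open>s\<close> tending to 1 (\<open>radial_derivative_large\<close>). Every set of points accumulating at 1 carries a bounded embedding
\<open>a \<mapsto> g' a\<close> of \<open>\<ell>\<^sub>\<infinity>\<close> into the bounded holomorphic functions that is bounded below on that set
(\<open>linf_interpolation\<close>). The primitives \<open>g a\<close> are Lipschitz, and the maps
\<open>x \<mapsto> g a (f x)\<close> form a copy of \<open>\<ell>\<^sub>\<infinity>\<close> that \<open>C\<close> fixes, since the derivative of
\<open>g a \<circ> h\<close> is \<open>g' a (h s) h' s\<close> (\<open>comp_hol_lip_fixes_linf\<close>).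

S3 implies S4. If \<open>Y\<close> is finite-dimensional, its closed ball is compact and the norm of \<open>\<phi>\<close> stays below
some \<open>r < 1\<close>. By the Cauchy estimates bounded holomorphic functions are uniformly Lipschitz on the
ball of radius \<open>r\<close>, so nets for \<open>\<phi> y\<close> transpose to nets for \<open>f \<circ> \<phi>\<close>.

S4 implies S1. If the norm of \<open>\<phi>\<close> were not bounded away from 1, the values of \<open>\<phi>\<close> would accumulate, in the
finite-dimensional space \<open>X\<close>, at a unit vector; the powers of a functional norming it converge to 0
pointwise on the open ball, while their compositions with \<open>\<phi>\<close> keep norm 1, which compactness forbids. So
the norm of \<open>\<phi>\<close> stays below some \<open>r < 1\<close>. The unit ball of Lipschitz functions has finite uniform nets on the totally bounded
ball of \<open>X\<close>, and the Cauchy estimates turn uniform closeness on the unit ball into closeness of Lipschitz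
constants on the ball of radius \<open>r\<close>.\<close>

section \<open>Finite nets\<close>

text \<open>Completeness of the space is a hypothesis about its universe because the function spaces below are
complete for complex-valued functions only, which a class instance cannot express.\<close>

lemma compact_closure_if_finite_nets:
  fixes S :: "'a::metric_space set"
  assumes comp: "complete (UNIV :: 'a set)"
    and nets: "\<And>e. e > 0 \<Longrightarrow> \<exists>k. finite k \<and> S \<subseteq> (\<Union>x\<in>k. ball x e)"
  shows "compact (closure S)"
  unfolding compact_eq_totally_bounded
proof (intro conjI allI impI)
  show "complete (closure S)"
    using complete_closed_subset[OF closed_closure _ comp] by blast
  fix e :: real assume e: "e > 0"
  then obtain k where k: "finite k" "S \<subseteq> (\<Union>x\<in>k. ball x (e/2))"
    using nets[of "e/2"] by auto
  then have "S \<subseteq> (\<Union>x\<in>k. cball x (e/2))"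
    using ball_subset_cball by blast
  then have "closure S \<subseteq> (\<Union>x\<in>k. cball x (e/2))"
    using k(1) by (intro closure_minimal closed_UN) auto
  also have "\<dots> \<subseteq> (\<Union>x\<in>k. ball x e)"
    using e by (intro UN_mono order_refl) auto
  finally show "\<exists>k. finite k \<and> closure S \<subseteq> (\<Union>x\<in>k. ball x e)"
    using k(1) by blast
qed

lemma finite_net_of_compact_closure:
  fixes S :: "'a::metric_space set"
  assumes "compact (closure S)" "e > 0"
  shows "\<exists>k. finite k \<and> k \<subseteq> S \<and> S \<subseteq> (\<Union>x\<in>k. ball x e)"
proof -
  have "closure S \<subseteq> (\<Union>x\<in>S. ball x e)"
    using assms(2) by (auto simp: closure_approachable)
  then obtain k where "k \<subseteq> S" "finite k" "closure S \<subseteq> (\<Union>x\<in>k. ball x e)"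
    using compactE_image[OF assms(1), of S "\<lambda>x. ball x e"] by auto
  then show ?thesis
    using closure_subset[of S] by blast
qed

text \<open>The rows are replaced by finitely many of them up to a small error. A column then only matters
through its entries in these rows, which lie in a disc, hence through a function from a finite set to a
finite set of small discs. One column for each such function that occurs is a net.\<close>

lemma finite_net_transpose:
  fixes q :: "'a \<Rightarrow> 'b \<Rightarrow> complex"
  assumes bound: "\<And>a b. a \<in> A \<Longrightarrow> b \<in> B \<Longrightarrow> cmod (q a b) \<le> M"
    and net: "\<And>e. e > 0 \<Longrightarrow>
      \<exists>A0. finite A0 \<and> A0 \<subseteq> A \<and> (\<forall>a\<in>A. \<exists>a0\<in>A0. \<forall>b\<in>B. cmod (q a b - q a0 b) < e)"
    and e: "e > 0"
  shows "\<exists>B0. finite B0 \<and> B0 \<subseteq> B \<and> (\<forall>b\<in>B. \<exists>b0\<in>B0. \<forall>a\<in>A. cmod (q a b - q a b0) < e)"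
proof -
  obtain A0 where A0: "finite A0" "A0 \<subseteq> A"
    "\<And>a. a \<in> A \<Longrightarrow> \<exists>a0\<in>A0. \<forall>b\<in>B. cmod (q a b - q a0 b) < e/4"
    using net[of "e/4"] e by auto
  obtain C where C: "finite C" "cball (0::complex) M \<subseteq> (\<Union>c\<in>C. ball c (e/4))"
    using compact_cball[of "0::complex" M] e unfolding compact_eq_totally_bounded
    by (metis zero_less_divide_iff zero_less_numeral)
  have "\<exists>c. c \<in> C \<and> dist c (q a b) < e/4" if "a \<in> A0" "b \<in> B" for a b
    using bound[of a b] that A0(2) C(2) by (force simp: subset_iff)
  then obtain c where c: "\<And>a b. a \<in> A0 \<Longrightarrow> b \<in> B \<Longrightarrow> c a b \<in> C \<and> dist (c a b) (q a b) < e/4"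
    by metis
  \<comment> \<open>Columns with equal signature \<open>s\<close> are close in all of the selected rows.\<close>
  define s where "s b = (\<lambda>a\<in>A0. c a b)" for b
  have "s ` B \<subseteq> A0 \<rightarrow>\<^sub>E C"
    using c by (auto simp: s_def)
  then have fin: "finite (s ` B)"
    using finite_PiE[OF A0(1), of "\<lambda>_. C"] C(1) finite_subset by blast
  show ?thesis
  proof (intro exI[of _ "inv_into B s ` s ` B"] conjI ballI)
    show "finite (inv_into B s ` s ` B)"
      using fin by simp
    show "inv_into B s ` s ` B \<subseteq> B"
      by (auto intro: inv_into_into)
    fix b assume b: "b \<in> B"
    define b0 where "b0 = inv_into B s (s b)"
    have b0: "b0 \<in> B" "s b0 = s b"
      using b by (auto simp: b0_def inv_into_into f_inv_into_f)
    have "cmod (q a b - q a b0) < e" if a: "a \<in> A" for a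
    proof -
      obtain a0 where a0: "a0 \<in> A0" "\<And>b. b \<in> B \<Longrightarrow> cmod (q a b - q a0 b) < e/4"
        using A0(3)[OF a] by blast
      have "c a0 b = c a0 b0"
        using fun_cong[OF b0(2), of a0] a0(1) by (simp add: s_def)
      then have "dist (c a0 b) (q a0 b) < e/4" "dist (c a0 b) (q a0 b0) < e/4"
        using c[OF a0(1) b] c[OF a0(1) b0(1)] by auto
      moreover have "dist (q a b) (q a0 b) < e/4" "dist (q a b0) (q a0 b0) < e/4"
        using a0(2)[OF b] a0(2)[OF b0(1)] by (auto simp: dist_norm)
      ultimately have "dist (q a b) (q a b0) < e"
        by metric
      then show ?thesis by (simp add: dist_norm)
    qed
    then show "\<exists>b0\<in>inv_into B s ` s ` B. \<forall>a\<in>A. cmod (q a b - q a b0) < e"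
      using b unfolding b0_def by blast
  qed
qed

section \<open>The Hahn-Banach theorem\<close>

text \<open>The theorem is obtained from minimal sublinear functionals: Zorn's lemma is applied to functionals
on the whole space, and minimality forces linearity, so no partially defined extensions occur.\<close>

definition sublinear :: "('a::real_vector \<Rightarrow> real) \<Rightarrow> bool" where
  "sublinear p \<longleftrightarrow> (\<forall>x y. p (x + y) \<le> p x + p y) \<and> (\<forall>r x. r \<ge> 0 \<longrightarrow> p (r *\<^sub>R x) = r * p x)"

lemma sublinear_ge_neg:
  assumes "sublinear p" shows "- p (- x) \<le> p x"
proof -
  have "p 0 = 0"
    using assms unfolding sublinear_def by (metis mult_zero_left order_refl scaleR_zero_left)
  moreover have "p (x + - x) \<le> p x + p (- x)"
    using assms unfolding sublinear_def by blast
  ultimately show ?thesis by simp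
qed

text \<open>The witness \<open>q x = inf {p (x + t v) - t p v | t \<ge> 0}\<close> pushes \<open>p\<close> down as far as possible in the direction
\<open>- v\<close>. It serves twice: it shows that a minimal sublinear functional is odd, and it makes the functional
found below a norm attain the norm at a given vector.\<close>

lemma sublinear_tilt:
  fixes p :: "'a::real_vector \<Rightarrow> real"
  assumes p: "sublinear p"
  obtains q where "sublinear q" "q \<le> p" "q (- v) \<le> - p v"
proof
  let ?A = "\<lambda>x. (\<lambda>t. p (x + t *\<^sub>R v) - t * p v) ` {0..}"
  define q where "q x = Inf (?A x)" for x
  have add: "p (x + y) \<le> p x + p y" for x y
    using p by (auto simp: sublinear_def)
  have scale: "p (r *\<^sub>R x) = r * p x" if "r \<ge> 0" for r x
    using p that by (auto simp: sublinear_def)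
  have lower: "- p (- x) \<le> p (x + t *\<^sub>R v) - t * p v" if "t \<ge> 0" for x t
    using add[of "x + t *\<^sub>R v" "- x"] scale[OF that, of v] by simp
  have bdd: "bdd_below (?A x)" for x
    using lower by (auto intro!: bdd_belowI[of _ "- p (- x)"])
  have q_le: "q x \<le> p (x + t *\<^sub>R v) - t * p v" if "t \<ge> 0" for x t
    unfolding q_def using that by (intro cInf_lower bdd) auto
  have q_ge: "c \<le> q x" if "\<And>t. t \<ge> 0 \<Longrightarrow> c \<le> p (x + t *\<^sub>R v) - t * p v" for c x
    unfolding q_def using that by (intro cInf_greatest) auto
  show "q \<le> p"
    using q_le[of 0] by (auto simp: le_fun_def)
  show "q (- v) \<le> - p v"
    using q_le[of 1 "- v"] scale[of 0 v] by simp
  show "sublinear q"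
    unfolding sublinear_def
  proof (intro conjI allI impI)
    fix x y
    have "q (x + y) - q y \<le> p (x + s *\<^sub>R v) - s * p v" if s: "s \<ge> 0" for s
    proof -
      have "q (x + y) - (p (x + s *\<^sub>R v) - s * p v) \<le> q y"
      proof (rule q_ge)
        fix t :: real assume t: "t \<ge> 0"
        have "q (x + y) \<le> p (x + y + (s + t) *\<^sub>R v) - (s + t) * p v"
          using s t by (intro q_le) simp
        also have "\<dots> \<le> p (x + s *\<^sub>R v) + p (y + t *\<^sub>R v) - (s + t) * p v"
          using add[of "x + s *\<^sub>R v" "y + t *\<^sub>R v"] by (simp add: algebra_simps)
        finally show "q (x + y) - (p (x + s *\<^sub>R v) - s * p v) \<le> p (y + t *\<^sub>R v) - t * p v"
          by (simp add: algebra_simps)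
      qed
      then show ?thesis by simp
    qed
    then have "q (x + y) - q y \<le> q x"
      by (rule q_ge)
    then show "q (x + y) \<le> q x + q y" by simp
  next
    fix r :: real and x assume r: "r \<ge> 0"
    have le: "q (r *\<^sub>R x) \<le> r * q x" if r: "r > 0" for r x
    proof -
      have "q (r *\<^sub>R x) / r \<le> q x"
      proof (rule q_ge)
        fix t :: real assume t: "t \<ge> 0"
        have "q (r *\<^sub>R x) \<le> p (r *\<^sub>R x + (r * t) *\<^sub>R v) - (r * t) * p v"
          using r t by (intro q_le) simp
        also have "\<dots> = r * (p (x + t *\<^sub>R v) - t * p v)"
          using scale[of r "x + t *\<^sub>R v"] r by (simp add: scaleR_add_right right_diff_distrib)
        finally show "q (r *\<^sub>R x) / r \<le> p (x + t *\<^sub>R v) - t * p v"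
          using r by (simp add: divide_le_eq mult.commute)
      qed
      then show ?thesis using r by (simp add: divide_le_eq mult.commute)
    qed
    show "q (r *\<^sub>R x) = r * q x"
    proof (cases "r = 0")
      case True
      have "q 0 = 0"
      proof (rule antisym)
        show "q 0 \<le> 0" using q_le[of 0 0] scale[of 0 0] by simp
        show "0 \<le> q 0" by (rule q_ge) (simp add: scale)
      qed
      then show ?thesis using True by simp
    next
      case False
      with r have r: "r > 0" by simp
      have "q x \<le> inverse r * q (r *\<^sub>R x)"
        using le[of "inverse r" "r *\<^sub>R x"] r by simp
      then have "r * q x \<le> q (r *\<^sub>R x)"
        using r by (simp add: field_simps)
      with le[OF r] show ?thesis by (rule antisym)
    qed
  qed
qed

text \<open>The infimum of a chain of sublinear functionals below \<open>P\<close> is sublinear; it is finite because each member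
is at least \<open>- P (- x)\<close> at \<open>x\<close>. A minimal member is odd by tilting, hence additive.\<close>

lemma linear_below_sublinear:
  fixes P :: "'a::real_vector \<Rightarrow> real"
  assumes P: "sublinear P"
  obtains f where "linear f" "f \<le> P"
proof -
  let ?A = "{p. sublinear p \<and> p \<le> P}"
  have "\<exists>m\<in>?A. \<forall>a\<in>?A. m \<ge> a \<longrightarrow> a = m"
  proof (rule predicate_Zorn)
    show "partial_order_on ?A (relation_of (\<ge>) ?A)"
      by (rule partial_order_on_relation_ofI) auto
    fix C assume C: "C \<in> Chains (relation_of (\<ge>) ?A)"
    then have CA: "p \<in> ?A" if "p \<in> C" for p
      using that by (auto simp: Chains_def relation_of_def)
    have chain: "p \<le> p' \<or> p' \<le> p" if "p \<in> C" "p' \<in> C" for p p'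
      using C that by (auto simp: Chains_def relation_of_def)
    show "\<exists>u\<in>?A. \<forall>a\<in>C. u \<le> a"
    proof (cases "C = {}")
      case True
      then show ?thesis using P by auto
    next
      case False
      define u where "u x = Inf ((\<lambda>p. p x) ` C)" for x
      have lower: "- P (- x) \<le> p x" if "p \<in> C" for p x
        using CA[OF that] sublinear_ge_neg[of p x] by (auto simp: le_fun_def) (metis neg_le_iff_le order_trans)
      have u_le: "u x \<le> p x" if "p \<in> C" for p x
        unfolding u_def using that lower
        by (intro cInf_lower) (auto intro!: bdd_belowI[of _ "- P (- x)"])
      have u_ge: "c \<le> u x" if "\<And>p. p \<in> C \<Longrightarrow> c \<le> p x" for c x
        unfolding u_def using that False by (intro cInf_greatest) auto
      have "sublinear u"
        unfolding sublinear_def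
      proof (intro conjI allI impI)
        fix x y
        have "u (x + y) - u y \<le> p x" if p: "p \<in> C" for p
        proof -
          have "u (x + y) - p x \<le> u y"
          proof (rule u_ge)
            fix p' assume p': "p' \<in> C"
            have "\<exists>r\<in>C. r \<le> p \<and> r \<le> p'"
              using chain[OF p p'] p p' by blast
            then obtain r where r: "r \<in> C" "r \<le> p" "r \<le> p'" by blast
            have "u (x + y) \<le> r (x + y)" using r(1) by (rule u_le)
            also have "\<dots> \<le> r x + r y" using CA[OF r(1)] by (simp add: sublinear_def)
            also have "\<dots> \<le> p x + p' y" using r(2,3) by (intro add_mono) (auto simp: le_fun_def)
            finally show "u (x + y) - p x \<le> p' y" by simp
          qed
          then show ?thesis by simp
        qed
        then have "u (x + y) - u y \<le> u x" by (rule u_ge)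
        then show "u (x + y) \<le> u x + u y" by simp
      next
        fix r :: real and x assume r: "r \<ge> 0"
        have hom: "p (r *\<^sub>R x) = r * p x" if "p \<in> C" for p
          using CA[OF that] r by (simp add: sublinear_def)
        show "u (r *\<^sub>R x) = r * u x"
        proof (cases "r = 0")
          case True
          have "(\<lambda>p. p 0) ` C = {0}"
            using hom True \<open>C \<noteq> {}\<close> by (force simp: image_iff)
          then have "u 0 = 0"
            by (simp add: u_def)
          then show ?thesis using True by simp
        next
          case False
          with r have r: "r > 0" by simp
          show ?thesis
          proof (rule antisym)
            have "u (r *\<^sub>R x) / r \<le> u x"
              using u_le[of _ "r *\<^sub>R x"] hom r by (intro u_ge) (auto simp: divide_le_eq mult.commute)
            then show "u (r *\<^sub>R x) \<le> r * u x" using r by (simp add: divide_le_eq mult.commute)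
            show "r * u x \<le> u (r *\<^sub>R x)"
            proof (rule u_ge)
              fix p assume p: "p \<in> C"
              show "r * u x \<le> p (r *\<^sub>R x)"
                using u_le[OF p, of x] hom[OF p] r by simp
            qed
          qed
        qed
      qed
      moreover have "u \<le> P"
      proof -
        obtain p where p: "p \<in> C" using False by blast
        then have "p \<le> P" using CA by blast
        with u_le[OF p] show ?thesis by (auto simp: le_fun_def intro: order_trans)
      qed
      ultimately show ?thesis
        using u_le by (auto simp: le_fun_def)
    qed
  qed
  then obtain m where m: "sublinear m" "m \<le> P"
    and min: "\<And>a. sublinear a \<Longrightarrow> a \<le> m \<Longrightarrow> a = m"
    by (auto intro: order_trans)
  have odd: "m (- v) = - m v" for v
  proof -
    obtain q where "sublinear q" "q \<le> m" "q (- v) \<le> - m v"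
      using sublinear_tilt[OF m(1)] by blast
    with min have "m (- v) \<le> - m v" by metis
    with sublinear_ge_neg[OF m(1), of v] show ?thesis by simp
  qed
  have "linear m"
  proof (rule linearI)
    fix x y
    have "m (x + y) \<le> m x + m y" "m (- x + - y) \<le> m (- x) + m (- y)"
      using m(1) unfolding sublinear_def by blast+
    then show "m (x + y) = m x + m y"
      using odd[of "x + y"] odd[of x] odd[of y] by simp
  next
    fix r x
    have pos: "m (s *\<^sub>R x) = s * m x" if "s \<ge> 0" for s
      using m(1) that by (simp add: sublinear_def)
    show "m (r *\<^sub>R x) = r *\<^sub>R m x"
    proof (cases "r \<ge> 0")
      case False
      then show ?thesis using pos[of "- r"] odd[of "r *\<^sub>R x"] by simp
    qed (simp add: pos)
  qed
  with m(2) that show ?thesis by blast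
qed

text \<open>A real functional \<open>g\<close> below the norm has the complexification \<open>f v = g v - \<i> g (\<i> v)\<close>. Rotating \<open>v\<close> until
\<open>f v\<close> is real and nonnegative shows that \<open>f\<close> has the same bound. Starting Zorn's lemma below the norm tilted at
\<open>x\<close> makes \<open>g\<close> norming at \<open>x\<close>.\<close>

lemma Hahn_Banach_norming_functional:
  fixes x :: "'a::complex_normed_vector"
  obtains f :: "'a \<Rightarrow> complex" where
    "\<And>u v. f (u + v) = f u + f v" "\<And>c v. f (c *\<^sub>C v) = c * f v"
    "\<And>v. cmod (f v) \<le> norm v" "f x = of_real (norm x)"
proof -
  have norm: "sublinear (norm :: 'a \<Rightarrow> real)"
    by (simp add: sublinear_def norm_triangle_ineq)
  obtain q where q: "sublinear q" "q \<le> norm" "q (- x) \<le> - norm x"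
    using sublinear_tilt[OF norm] by blast
  obtain g where g: "linear g" "g \<le> q"
    using linear_below_sublinear[OF q(1)] by blast
  have g_le: "g v \<le> norm v" for v
    using g(2) q(2) by (auto simp: le_fun_def intro: order_trans)
  have g_x: "norm x \<le> g x"
  proof -
    have "g (- x) \<le> - norm x" using g(2) q(3) by (auto simp: le_fun_def intro: order_trans)
    then show ?thesis using linear_neg[OF g(1), of x] by simp
  qed
  define f where "f v = Complex (g v) (- g (\<i> *\<^sub>C v))" for v
  have add: "f (u + v) = f u + f v" for u v
    by (simp add: f_def scaleC_add_right linear_add[OF g(1)] complex_eq_iff)
  have g_split: "g (c *\<^sub>C v) = Re c * g v + Im c * g (\<i> *\<^sub>C v)" for c v
  proof -
    have "c *\<^sub>C v = Re c *\<^sub>R v + Im c *\<^sub>R (\<i> *\<^sub>C v)"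
      unfolding scaleC_of_real[symmetric] scaleC_scaleC scaleC_add_left[symmetric]
      by (metis complex_eq mult.commute)
    then show ?thesis
      by (simp add: linear_add[OF g(1)] linear_scale[OF g(1)])
  qed
  have hom: "f (c *\<^sub>C v) = c * f v" for c v
    using g_split[of c v] g_split[of "\<i> * c" v]
    by (simp add: f_def complex_eq_iff scaleC_scaleC algebra_simps)
  have bound: "cmod (f v) \<le> norm v" for v
  proof (cases "f v = 0")
    case False
    define c where "c = cnj (f v) / of_real (cmod (f v))"
    have "c * f v = of_real (cmod (f v))"
      using False complex_norm_square[of "f v"]
      by (simp add: c_def mult.commute[of "cnj (f v)"] power2_eq_square nonzero_divide_eq_eq)
    then have "of_real (cmod (f v)) = f (c *\<^sub>C v)" by (simp add: hom)
    then have "cmod (f v) = g (c *\<^sub>C v)" by (simp add: f_def complex_eq_iff)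
    also have "\<dots> \<le> norm (c *\<^sub>C v)" by (rule g_le)
    also have "\<dots> = norm v" using False by (simp add: norm_scaleC c_def norm_divide)
    finally show ?thesis .
  qed simp
  have "f x = of_real (norm x)"
  proof -
    have Re: "Re (f x) = norm x" using g_le[of x] g_x by (simp add: f_def)
    have "(cmod (f x))\<^sup>2 \<le> (norm x)\<^sup>2"
      using bound by (intro power_mono) auto
    then have "Im (f x) = 0"
      by (simp add: cmod_power2 Re)
    with Re show ?thesis by (simp add: complex_eq_iff)
  qed
  with add hom bound that show ?thesis by blast
qed

section \<open>Finite dimension\<close>

lemma bounded_linear_scaleC_left: "bounded_linear (\<lambda>c. c *\<^sub>C (a :: 'a::complex_normed_vector))"
proof (rule bounded_linear_intro[of _ "norm a"])
  fix r :: real and c d :: complex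
  show "(c + d) *\<^sub>C a = c *\<^sub>C a + d *\<^sub>C a"
    by (rule scaleC_add_left)
  show "(r *\<^sub>R c) *\<^sub>C a = r *\<^sub>R c *\<^sub>C a"
    by (metis scaleC_of_real scaleC_scaleC scaleR_conv_of_real)
  show "norm (c *\<^sub>C a) \<le> norm c * norm a"
    by (simp add: norm_scaleC)
qed

lemma compact_bounded_combinations:
  fixes B :: "'a::complex_normed_vector set"
  assumes "finite B"
  shows "compact {\<Sum>b\<in>B. c b *\<^sub>C b | c. \<forall>b\<in>B. cmod (c b) \<le> r}"
  using assms
proof (induction B)
  case empty
  have "{\<Sum>b\<in>{}. c b *\<^sub>C b | c :: 'a \<Rightarrow> complex. \<forall>b\<in>{}. cmod (c b) \<le> r} = {0 :: 'a}" by auto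
  then show ?case by (metis compact_sing)
next
  case (insert a B)
  let ?K = "{\<Sum>b\<in>B. c b *\<^sub>C b | c. \<forall>b\<in>B. cmod (c b) \<le> r}"
  let ?add = "\<lambda>p :: complex \<times> 'a. fst p *\<^sub>C a + snd p"
  have "compact (?add ` (cball 0 r \<times> ?K))"
    using insert.IH
    by (intro compact_continuous_image compact_Times)
      (auto intro!: continuous_intros bounded_linear.continuous_on[OF bounded_linear_scaleC_left])
  also have "?add ` (cball 0 r \<times> ?K) =
      {\<Sum>b\<in>insert a B. c b *\<^sub>C b | c. \<forall>b\<in>insert a B. cmod (c b) \<le> r}" (is "?L = ?R")
  proof (intro equalityI subsetI)
    fix x assume "x \<in> ?L"
    then obtain z c where "x = z *\<^sub>C a + (\<Sum>b\<in>B. c b *\<^sub>C b)" "cmod z \<le> r" "\<forall>b\<in>B. cmod (c b) \<le> r"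
      by auto
    moreover have "(\<Sum>b\<in>B. (c(a := z)) b *\<^sub>C b) = (\<Sum>b\<in>B. c b *\<^sub>C b)"
      using insert.hyps by (intro sum.cong) auto
    ultimately show "x \<in> ?R"
      using insert.hyps by (intro CollectI exI[of _ "c(a := z)"]) auto
  next
    fix x assume "x \<in> ?R"
    then obtain c where c: "x = (\<Sum>b\<in>insert a B. c b *\<^sub>C b)" "\<forall>b\<in>insert a B. cmod (c b) \<le> r"
      by blast
    then have "x = ?add (c a, \<Sum>b\<in>B. c b *\<^sub>C b)"
      using insert.hyps by simp
    moreover have "(\<Sum>b\<in>B. c b *\<^sub>C b) \<in> ?K"
      using c(2) by blast
    ultimately show "x \<in> ?L"
      using c(2) by (intro image_eqI[of _ _ "(c a, \<Sum>b\<in>B. c b *\<^sub>C b)"]) auto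
  qed
  finally show ?case .
qed

text \<open>The combinations of a finite spanning set with coefficients bounded by \<open>n\<close> form compact sets that
cover the space. By Baire's theorem one of them has an interior point, and a translated and rescaled
copy of it contains any given ball.\<close>

lemma finite_cdim_compact_cball:
  assumes "finite_cdim TYPE('a::complex_banach)"
  shows "compact (cball (0::'a) r)"
proof -
  obtain B :: "'a set" where B: "finite B" "complex_vector.span B = UNIV"
    using assms by (auto simp: finite_cdim_def)
  define K where "K n = {\<Sum>b\<in>B. c b *\<^sub>C b | c. \<forall>b\<in>B. cmod (c b) \<le> real n}" for n
  have K: "compact (K n)" for n
    unfolding K_def by (rule compact_bounded_combinations[OF B(1)])
  have cover: "x \<in> (\<Union>n. K n)" for x
  proof -
    obtain c where c: "x = (\<Sum>b\<in>B. c b *\<^sub>C b)"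
      using B complex_vector.span_finite[OF B(1)] by blast
    obtain n where n: "(\<Sum>b\<in>B. cmod (c b)) \<le> real n"
      using real_arch_simple by blast
    have "cmod (c b) \<le> real n" if "b \<in> B" for b
      using member_le_sum[OF that, of "\<lambda>b. cmod (c b)"] B(1) n by simp
    then show ?thesis using c by (auto simp: K_def)
  qed
  have "\<exists>n. interior (K n) \<noteq> {}"
  proof (rule ccontr)
    assume none: "\<nexists>n. interior (K n) \<noteq> {}"
    have "Met_TC.mtopology interior_of \<Union>(range K) = {}"
      using none K by (intro Met_TC.metric_Baire_category_alt)
        (auto simp: complete_UNIV intro: compact_imp_closed)
    moreover have "\<Union>(range K) = UNIV" using cover by blast
    ultimately show False by simp
  qed
  then obtain n x e where e: "e > 0" "ball x e \<subseteq> K n"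
    by (metis all_not_in_conv mem_interior)
  let ?T = "\<lambda>y. (2 * \<bar>r\<bar> / e) *\<^sub>R (y - x)"
  have "compact (?T ` K n)"
    by (intro compact_continuous_image K continuous_intros)
  moreover have "cball 0 r \<subseteq> ?T ` K n"
  proof
    fix y :: 'a assume y: "y \<in> cball 0 r"
    show "y \<in> ?T ` K n"
    proof (cases "r = 0")
      case True
      have "x \<in> K n" using e by auto
      then show ?thesis using True y by (auto simp: image_iff)
    next
      case False
      with y norm_ge_zero[of y] have r: "r > 0" unfolding mem_cball_0 by linarith
      have "x + (e / (2 * r)) *\<^sub>R y \<in> ball x e"
        using y r e(1) by (simp add: dist_norm divide_simps)
      then have "x + (e / (2 * r)) *\<^sub>R y \<in> K n" using e(2) by blast
      moreover have "y = ?T (x + (e / (2 * r)) *\<^sub>R y)"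
        using r e(1) by simp
      ultimately show ?thesis by blast
    qed
  qed
  ultimately show ?thesis
    using closed_Int_compact[OF closed_cball] by (metis inf.absorb_iff1)
qed

section \<open>Isomorphisms onto the image\<close>

lemma bounded_if_continuous_at_0:
  fixes g :: "'a::real_normed_vector \<Rightarrow> 'b::real_normed_vector"
  assumes cont: "continuous_on G g" and G: "0 \<in> G" "\<And>r x. x \<in> G \<Longrightarrow> r *\<^sub>R x \<in> G"
    and hom: "\<And>r x. x \<in> G \<Longrightarrow> g (r *\<^sub>R x) = r *\<^sub>R g x"
  obtains C where "C > 0" "\<And>x. x \<in> G \<Longrightarrow> norm (g x) \<le> C * norm x"
proof -
  have "g 0 = 0" using hom[OF G(1), of 0] by simp
  then obtain d where d: "d > 0" "\<And>x. x \<in> G \<Longrightarrow> norm x < d \<Longrightarrow> norm (g x) < 1"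
    using cont G(1) unfolding continuous_on_iff
    by (metis dist_0_norm dist_commute zero_less_one)
  have "norm (g x) \<le> 2 / d * norm x" if x: "x \<in> G" for x
  proof (cases "x = 0")
    case False
    let ?t = "d / (2 * norm x)"
    have "norm (?t *\<^sub>R x) < d" using False d(1) by simp
    then have "norm (g (?t *\<^sub>R x)) < 1" using G(2)[OF x] d(2) by blast
    then have "?t * norm (g x) < 1" using d(1) by (simp add: hom[OF x] del: times_divide_eq_left)
    then show ?thesis using False d(1) by (simp add: field_simps)
  qed (use \<open>g 0 = 0\<close> in simp)
  then show ?thesis using that[of "2 / d"] d(1) by simp
qed

lemma subspace_scaleR: "complex_vector.subspace G \<Longrightarrow> x \<in> G \<Longrightarrow> r *\<^sub>R x \<in> G"
  using complex_vector.subspace_scale[of G x "of_real r"] by (simp add: scaleC_of_real)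

text \<open>On subspaces, isomorphisms in the topological sense are exactly the linear maps bounded above and
below; the next two lemmas are the two directions.\<close>

lemma clinear_iso_bounds:
  assumes "clinear_iso T G H"
  obtains c C where "c > 0" "C > 0" "\<And>x. x \<in> G \<Longrightarrow> c * norm x \<le> norm (T x)"
    "\<And>x. x \<in> G \<Longrightarrow> norm (T x) \<le> C * norm x"
proof -
  obtain S where GH: "complex_vector.subspace G" "complex_vector.subspace H"
    and hom: "\<And>c x. x \<in> G \<Longrightarrow> T (c *\<^sub>C x) = c *\<^sub>C T x" and S: "homeomorphism G H T S"
    using assms by (auto simp: clinear_iso_def)
  have homR: "T (r *\<^sub>R x) = r *\<^sub>R T x" if "x \<in> G" for r x
    using hom[OF that, of "of_real r"] by (simp add: scaleC_of_real)
  have homS: "S (r *\<^sub>R y) = r *\<^sub>R S y" if y: "y \<in> H" for r y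
  proof -
    have "S y \<in> G" "T (S y) = y" using S y by (auto simp: homeomorphism_def)
    then have "r *\<^sub>R y = T (r *\<^sub>R S y)" by (simp add: homR)
    then show ?thesis
      using S subspace_scaleR[OF GH(1) \<open>S y \<in> G\<close>] by (simp add: homeomorphism_def)
  qed
  obtain C where C: "C > 0" "\<And>x. x \<in> G \<Longrightarrow> norm (T x) \<le> C * norm x"
  proof (rule bounded_if_continuous_at_0[of G T])
    show "continuous_on G T" using S by (simp add: homeomorphism_def)
  qed (use subspace_scaleR[OF GH(1)] homR complex_vector.subspace_0[OF GH(1)] in blast)+
  obtain D where D: "D > 0" "\<And>y. y \<in> H \<Longrightarrow> norm (S y) \<le> D * norm y"
  proof (rule bounded_if_continuous_at_0[of H S])
    show "continuous_on H S" using S by (simp add: homeomorphism_def)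
  qed (use subspace_scaleR[OF GH(2)] homS complex_vector.subspace_0[OF GH(2)] in blast)+
  have "inverse D * norm x \<le> norm (T x)" if "x \<in> G" for x
    using D(2)[of "T x"] S that D(1) by (auto simp: homeomorphism_def field_simps)
  with C D(1) that[of "inverse D" C] show ?thesis by simp
qed

lemma clinear_isoI:
  assumes G: "complex_vector.subspace G"
    and add: "\<And>x y. x \<in> G \<Longrightarrow> y \<in> G \<Longrightarrow> T (x + y) = T x + T y"
    and hom: "\<And>c x. x \<in> G \<Longrightarrow> T (c *\<^sub>C x) = c *\<^sub>C T x"
    and c: "c > 0" "\<And>x. x \<in> G \<Longrightarrow> c * norm x \<le> norm (T x)"
    and C: "\<And>x. x \<in> G \<Longrightarrow> norm (T x) \<le> C * norm x"
  shows "clinear_iso T G (T ` G)"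
proof -
  have diff: "T (x - y) = T x - T y" if "x \<in> G" "y \<in> G" for x y
    using add[OF complex_vector.subspace_diff[OF G that] that(2)] by simp
  have lower: "c * dist x y \<le> dist (T x) (T y)" if "x \<in> G" "y \<in> G" for x y
    using c(2)[OF complex_vector.subspace_diff[OF G that]] diff[OF that] by (simp add: dist_norm)
  have upper: "dist (T x) (T y) \<le> C * dist x y" if "x \<in> G" "y \<in> G" for x y
    using C[OF complex_vector.subspace_diff[OF G that]] diff[OF that] by (simp add: dist_norm)
  have inj: "inj_on T G"
  proof (rule inj_onI)
    fix x y assume "x \<in> G" "y \<in> G" "T x = T y"
    then have "c * dist x y \<le> 0" using lower[of x y] by simp
    then show "x = y" using c(1) by (simp add: mult_le_0_iff)
  qed
  let ?S = "inv_into G T"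
  have "\<bar>C\<bar>-lipschitz_on G T"
  proof (rule lipschitz_onI)
    fix x y assume "x \<in> G" "y \<in> G"
    then have "dist (T x) (T y) \<le> C * dist x y" by (rule upper)
    also have "\<dots> \<le> \<bar>C\<bar> * dist x y" by (intro mult_right_mono) auto
    finally show "dist (T x) (T y) \<le> \<bar>C\<bar> * dist x y" .
  qed simp
  moreover have "(inverse c)-lipschitz_on (T ` G) ?S"
  proof (rule lipschitz_onI)
    fix u v assume "u \<in> T ` G" "v \<in> T ` G"
    then show "dist (?S u) (?S v) \<le> inverse c * dist u v"
      using lower[of "?S u" "?S v"] c(1) by (simp add: inv_into_into f_inv_into_f field_simps)
  qed (use c(1) in simp)
  ultimately have "homeomorphism G (T ` G) T ?S"
    using inj by (auto simp: homeomorphism_def inv_into_f_f f_inv_into_f lipschitz_on_continuous_on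
        inv_into_into image_iff)
  moreover have "complex_vector.subspace (T ` G)"
    unfolding complex_vector.subspace_def
  proof (intro conjI allI ballI)
    show "0 \<in> T ` G"
      using diff[of 0 0] complex_vector.subspace_0[OF G] by (force simp: image_iff)
    show "u + v \<in> T ` G" if "u \<in> T ` G" "v \<in> T ` G" for u v
      using that complex_vector.subspace_add[OF G] by (auto simp flip: add)
    show "k *\<^sub>C u \<in> T ` G" if "u \<in> T ` G" for k u
      using that complex_vector.subspace_scale[OF G] by (auto simp flip: hom)
  qed
  ultimately show ?thesis
    using G add hom by (auto simp: clinear_iso_def)
qed

section \<open>Cauchy estimates and uniform limits\<close>

lemma cholomorphic_on_subset: "cholomorphic_on f U \<Longrightarrow> V \<subseteq> U \<Longrightarrow> cholomorphic_on f V"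
  unfolding cholomorphic_on_def by blast

lemma cholomorphic_on_affine: "cholomorphic_on (\<lambda>c :: complex. x + c *\<^sub>C v) U"
proof -
  have "((\<lambda>c. x + c *\<^sub>C v) has_derivative (\<lambda>h. h *\<^sub>C v)) (at c)" for c :: complex
    using has_derivative_add[OF has_derivative_const
        bounded_linear.has_derivative[OF bounded_linear_scaleC_left has_derivative_ident]]
    by simp
  moreover have "(k *\<^sub>C h) *\<^sub>C v = k *\<^sub>C h *\<^sub>C v" for k h :: complex
    by (simp add: scaleC_complex_def scaleC_scaleC)
  ultimately show ?thesis
    unfolding cholomorphic_on_def by blast
qed

lemma cholomorphic_along_line:
  fixes f :: "'a::complex_normed_vector \<Rightarrow> complex"
  assumes "cholomorphic_on f U" "open V" "\<And>c. c \<in> V \<Longrightarrow> x + c *\<^sub>C v \<in> U"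
  shows "(\<lambda>c. f (x + c *\<^sub>C v)) holomorphic_on V"
  using cholomorphic_on_compose[OF cholomorphic_on_affine assms(1), of x v V] assms(2,3)
  by (simp add: image_subset_iff flip: cholomorphic_on_complex)

text \<open>Cauchy's inequality on the disc of radius \<open>r / (2 \<bar>v\<bar>)\<close> in the complex line through \<open>x\<close> in direction \<open>v\<close>.
Half of the largest possible radius is used, so that the closed disc lies in the domain; this costs the factor 2.\<close>

lemma cholomorphic_derivative_bound:
  fixes f :: "'a::complex_normed_vector \<Rightarrow> complex"
  assumes hol: "cholomorphic_on f (ball x r)" and r: "r > 0"
    and M: "\<And>z. z \<in> ball x r \<Longrightarrow> cmod (f z) \<le> M"
    and D: "(f has_derivative D) (at x)"
  shows "cmod (D v) \<le> 2 * M / r * norm v"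
proof (cases "v = 0")
  case True
  then show ?thesis
    using linear_0[OF has_derivative_linear[OF D]] by simp
next
  case False
  define s where "s = r / (2 * norm v)"
  have s: "s > 0" using r False by (simp add: s_def)
  let ?g = "\<lambda>c. f (x + c *\<^sub>C v)"
  have in_ball: "x + c *\<^sub>C v \<in> ball x r" if "cmod c < 2 * s" for c
    using that False by (simp add: dist_norm norm_scaleC s_def field_simps)
  have hol_g: "?g holomorphic_on ball 0 (2 * s)"
    by (rule cholomorphic_along_line[OF hol]) (use in_ball in auto)
  have "((\<lambda>c. x + c *\<^sub>C v) has_derivative (\<lambda>h. h *\<^sub>C v)) (at (0::complex))"
    using has_derivative_add[OF has_derivative_const
        bounded_linear.has_derivative[OF bounded_linear_scaleC_left has_derivative_ident]]
    by simp
  then have "(?g has_derivative (\<lambda>h. D (h *\<^sub>C v))) (at 0)"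
    by (rule has_derivative_compose) (use D in simp)
  moreover have "?g field_differentiable at 0"
    using hol_g s by (intro holomorphic_on_imp_differentiable_at[of _ "ball 0 (2 * s)"]) auto
  then have "(?g has_derivative (*) (deriv ?g 0)) (at 0)"
    using DERIV_deriv_iff_field_differentiable has_field_derivative_def by blast
  ultimately have "(\<lambda>h. D (h *\<^sub>C v)) = (*) (deriv ?g 0)"
    by (rule has_derivative_unique)
  then have "D v = deriv ?g 0"
    by (metis mult.right_neutral scaleC_one)
  moreover have "cmod ((deriv ^^ 1) ?g 0) \<le> fact 1 * M / s ^ 1"
  proof (rule Cauchy_inequality)
    show "?g holomorphic_on ball 0 s"
      using hol_g by (rule holomorphic_on_subset) (use s in auto)
    show "continuous_on (cball 0 s) ?g"
      using hol_g by (intro holomorphic_on_imp_continuous_on, elim holomorphic_on_subset) (use s in auto)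
    show "cmod (?g c) \<le> M" if "cmod (0 - c) = s" for c
      using that s by (intro M in_ball) simp
  qed (rule s)
  ultimately show ?thesis
    using False r by (simp add: s_def field_simps)
qed

lemma cholomorphic_bounded_imp_lipschitz:
  fixes f :: "'a::complex_normed_vector \<Rightarrow> complex"
  assumes hol: "cholomorphic_on f U" and M: "\<And>z. z \<in> U \<Longrightarrow> cmod (f z) \<le> M"
    and S: "convex S" "\<And>x. x \<in> S \<Longrightarrow> ball x r \<subseteq> U" and r: "r > 0"
    and xy: "x \<in> S" "y \<in> S"
  shows "cmod (f x - f y) \<le> 2 * M / r * norm (x - y)"
proof -
  have SU: "z \<in> U" if "z \<in> S" for z
    using S(2)[OF that] r by auto
  obtain D where D: "\<And>z. z \<in> U \<Longrightarrow> (f has_derivative D z) (at z)"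
    using hol unfolding cholomorphic_on_def by metis
  show ?thesis
  proof (rule differentiable_bound[OF S(1) _ _ xy])
    fix z assume z: "z \<in> S"
    show "(f has_derivative D z) (at z within S)"
      using D[OF SU[OF z]] by (rule has_derivative_at_withinI)
    show "onorm (D z) \<le> 2 * M / r"
    proof (rule onorm_bound)
      have "0 \<le> M" using M[OF SU[OF z]] norm_ge_zero order_trans by blast
      then show "0 \<le> 2 * M / r" using r by simp
      show "norm (D z v) \<le> 2 * M / r * norm v" for v
        using S(2)[OF z] M
        by (intro cholomorphic_derivative_bound[OF cholomorphic_on_subset[OF hol] r _ D[OF SU[OF z]]]) auto
    qed
  qed
qed

text \<open>Cauchy's estimate for \<open>f m - f n\<close> makes the derivatives uniformly Cauchy on a smaller ball, so the
theorem on differentiating a sequence termwise applies; complex homogeneity of the derivative passes to the limit.\<close>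

lemma cholomorphic_uniform_limit:
  fixes f :: "nat \<Rightarrow> 'a::complex_normed_vector \<Rightarrow> complex"
  assumes hol: "\<And>n. cholomorphic_on (f n) U" and U: "open U"
    and lim: "uniform_limit U f g sequentially"
  shows "cholomorphic_on g U"
  unfolding cholomorphic_on_def
proof
  fix x assume x: "x \<in> U"
  obtain s where s: "s > 0" "ball x s \<subseteq> U"
    using U x by (auto simp: open_contains_ball)
  define r where "r = s / 2"
  have r: "r > 0" using s by (simp add: r_def)
  have near: "ball z r \<subseteq> U" "z \<in> U" if "z \<in> ball x r" for z
  proof -
    have "ball z r \<subseteq> ball x s"
      using that by (intro subsetI) (simp add: r_def, metric)
    with s(2) show "ball z r \<subseteq> U" by blast
    with r show "z \<in> U" by auto
  qed
  have "\<exists>D. \<forall>n. \<forall>z\<in>U. (f n has_derivative D n z) (at z) \<and> (\<forall>c v. D n z (c *\<^sub>C v) = c *\<^sub>C D n z v)"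
    using hol unfolding cholomorphic_on_def by metis
  then obtain D where D: "\<And>n z. z \<in> U \<Longrightarrow> (f n has_derivative D n z) (at z)"
    and D_hom: "\<And>n z c v. z \<in> U \<Longrightarrow> D n z (c *\<^sub>C v) = c *\<^sub>C D n z v"
    by metis
  have D_cauchy: "\<exists>N. \<forall>m\<ge>N. \<forall>n\<ge>N. \<forall>z\<in>ball x r. \<forall>h. cmod (D m z h - D n z h) \<le> e * norm h"
    if e: "e > 0" for e
  proof -
    define d where "d = e * r / 4"
    have d: "d > 0" using e r by (simp add: d_def)
    obtain N where N: "\<And>n z. n \<ge> N \<Longrightarrow> z \<in> U \<Longrightarrow> dist (f n z) (g z) < d"
      using lim d unfolding uniform_limit_iff eventually_sequentially by metis
    have "cmod (D m z h - D n z h) \<le> e * norm h" if mn: "m \<ge> N" "n \<ge> N" and z: "z \<in> ball x r" for m n z h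
    proof -
      have "cholomorphic_on (\<lambda>w. f m w + (- 1) *\<^sub>C f n w) (ball z r)"
        by (intro cholomorphic_on_add cholomorphic_on_scaleC cholomorphic_on_subset[OF hol near(1)[OF z]])
      moreover have "cmod (f m w + (- 1) *\<^sub>C f n w) \<le> 2 * d" if "w \<in> ball z r" for w
      proof -
        have "w \<in> U" using near(1)[OF z] that by blast
        then have "dist (f m w) (f n w) < 2 * d"
          using N[OF mn(1), of w] N[OF mn(2), of w] by metric
        then show ?thesis by (simp add: scaleC_complex_def dist_norm)
      qed
      moreover have "((\<lambda>w. f m w + (- 1) *\<^sub>C f n w) has_derivative (\<lambda>h. D m z h - D n z h)) (at z)"
        using has_derivative_diff[OF D[OF near(2)[OF z]] D[OF near(2)[OF z]]]
        by (simp add: scaleC_complex_def)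
      ultimately have "cmod (D m z h - D n z h) \<le> 2 * (2 * d) / r * norm h"
        using r by (rule_tac cholomorphic_derivative_bound) auto
      then show ?thesis using r by (simp add: d_def)
    qed
    then show ?thesis by blast
  qed
  define D' where "D' z h = lim (\<lambda>n. D n z h)" for z h
  have D'_lim: "(\<lambda>n. D n z h) \<longlonglongrightarrow> D' z h" if z: "z \<in> ball x r" for z h
  proof -
    have "Cauchy (\<lambda>n. D n z h)"
    proof (rule CauchyI)
      fix e :: real assume e: "e > 0"
      have "e / (norm h + 1) > 0" using e by (simp add: add_nonneg_pos)
      then obtain N where "\<forall>m\<ge>N. \<forall>n\<ge>N. \<forall>z\<in>ball x r. \<forall>k. cmod (D m z k - D n z k) \<le> e / (norm h + 1) * norm k"
        using D_cauchy by blast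
      then have "\<forall>m\<ge>N. \<forall>n\<ge>N. cmod (D m z h - D n z h) \<le> e / (norm h + 1) * norm h"
        using z by blast
      moreover have "e / (norm h + 1) * norm h < e"
        using e by (simp add: field_simps add_pos_nonneg)
      ultimately show "\<exists>N. \<forall>m\<ge>N. \<forall>n\<ge>N. norm (D m z h - D n z h) < e"
        using order_le_less_trans by blast
    qed
    then show ?thesis
      unfolding D'_def using Cauchy_convergent convergent_LIMSEQ_iff by blast
  qed
  have "\<exists>g2. \<forall>z\<in>ball x r. (\<lambda>n. f n z) \<longlonglongrightarrow> g2 z \<and> (g2 has_derivative D' z) (at z within ball x r)"
  proof (rule has_derivative_sequence)
    show "(f n has_derivative D n z) (at z within ball x r)" if "z \<in> ball x r" for n z
      using D[OF near(2)[OF that]] by (rule has_derivative_at_withinI)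
    show "\<forall>\<^sub>F n in sequentially. \<forall>z\<in>ball x r. \<forall>h. cmod (D n z h - D' z h) \<le> e * norm h" if e: "e > 0" for e
    proof -
      obtain N where N: "\<And>m n z h. m \<ge> N \<Longrightarrow> n \<ge> N \<Longrightarrow> z \<in> ball x r \<Longrightarrow> cmod (D m z h - D n z h) \<le> e * norm h"
        using D_cauchy[OF e] by blast
      have "cmod (D n z h - D' z h) \<le> e * norm h" if n: "n \<ge> N" and z: "z \<in> ball x r" for n z h
      proof (rule tendsto_upperbound)
        show "(\<lambda>m. cmod (D n z h - D m z h)) \<longlonglongrightarrow> cmod (D n z h - D' z h)"
          by (intro tendsto_intros D'_lim z)
        show "\<forall>\<^sub>F m in sequentially. cmod (D n z h - D m z h) \<le> e * norm h"
          using N[OF n _ z] by (auto simp: eventually_sequentially)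
      qed simp
      then show ?thesis unfolding eventually_sequentially by blast
    qed
    show "x \<in> ball x r" using r by simp
    show "(\<lambda>n. f n x) \<longlonglongrightarrow> g x"
      using tendsto_uniform_limitI[OF lim x] .
  qed simp
  then obtain g2 where g2: "\<And>z. z \<in> ball x r \<Longrightarrow> (\<lambda>n. f n z) \<longlonglongrightarrow> g2 z"
    "\<And>z. z \<in> ball x r \<Longrightarrow> (g2 has_derivative D' z) (at z within ball x r)"
    by blast
  have g_eq: "g2 z = g z" if "z \<in> ball x r" for z
    using LIMSEQ_unique[OF g2(1)[OF that] tendsto_uniform_limitI[OF lim near(2)[OF that]]] .
  have xr: "x \<in> ball x r" using r by simp
  have "(g2 has_derivative D' x) (at x)"
    using g2(2)[OF xr] at_within_open[OF xr open_ball] by simp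
  then have "(g has_derivative D' x) (at x)"
    by (rule has_derivative_transform_within_open[OF _ open_ball xr]) (rule g_eq)
  moreover have "D' x (c *\<^sub>C v) = c *\<^sub>C D' x v" for c v
  proof (rule LIMSEQ_unique)
    show "(\<lambda>n. D n x (c *\<^sub>C v)) \<longlonglongrightarrow> D' x (c *\<^sub>C v)" by (rule D'_lim[OF xr])
    have "(\<lambda>n. c * D n x v) \<longlonglongrightarrow> c * D' x v" by (intro tendsto_intros D'_lim[OF xr])
    then show "(\<lambda>n. D n x (c *\<^sub>C v)) \<longlonglongrightarrow> c *\<^sub>C D' x v"
      by (simp add: D_hom[OF x] scaleC_complex_def)
  qed
  ultimately show "\<exists>E. (g has_derivative E) (at x) \<and> (\<forall>c v. E (c *\<^sub>C v) = c *\<^sub>C E v)"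
    by blast
qed

section \<open>Completeness of the two function spaces\<close>

lemma uniform_Cauchy_holomorphic_limit:
  fixes f :: "nat \<Rightarrow> 'a::complex_normed_vector \<Rightarrow> complex"
  assumes hol: "\<And>n. cholomorphic_on (f n) (ball 0 1)"
    and Cauchy: "\<And>e. e > 0 \<Longrightarrow> \<exists>N. \<forall>m\<ge>N. \<forall>n\<ge>N. \<forall>x\<in>ball 0 1. cmod (f m x - f n x) < e"
  obtains g where "cholomorphic_on g (ball 0 1)" "uniform_limit (ball 0 1) f g sequentially"
    "\<And>x. x \<notin> ball 0 1 \<Longrightarrow> g x = 0"
proof -
  have "uniformly_Cauchy_on (ball 0 1) f"
    using Cauchy unfolding uniformly_Cauchy_on_def dist_norm by blast
  then obtain g where g: "uniform_limit (ball 0 1) f g sequentially"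
    using Cauchy_uniformly_convergent uniformly_convergent_on_def by blast
  let ?g = "\<lambda>x. if x \<in> ball 0 1 then g x else 0"
  have lim: "uniform_limit (ball 0 1) f ?g sequentially"
    using g by (rule uniform_limit_cong'[THEN iffD1, rotated 2]) auto
  then have "cholomorphic_on ?g (ball 0 1)"
    by (intro cholomorphic_uniform_limit[OF hol]) auto
  with lim that[of ?g] show ?thesis by simp
qed

lemma complete_hol_inf: "complete (UNIV :: 'a::complex_normed_vector hol_inf set)"
proof (rule completeI)
  fix f :: "nat \<Rightarrow> 'a hol_inf"
  assume "Cauchy f"
  then have C: "\<exists>N. \<forall>m\<ge>N. \<forall>n\<ge>N. norm (f m - f n) < e" if "e > 0" for e
    using that CauchyD by blast
  have point: "cmod (hi_apply (f m) x - hi_apply (f n) x) \<le> norm (f m - f n)" if "x \<in> ball 0 1" for m n x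
    using hi_norm_le[OF that, of "f m - f n"] by (simp add: hi_apply_simps)
  obtain g where g: "cholomorphic_on g (ball 0 1)"
    "uniform_limit (ball 0 1) (\<lambda>n. hi_apply (f n)) g sequentially" "\<And>x. x \<notin> ball 0 1 \<Longrightarrow> g x = 0"
  proof (rule uniform_Cauchy_holomorphic_limit[of "\<lambda>n. hi_apply (f n)"])
    show "\<exists>N. \<forall>m\<ge>N. \<forall>n\<ge>N. \<forall>x\<in>ball 0 1. cmod (hi_apply (f m) x - hi_apply (f n) x) < e" if "e > 0" for e
      using C[OF that] point by (meson order_le_less_trans)
  qed (auto simp: hi_holomorphic)
  have "bounded (g ` ball 0 1)"
    by (rule uniform_limit_bounded[OF g(2)]) (simp_all add: hi_bounded)
  then have G: "hi_apply (Abs_hol_inf g) = g"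
    using g(1,3) by (intro Abs_hol_inf_inverse) auto
  have "f \<longlonglongrightarrow> Abs_hol_inf g"
  proof (rule LIMSEQ_I)
    fix e :: real assume e: "e > 0"
    then obtain N where N: "\<And>n x. n \<ge> N \<Longrightarrow> x \<in> ball 0 1 \<Longrightarrow> dist (hi_apply (f n) x) (g x) < e / 2"
      using g(2) unfolding uniform_limit_iff eventually_sequentially by (metis half_gt_zero)
    have "norm (f n - Abs_hol_inf g) \<le> e / 2" if "n \<ge> N" for n
      using N[OF that] by (intro hi_norm_bound) (simp add: hi_apply_simps G dist_norm less_imp_le)
    then show "\<exists>N. \<forall>n\<ge>N. norm (f n - Abs_hol_inf g) < e"
      using e by (intro exI[of _ N]) fastforce
  qed
  then show "\<exists>l\<in>UNIV. f \<longlonglongrightarrow> l" by blast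
qed

lemma hl_diff_le: "x \<in> ball 0 1 \<Longrightarrow> y \<in> ball 0 1 \<Longrightarrow>
    norm (hl_apply f x - hl_apply f y) \<le> norm f * norm (x - y)"
  using lipschitz_onD[OF hl_lipschitz[of f], of x y]
    mult_right_mono[of "lip_const (hl_apply f)" "norm f" "norm (x - y)"]
  by (auto simp: norm_hol_lip_def dist_norm)

lemma hl_norm_le:
  assumes x: "x \<in> ball 0 1"
  shows "norm (hl_apply f x) \<le> norm f"
proof -
  have L: "0 \<le> lip_const (hl_apply f)" using lipschitz_on_nonneg[OF hl_lipschitz] .
  have "norm (hl_apply f x) \<le> norm (hl_apply f x - hl_apply f 0) + norm (hl_apply f 0)"
    using norm_triangle_sub[of "hl_apply f x" "hl_apply f 0"] by simp
  also have "norm (hl_apply f x - hl_apply f 0) \<le> lip_const (hl_apply f) * norm x"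
    using lipschitz_onD[OF hl_lipschitz[of f], of x 0] x by (simp add: dist_norm)
  also have "\<dots> \<le> lip_const (hl_apply f)"
    using x L by (simp add: mult_left_le)
  finally show ?thesis by (simp add: norm_hol_lip_def)
qed

lemma hl_norm_bound:
  assumes "0 \<le> L" "\<And>x y. x \<in> ball 0 1 \<Longrightarrow> y \<in> ball 0 1 \<Longrightarrow>
    norm (hl_apply f x - hl_apply f y) \<le> L * norm (x - y)"
  shows "norm f \<le> L + norm (hl_apply f 0)"
proof -
  have "L-lipschitz_on (ball 0 1) (hl_apply f)"
    using assms by (intro lipschitz_onI) (auto simp: dist_norm)
  then show ?thesis using lip_const_le by (auto simp: norm_hol_lip_def)
qed

lemma complete_hol_lip: "complete (UNIV :: ('a::complex_normed_vector, complex) hol_lip set)"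
proof (rule completeI)
  fix f :: "nat \<Rightarrow> ('a, complex) hol_lip"
  assume "Cauchy f"
  then have C: "\<exists>N. \<forall>m\<ge>N. \<forall>n\<ge>N. norm (f m - f n) < e" if "e > 0" for e
    using that CauchyD by blast
  have point: "cmod (hl_apply (f m) x - hl_apply (f n) x) \<le> norm (f m - f n)" if "x \<in> ball 0 1" for m n x
    using hl_norm_le[OF that, of "f m - f n"] by (simp add: hl_apply_simps)
  obtain g where g: "cholomorphic_on g (ball 0 1)"
    "uniform_limit (ball 0 1) (\<lambda>n. hl_apply (f n)) g sequentially" "\<And>x. x \<notin> ball 0 1 \<Longrightarrow> g x = 0"
  proof (rule uniform_Cauchy_holomorphic_limit[of "\<lambda>n. hl_apply (f n)"])
    show "\<exists>N. \<forall>m\<ge>N. \<forall>n\<ge>N. \<forall>x\<in>ball 0 1. cmod (hl_apply (f m) x - hl_apply (f n) x) < e" if "e > 0" for e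
      using C[OF that] point by (meson order_le_less_trans)
  qed (auto simp: hl_holomorphic)
  have lim: "(\<lambda>n. hl_apply (f n) x) \<longlonglongrightarrow> g x" if "x \<in> ball 0 1" for x
    using tendsto_uniform_limitI[OF g(2) that] .
  have close: "cmod ((hl_apply (f n) x - g x) - (hl_apply (f n) y - g y)) \<le> e * norm (x - y)"
    "cmod (hl_apply (f n) x - g x) \<le> e"
    if N: "\<forall>m\<ge>N. \<forall>n\<ge>N. norm (f m - f n) < e" and n: "n \<ge> N" and x: "x \<in> ball 0 1" and y: "y \<in> ball 0 1"
    for e N n x y
  proof -
    show "cmod ((hl_apply (f n) x - g x) - (hl_apply (f n) y - g y)) \<le> e * norm (x - y)"
    proof (rule tendsto_upperbound)
      show "(\<lambda>m. cmod ((hl_apply (f n) x - hl_apply (f m) x) - (hl_apply (f n) y - hl_apply (f m) y)))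
          \<longlonglongrightarrow> cmod ((hl_apply (f n) x - g x) - (hl_apply (f n) y - g y))"
        by (intro tendsto_intros lim x y)
      have "cmod ((hl_apply (f n) x - hl_apply (f m) x) - (hl_apply (f n) y - hl_apply (f m) y)) \<le> e * norm (x - y)"
        if m: "m \<ge> N" for m
      proof -
        have "norm (f n - f m) * norm (x - y) \<le> e * norm (x - y)"
          using N n m by (intro mult_right_mono) (auto intro: less_imp_le)
        then show ?thesis
          using hl_diff_le[OF x y, of "f n - f m"] by (simp add: hl_apply_simps)
      qed
      then show "\<forall>\<^sub>F m in sequentially.
          cmod ((hl_apply (f n) x - hl_apply (f m) x) - (hl_apply (f n) y - hl_apply (f m) y)) \<le> e * norm (x - y)"
        by (auto simp: eventually_sequentially)
    qed simp
    show "cmod (hl_apply (f n) x - g x) \<le> e"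
    proof (rule tendsto_upperbound)
      show "(\<lambda>m. cmod (hl_apply (f n) x - hl_apply (f m) x)) \<longlonglongrightarrow> cmod (hl_apply (f n) x - g x)"
        by (intro tendsto_intros lim x)
      have "cmod (hl_apply (f n) x - hl_apply (f m) x) \<le> e" if "m \<ge> N" for m
        using point[OF x, of n m] N n that by force
      then show "\<forall>\<^sub>F m in sequentially. cmod (hl_apply (f n) x - hl_apply (f m) x) \<le> e"
        by (auto simp: eventually_sequentially)
    qed simp
  qed
  obtain N where N: "\<forall>m\<ge>N. \<forall>n\<ge>N. norm (f m - f n) < 1" using C[of 1] by auto
  have "(norm (f N) + 1)-lipschitz_on (ball 0 1) g"
  proof (rule lipschitz_onI)
    fix x y :: 'a assume xy: "x \<in> ball 0 1" "y \<in> ball 0 1"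
    have "cmod (g x - g y) \<le> cmod (hl_apply (f N) x - hl_apply (f N) y)
        + cmod ((hl_apply (f N) x - g x) - (hl_apply (f N) y - g y))"
      using norm_triangle_ineq4[of "hl_apply (f N) x - hl_apply (f N) y"
          "(hl_apply (f N) x - g x) - (hl_apply (f N) y - g y)"] by simp
    also have "\<dots> \<le> norm (f N) * norm (x - y) + 1 * norm (x - y)"
      by (intro add_mono hl_diff_le close(1)[OF N] xy order_refl)
    finally show "dist (g x) (g y) \<le> (norm (f N) + 1) * dist x y"
      by (simp add: dist_norm distrib_right)
  qed simp
  then have G: "hl_apply (Abs_hol_lip g) = g"
    using g(1,3) by (intro Abs_hol_lip_inverse) auto
  have "f \<longlonglongrightarrow> Abs_hol_lip g"
  proof (rule LIMSEQ_I)
    fix e :: real assume e: "e > 0"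
    then obtain N where N: "\<forall>m\<ge>N. \<forall>n\<ge>N. norm (f m - f n) < e / 3" using C[of "e / 3"] by auto
    have "norm (f n - Abs_hol_lip g) < e" if n: "n \<ge> N" for n
    proof -
      have "norm (f n - Abs_hol_lip g) \<le> e / 3 + norm (hl_apply (f n - Abs_hol_lip g) 0)"
        using close(1)[OF N n] e by (intro hl_norm_bound) (auto simp: hl_apply_simps G)
      also have "norm (hl_apply (f n - Abs_hol_lip g) 0) \<le> e / 3"
        using close(2)[OF N n, of 0 0] by (simp add: hl_apply_simps G)
      finally show ?thesis using e by simp
    qed
    then show "\<exists>N. \<forall>n\<ge>N. norm (f n - Abs_hol_lip g) < e" by blast
  qed
  then show "\<exists>l\<in>UNIV. f \<longlonglongrightarrow> l" by blast
qed

section \<open>Bounded holomorphic functions peaking along a sequence\<close>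

text \<open>The function \<open>F = 1 - h\<close> maps the disc into the right half-plane. Composing it with the Cayley
transform \<open>(F - a) / (F + cnj a)\<close>, where \<open>a = F 0\<close>, gives a self-map fixing 0, to which Schwarz's lemma
applies; the rest rewrites its conclusion with
\<open>\<bar>F + cnj a\<bar>\<^sup>2 - \<bar>F - a\<bar>\<^sup>2 = 4 Re F Re a\<close>.\<close>

lemma one_minus_Re_ge:
  assumes hol: "h holomorphic_on ball 0 1" and h: "\<And>z. cmod z < 1 \<Longrightarrow> cmod (h z) < 1"
    and z: "cmod z < 1"
  shows "(1 - cmod z) * ((1 - Re (h 0)) / 4) \<le> 1 - Re (h z)"
proof -
  define F where "F w = 1 - h w" for w
  define a where "a = F 0"
  have F_pos: "Re (F w) > 0" if "cmod w < 1" for w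
    using complex_Re_le_cmod[of "h w"] h[OF that] by (simp add: F_def)
  then have a_pos: "Re a > 0" by (simp add: a_def)
  define q where "q w = (F w - a) / (F w + cnj a)" for w
  have denom: "F w + cnj a \<noteq> 0" if "cmod w < 1" for w
  proof -
    have "Re (F w + cnj a) > 0" using F_pos[OF that] a_pos by simp
    then show ?thesis by (metis less_irrefl zero_complex.sel(1))
  qed
  have norms: "(cmod (F w + cnj a))\<^sup>2 - (cmod (F w - a))\<^sup>2 = 4 * Re (F w) * Re a" for w
    unfolding cmod_power2 by (simp add: power2_eq_square algebra_simps)
  have "cmod (q z) \<le> cmod z"
  proof (rule Schwarz_Lemma(1))
    show "q holomorphic_on ball 0 1"
      unfolding q_def F_def
      by (intro holomorphic_intros hol) (use denom in \<open>auto simp: F_def\<close>)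
    show "q 0 = 0" by (simp add: q_def a_def)
    show "cmod (q w) < 1" if "cmod w < 1" for w
    proof -
      have "(cmod (F w - a))\<^sup>2 < (cmod (F w + cnj a))\<^sup>2"
        using norms[of w] F_pos[OF that] a_pos by (smt (verit) mult_pos_pos)
      then have "cmod (F w - a) < cmod (F w + cnj a)"
        by (rule power_less_imp_less_base) simp
      then show ?thesis
        using denom[OF that] by (simp add: q_def norm_divide)
    qed
  qed (rule z)
  then have "cmod (F z - a) \<le> cmod z * cmod (F z + cnj a)"
    using denom[OF z] by (simp add: q_def norm_divide divide_le_eq)
  then have "(cmod (F z - a))\<^sup>2 \<le> (cmod z * cmod (F z + cnj a))\<^sup>2"
    by (rule power_mono) simp
  then have "(1 - (cmod z)\<^sup>2) * (cmod (F z + cnj a))\<^sup>2 \<le> 4 * Re (F z) * Re a"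
    using norms[of z] by (simp add: power_mult_distrib algebra_simps)
  moreover have "(1 - cmod z) * (Re a)\<^sup>2 \<le> (1 - (cmod z)\<^sup>2) * (cmod (F z + cnj a))\<^sup>2"
  proof (rule mult_mono)
    show "1 - cmod z \<le> 1 - (cmod z)\<^sup>2"
      using z by (simp add: power2_eq_square mult_left_le)
    then show "0 \<le> 1 - (cmod z)\<^sup>2" using z by simp
    have "Re a \<le> cmod (F z + cnj a)"
      using complex_Re_le_cmod[of "F z + cnj a"] F_pos[OF z] by simp
    then show "(Re a)\<^sup>2 \<le> (cmod (F z + cnj a))\<^sup>2"
      using a_pos by (intro power_mono) auto
  qed simp
  ultimately have "((1 - cmod z) * Re a) * Re a \<le> (4 * Re (F z)) * Re a"
    by (simp add: power2_eq_square mult.assoc)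
  then have "(1 - cmod z) * Re a \<le> 4 * Re (F z)"
    using a_pos by simp
  then show ?thesis by (simp add: a_def F_def)
qed

lemma radial_derivative_large:
  assumes hol: "h holomorphic_on ball 0 1" and h: "\<And>z. cmod z < 1 \<Longrightarrow> cmod (h z) < 1"
    and cont: "continuous_on (cball 0 1) h" and h1: "h 1 = 1"
  obtains c where "c > 0"
    "\<And>r. 0 \<le> r \<Longrightarrow> r < 1 \<Longrightarrow> \<exists>s. r < s \<and> s < 1 \<and> c \<le> cmod (deriv h (of_real s))"
proof
  let ?c = "(1 - Re (h 0)) / 4"
  show "?c > 0"
    using complex_Re_le_cmod[of "h 0"] h[of 0] by simp
  fix r :: real assume r: "0 \<le> r" "r < 1"
  obtain s where s: "r < s" "s < 1"
    "Re (h (of_real 1)) - Re (h (of_real r)) = Re (deriv h (of_real s) * of_real (1 - r))"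
  proof (rule mvt[OF r(2)])
    have "continuous_on {r..1} (\<lambda>t. h (of_real t))"
      using r by (intro continuous_on_compose2[OF cont] continuous_intros) auto
    then show "continuous_on {r..1} (\<lambda>t. Re (h (of_real t)))"
      by (rule continuous_on_Re)
    fix s assume s: "r < s" "s < 1"
    have "(h has_field_derivative deriv h (of_real s)) (at (of_real s))"
      using r s by (intro holomorphic_derivI[OF hol]) auto
    then have "(h has_derivative (*) (deriv h (of_real s))) (at (of_real s))"
      by (simp add: has_field_derivative_def)
    then have "((\<lambda>t. h (of_real t)) has_derivative (\<lambda>u. deriv h (of_real s) * of_real u)) (at s)"
      by (intro has_derivative_compose[OF has_derivative_of_real[OF has_derivative_ident]])
    then show "((\<lambda>t. Re (h (of_real t))) has_derivative (\<lambda>u. Re (deriv h (of_real s) * of_real u))) (at s)"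
      by (rule has_derivative_Re)
  qed blast
  have "?c * (1 - r) \<le> 1 - Re (h (of_real r))"
    using one_minus_Re_ge[OF hol h, of "of_real r"] r by (simp add: mult.commute)
  also have "\<dots> = Re (deriv h (of_real s)) * (1 - r)"
    using s(3) h1 by simp
  finally have "?c \<le> Re (deriv h (of_real s))"
    using r by (simp only: mult_le_cancel_right)
  also have "\<dots> \<le> cmod (deriv h (of_real s))" by (rule complex_Re_le_cmod)
  finally show "\<exists>s. r < s \<and> s < 1 \<and> ?c \<le> cmod (deriv h (of_real s))"
    using s by blast
qed

text \<open>The function \<open>p w = (1 + w) / 2\<close> peaks at 1: its modulus is below 1 on the closed disc except at 1. The function
\<open>u\<close> is \<open>p\<^sup>m - p\<^sup>l\<close>. First \<open>m\<close> is chosen so large that \<open>p\<^sup>m\<close> is tiny at distance \<open>\<ge> d\<close> from 1, then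
\<open>z \<in> Z\<close> so close to 1 that \<open>p\<^sup>m\<close> is nearly 1 at \<open>z\<close>, then \<open>l \<ge> m\<close> so large that \<open>p\<^sup>l\<close> is tiny at \<open>z\<close>. As \<open>u\<close>
vanishes at 1, it is also small within some distance \<open>d'\<close> of 1, so all of its mass is in the annulus
\<open>d' \<le> \<bar>1 - w\<bar> < d\<close>. The primitive \<open>U\<close> is small because of the denominators \<open>m + 1\<close> and \<open>l + 1\<close>.\<close>

lemma peak_function_at_1:
  assumes Z: "1 \<in> closure Z" "Z \<subseteq> ball 0 1" and d: "d > 0" and e: "e > 0"
  obtains d' z u U where "0 < d'" "d' < d" "z \<in> Z" "d' \<le> cmod (1 - z)" "cmod (1 - z) < d" "3/4 \<le> cmod (u z)"
    "\<And>w. cmod w < 1 \<Longrightarrow> (U has_field_derivative u w) (at w)"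
    "\<And>w. cmod w < 1 \<Longrightarrow> cmod (U w) \<le> e"
    "\<And>w. cmod w < 1 \<Longrightarrow> cmod (u w) \<le> 2"
    "\<And>w. cmod w < 1 \<Longrightarrow> cmod (1 - w) \<ge> d \<or> cmod (1 - w) < d' \<Longrightarrow> cmod (u w) \<le> e"
proof -
  define p where "p w = (1 + w) / 2" for w :: complex
  \<comment> \<open>The parallelogram law for 1 and \<open>w\<close>.\<close>
  have p_sq: "(cmod (p w))\<^sup>2 = (2 + 2 * (cmod w)\<^sup>2 - (cmod (1 - w))\<^sup>2) / 4" for w
    unfolding p_def norm_divide power_divide cmod_power2
    by (simp add: power2_eq_square algebra_simps)
  have p_less: "cmod (p w) < 1" if "cmod w < 1" for w
    using norm_triangle_ineq[of 1 w] that by (simp add: p_def norm_divide)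
  define r where "r = max 0 (1 - d\<^sup>2 / 4)"
  have r: "0 \<le> r" "r < 1" using d by (auto simp: r_def)
  have p_away: "(cmod (p w))\<^sup>2 \<le> r" if "cmod w < 1" "d \<le> cmod (1 - w)" for w
  proof -
    have "(cmod w)\<^sup>2 \<le> 1" using that(1) by (simp add: power_le_one)
    moreover have "d\<^sup>2 \<le> (cmod (1 - w))\<^sup>2" using that(2) d by (intro power_mono) auto
    ultimately have "(cmod (p w))\<^sup>2 \<le> 1 - d\<^sup>2 / 4" unfolding p_sq by simp
    then show ?thesis unfolding r_def by (rule max.coboundedI2)
  qed
  have "(\<lambda>n. r ^ n) \<longlonglongrightarrow> 0" using r by (intro LIMSEQ_power_zero) simp
  then have "\<forall>\<^sub>F n in sequentially. r ^ n < e / 2"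
    using e by (intro order_tendstoD(2)) auto
  moreover have "\<forall>\<^sub>F n in sequentially. 4 / e \<le> real n"
    by (rule filterlim_real_sequentially[unfolded filterlim_at_top, rule_format])
  ultimately have "\<forall>\<^sub>F n in sequentially. r ^ n < e / 2 \<and> 4 / e \<le> real n"
    by (rule eventually_conj)
  then obtain n where n: "r ^ n < e / 2" "4 / e \<le> real n"
    using eventually_happens' sequentially_bot by blast
  define m where "m = 2 * n"
  have small: "cmod (p w) ^ k \<le> e / 2" if "cmod w < 1" "d \<le> cmod (1 - w)" "k \<ge> m" for w k
  proof -
    have "cmod (p w) ^ k \<le> cmod (p w) ^ m"
      using p_less[OF that(1)] that(3) by (intro power_decreasing) auto
    also have "\<dots> = ((cmod (p w))\<^sup>2) ^ n" by (simp add: m_def power_mult)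
    also have "\<dots> \<le> r ^ n" using p_away[OF that(1,2)] by (intro power_mono) auto
    finally show ?thesis using n(1) by simp
  qed
  have "(\<lambda>w. p w ^ m) \<midarrow>1\<rightarrow> p 1 ^ m" unfolding p_def by (intro tendsto_intros) simp
  then obtain t where t: "t > 0" "\<And>w. w \<noteq> 1 \<Longrightarrow> dist w 1 < t \<Longrightarrow> dist (p w ^ m) 1 < 1/8"
    unfolding LIM_def by (auto simp: p_def dest!: spec[of _ "1/8 :: real"])
  obtain z where z: "z \<in> Z" "dist z 1 < min t d"
    using Z(1) t(1) d by (metis closure_approachable min_less_iff_conj)
  have z1: "cmod z < 1" using z(1) Z(2) by auto
  then have z_ne: "z \<noteq> 1" by auto
  have "(\<lambda>k. cmod (p z) ^ k) \<longlonglongrightarrow> 0" using p_less[OF z1] by (intro LIMSEQ_power_zero) simp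
  then have "\<forall>\<^sub>F k in sequentially. cmod (p z) ^ k < 1/8"
    by (rule order_tendstoD(2)) simp
  then have "\<forall>\<^sub>F k in sequentially. cmod (p z) ^ k < 1/8 \<and> m \<le> k"
    by (intro eventually_conj eventually_ge_at_top)
  then obtain l where l: "cmod (p z) ^ l < 1/8" "m \<le> l"
    using eventually_happens' sequentially_bot by blast
  define u where "u w = p w ^ m - p w ^ l" for w
  define U where "U w = 2 / of_nat (Suc m) * p w ^ Suc m - 2 / of_nat (Suc l) * p w ^ Suc l" for w
  have "u \<midarrow>1\<rightarrow> u 1" unfolding u_def p_def by (intro tendsto_intros) simp_all
  then obtain t' where t': "t' > 0" "\<And>w. w \<noteq> 1 \<Longrightarrow> dist w 1 < t' \<Longrightarrow> cmod (u w) < e"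
    using LIM_D[of u "u 1" 1 e] e by (auto simp: u_def p_def dist_norm)
  define d' where "d' = min t' (min (d / 2) (cmod (1 - z)))"
  have u_le: "cmod (u w) \<le> cmod (p w) ^ m + cmod (p w) ^ l" for w
    using norm_triangle_ineq4[of "p w ^ m" "p w ^ l"] by (simp add: u_def norm_power)
  show ?thesis
  proof (rule that[of d' z u U])
    show "0 < d'" using t' d z_ne by (simp add: d'_def)
    show "d' < d" using d by (simp add: d'_def)
    show "z \<in> Z" by fact
    show "d' \<le> cmod (1 - z)" by (simp add: d'_def)
    show "cmod (1 - z) < d" using z(2) by (simp add: dist_norm norm_minus_commute)
    have "cmod (1 - p z ^ m) < 1/8"
      using t(2)[OF z_ne] z(2) by (simp add: dist_norm norm_minus_commute)
    moreover have "1 = u z + (1 - p z ^ m) + p z ^ l" by (simp add: u_def)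
    then have "1 \<le> cmod (u z) + cmod (1 - p z ^ m) + cmod (p z) ^ l"
      by (metis norm_one norm_power norm_triangle_ineq order_trans add_right_mono)
    ultimately show "3/4 \<le> cmod (u z)" using l(1) by simp
  next
    fix w :: complex assume w: "cmod w < 1"
    have pd: "(p has_field_derivative 1/2) (at w)"
      unfolding p_def by (auto intro!: derivative_eq_intros)
    show "(U has_field_derivative u w) (at w)"
      unfolding U_def by (rule derivative_eq_intros pd refl | simp add: u_def del: of_nat_Suc power_Suc)+
    have p1: "cmod (p w) ^ k \<le> 1" for k
      using p_less[OF w] by (intro power_le_one) auto
    show "cmod (u w) \<le> 2" using u_le[of w] p1[of m] p1[of l] by simp
    have bnd: "cmod (2 / of_nat (Suc k) * p w ^ Suc k) \<le> e / 2" if "k \<ge> n" for k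
    proof -
      have "cmod (2 / of_nat (Suc k) * p w ^ Suc k) = 2 / real (Suc k) * cmod (p w) ^ Suc k"
        by (simp only: norm_mult norm_divide norm_power norm_of_nat norm_numeral)
      also have "\<dots> \<le> 2 / real (Suc k)"
        using p1[of "Suc k"] by (intro mult_left_le) auto
      also have "\<dots> \<le> e / 2"
      proof -
        have "4 / e \<le> real (Suc k)" using n(2) that by simp
        then show ?thesis using e by (simp add: field_simps del: of_nat_Suc)
      qed
      finally show ?thesis .
    qed
    show "cmod (U w) \<le> e"
      using norm_triangle_ineq4[of "2 / of_nat (Suc m) * p w ^ Suc m" "2 / of_nat (Suc l) * p w ^ Suc l"]
        bnd[of m] bnd[of l] l(2) unfolding U_def m_def by simp
    assume "d \<le> cmod (1 - w) \<or> cmod (1 - w) < d'"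
    then show "cmod (u w) \<le> e"
    proof
      assume "d \<le> cmod (1 - w)"
      then show ?thesis using u_le[of w] small[OF w, of m] small[OF w, of l] l(2) by simp
    next
      assume "cmod (1 - w) < d'"
      then have "dist w 1 < t'" by (simp add: d'_def dist_norm norm_minus_commute)
      moreover have "w \<noteq> 1" using w by auto
      ultimately show ?thesis using t'(2) less_imp_le by blast
    qed
  qed
qed

text \<open>The form in which sums of peak functions are estimated: one index \<open>j\<close> may carry an arbitrary term \<open>y\<close>, the
other terms decay geometrically.\<close>

lemma geometric_perturbation_bound:
  fixes x :: "nat \<Rightarrow> complex"
  assumes "x sums s" "\<And>k. cmod (x k - (if k = j then y else 0)) \<le> C * (1/2) ^ k"
  shows "cmod (s - y) \<le> 2 * C"
proof -
  have "(\<lambda>k. if k = j then y else 0) sums y"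
    using sums_single[of j "\<lambda>_. y"] by simp
  then have s: "(\<lambda>k. x k - (if k = j then y else 0)) sums (s - y)"
    using assms(1) by (intro sums_diff)
  have g: "(\<lambda>k. C * (1/2) ^ k) sums (C * 2)"
    using sums_mult[OF geometric_sums[of "1/2 :: real"], of C] by simp
  show ?thesis
    using norm_sums_le[OF s g assms(2)] by simp
qed

text \<open>Peak functions \<open>u k\<close> are stacked in disjoint annuli around 1, the outer radius of each being the inner
radius of the previous one. At every point all but at most one of them are at most
\<open>2\<^sup>-\<^sup>k / 16\<close>. Hence \<open>g' a = (\<Sum>k. a k u k)\<close> is bounded by \<open>(2 + 1/8) \<bar>a\<bar>\<close>, and at the peak
\<open>z n\<close> it differs from \<open>a n u n (z n)\<close> by at most \<open>\<bar>a\<bar> / 8\<close>; choosing \<open>n\<close> with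
\<open>\<bar>a n\<bar> \<ge> \<bar>a\<bar> / 2\<close> leaves at least \<open>3/8 - 1/8 = 1/4\<close> of the norm. The series is integrated termwise.\<close>

lemma linf_interpolation:
  assumes Z: "1 \<in> closure Z" "Z \<subseteq> ball (0::complex) 1"
  obtains g g' :: "(nat \<Rightarrow>\<^sub>C complex) \<Rightarrow> complex \<Rightarrow> complex" where
    "\<And>a b w. cmod w < 1 \<Longrightarrow> g (a + b) w = g a w + g b w"
    "\<And>c a w. cmod w < 1 \<Longrightarrow> g (c *\<^sub>C a) w = c * g a w"
    "\<And>a w. cmod w < 1 \<Longrightarrow> (g a has_field_derivative g' a w) (at w)"
    "\<And>a w. cmod w < 1 \<Longrightarrow> cmod (g' a w) \<le> 3 * norm a"
    "\<And>a. cmod (g a 0) \<le> norm a"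
    "\<And>a. \<exists>z\<in>Z. norm a / 4 \<le> cmod (g' a z)"
proof -
  define step where "step k d d' z u U \<longleftrightarrow> 0 < d' \<and> d' < d \<and> z \<in> Z \<and> d' \<le> cmod (1 - z) \<and>
      cmod (1 - z) < d \<and> 3/4 \<le> cmod (u z) \<and>
      (\<forall>w. cmod w < 1 \<longrightarrow> (U has_field_derivative u w) (at w) \<and> cmod (U w) \<le> (1/2)^k / 16 \<and> cmod (u w) \<le> 2 \<and>
        (cmod (1 - w) \<ge> d \<or> cmod (1 - w) < d' \<longrightarrow> cmod (u w) \<le> (1/2)^k / 16))"
    for k :: nat and d d' :: real and z and u U :: "complex \<Rightarrow> complex"
  have "\<exists>d' z u U. step k d d' z u U" if "d > 0" for k d
  proof (rule peak_function_at_1[OF Z that, of "(1/2)^k / 16"])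
    show "(0::real) < (1/2)^k / 16" by simp
  qed (unfold step_def, blast)
  then have "\<exists>d. \<forall>k. 0 < d k \<and> (\<exists>z u U. step k (d k) (d (Suc k)) z u U)"
  proof (intro dependent_nat_choice)
    show "\<exists>d::real. 0 < d" by (rule exI[of _ 1]) simp
    fix d :: real and k
    assume ex: "\<And>d k. 0 < d \<Longrightarrow> \<exists>d' z u U. step k d d' z u U" and "0 < d"
    then obtain d' z u U where "step k d d' z u U" by blast
    moreover from this have "0 < d'" by (simp add: step_def)
    ultimately show "\<exists>d'. 0 < d' \<and> (\<exists>z u U. step k d d' z u U)" by blast
  qed
  then obtain d z u U where st: "\<And>k. step k (d k) (d (Suc k)) (z k) (u k) (U k)"
    by metis
  have u_small: "cmod (u k w) \<le> (1/2)^k / 16"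
    if "cmod w < 1" "cmod (1 - w) \<ge> d k \<or> cmod (1 - w) < d (Suc k)" for k w
    using st[of k] that by (auto simp: step_def)
  have u2: "cmod (u k w) \<le> 2" and U_small: "cmod (U k w) \<le> (1/2)^k / 16"
    and deriv: "(U k has_field_derivative u k w) (at w)" if "cmod w < 1" for k w
    using st[of k] that by (auto simp: step_def)
  have z: "z k \<in> Z" "d (Suc k) \<le> cmod (1 - z k)" "cmod (1 - z k) < d k" "3/4 \<le> cmod (u k (z k))" for k
    using st[of k] by (auto simp: step_def)
  have dec: "decseq d"
    using st by (intro decseq_SucI) (auto simp: step_def less_imp_le)
  have off_annulus: "cmod (u k w) \<le> (1/2)^k / 16"
    if w: "cmod w < 1" "d (Suc j) \<le> cmod (1 - w)" "cmod (1 - w) < d j" and k: "k \<noteq> j" for j k w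
  proof (rule u_small[OF w(1)])
    show "d k \<le> cmod (1 - w) \<or> cmod (1 - w) < d (Suc k)"
    proof (cases "k < j")
      case True
      then have "d j \<le> d (Suc k)" using decseqD[OF dec, of "Suc k" j] by simp
      then show ?thesis using w(3) by simp
    next
      case False
      then have "d k \<le> d (Suc j)" using k decseqD[OF dec, of "Suc j" k] by simp
      then show ?thesis using w(2) by simp
    qed
  qed
  have one_index: "\<exists>j. \<forall>k. k \<noteq> j \<longrightarrow> cmod (u k w) \<le> (1/2)^k / 16" if w: "cmod w < 1" for w
  proof (cases "\<exists>j. d (Suc j) \<le> cmod (1 - w) \<and> cmod (1 - w) < d j")
    case True
    then show ?thesis using off_annulus[OF w] by blast
  next
    case False
    then show ?thesis using u_small[OF w] by (force simp: not_le not_less)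
  qed
  have term_bound: "cmod (apply_bcontfun a i * v) \<le> norm a * t" if "cmod v \<le> t" for a v t and i :: nat
    using mult_mono[OF norm_bounded[of a i] that] by (simp add: norm_mult)
  have "\<exists>G G'. \<forall>w\<in>ball 0 1. (\<lambda>k. apply_bcontfun a k * U k w) sums G w \<and>
      (\<lambda>k. apply_bcontfun a k * u k w) sums G' w \<and> (G has_field_derivative G' w) (at w)" for a
  proof (rule series_and_derivative_comparison_complex[OF open_ball])
    show "((\<lambda>w. apply_bcontfun a k * U k w) has_field_derivative apply_bcontfun a k * u k w) (at w)"
      if "w \<in> ball 0 1" for k w
      using deriv[of w k] that by (intro DERIV_cmult) simp
    fix x :: complex
    let ?h = "\<lambda>k. complex_of_real (norm a * ((1/2)^k / 16))"
    have "summable (\<lambda>k. norm a * ((1/2)^k / 16))"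
      by (intro summable_mult summable_divide summable_geometric) simp
    then have "summable ?h" by (rule summable_of_real)
    moreover have "range ?h \<subseteq> \<real>\<^sub>\<ge>\<^sub>0" by auto
    moreover have "cmod (apply_bcontfun a k * U k w) \<le> cmod (?h k)" if "w \<in> ball x 1 \<inter> ball 0 1" for k w
      unfolding norm_of_real using term_bound[OF U_small[of w k], where a = a and i = k] that by simp
    ultimately show "\<exists>t h. 0 < t \<and> summable h \<and> range h \<subseteq> \<real>\<^sub>\<ge>\<^sub>0 \<and>
        (\<forall>\<^sub>F k in sequentially. \<forall>w\<in>ball x t \<inter> ball 0 1. cmod (apply_bcontfun a k * U k w) \<le> cmod (h k))"
      by (intro exI[of _ 1] exI[of _ ?h]) auto
  qed
  then obtain g g' where g: "\<And>a w. cmod w < 1 \<Longrightarrow> (\<lambda>k. apply_bcontfun a k * U k w) sums g a w"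
    and g': "\<And>a w. cmod w < 1 \<Longrightarrow> (\<lambda>k. apply_bcontfun a k * u k w) sums g' a w"
    and gd: "\<And>a w. cmod w < 1 \<Longrightarrow> (g a has_field_derivative g' a w) (at w)"
  proof -
    assume *: "\<And>g g'. (\<And>a w. cmod w < 1 \<Longrightarrow> (\<lambda>k. apply_bcontfun a k * U k w) sums g a w) \<Longrightarrow>
      (\<And>a w. cmod w < 1 \<Longrightarrow> (\<lambda>k. apply_bcontfun a k * u k w) sums g' a w) \<Longrightarrow>
      (\<And>a w. cmod w < 1 \<Longrightarrow> (g a has_field_derivative g' a w) (at w)) \<Longrightarrow> thesis"
    assume ex: "\<And>a. \<exists>G G'. \<forall>w\<in>ball 0 1. (\<lambda>k. apply_bcontfun a k * U k w) sums G w \<and>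
      (\<lambda>k. apply_bcontfun a k * u k w) sums G' w \<and> (G has_field_derivative G' w) (at w)"
    then have "\<exists>G. \<forall>a. \<exists>G'. \<forall>w\<in>ball 0 1. (\<lambda>k. apply_bcontfun a k * U k w) sums G a w \<and>
      (\<lambda>k. apply_bcontfun a k * u k w) sums G' w \<and> (G a has_field_derivative G' w) (at w)"
      by (intro choice) blast
    then obtain G where "\<forall>a. \<exists>G'. \<forall>w\<in>ball 0 1. (\<lambda>k. apply_bcontfun a k * U k w) sums G a w \<and>
      (\<lambda>k. apply_bcontfun a k * u k w) sums G' w \<and> (G a has_field_derivative G' w) (at w)" ..
    from choice[OF this] obtain G' where "\<forall>a. \<forall>w\<in>ball 0 1. (\<lambda>k. apply_bcontfun a k * U k w) sums G a w \<and>
      (\<lambda>k. apply_bcontfun a k * u k w) sums G' a w \<and> (G a has_field_derivative G' a w) (at w)" ..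
    then show thesis by (intro *[of G G']) auto
  qed
  have dominant: "cmod (g' a w - apply_bcontfun a j * u j w) \<le> norm a / 8"
    if w: "cmod w < 1" and j: "\<And>k. k \<noteq> j \<Longrightarrow> cmod (u k w) \<le> (1/2)^k / 16" for a w j
  proof -
    have "cmod (g' a w - apply_bcontfun a j * u j w) \<le> 2 * (norm a / 16)"
    proof (rule geometric_perturbation_bound[OF g'[OF w]])
      show "cmod (apply_bcontfun a k * u k w - (if k = j then apply_bcontfun a j * u j w else 0))
          \<le> norm a / 16 * (1/2) ^ k" for k
        using term_bound[OF j[of k], where a = a and i = k] by auto
    qed
    then show ?thesis by simp
  qed
  show ?thesis
  proof (rule that[of g g'])
    fix a b :: "nat \<Rightarrow>\<^sub>C complex" and c w :: complex assume w: "cmod w < 1"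
    show "g (a + b) w = g a w + g b w"
    proof (rule sums_unique2[OF g[OF w]])
      show "(\<lambda>k. apply_bcontfun (a + b) k * U k w) sums (g a w + g b w)"
        using sums_add[OF g[OF w, of a] g[OF w, of b]] by (simp add: plus_bcontfun.rep_eq distrib_right)
    qed
    show "g (c *\<^sub>C a) w = c * g a w"
    proof (rule sums_unique2[OF g[OF w]])
      show "(\<lambda>k. apply_bcontfun (c *\<^sub>C a) k * U k w) sums (c * g a w)"
        using sums_mult[OF g[OF w, of a], of c]
        by (simp add: scaleC_bcontfun.rep_eq scaleC_complex_def mult.assoc)
    qed
    show "(g a has_field_derivative g' a w) (at w)" by (rule gd[OF w])
    obtain j where j: "\<And>k. k \<noteq> j \<Longrightarrow> cmod (u k w) \<le> (1/2)^k / 16"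
      using one_index[OF w] by blast
    have "cmod (g' a w) \<le> cmod (apply_bcontfun a j * u j w) + cmod (g' a w - apply_bcontfun a j * u j w)"
      by (rule norm_triangle_sub)
    also have "\<dots> \<le> norm a * 2 + norm a / 8"
      using j by (intro add_mono term_bound u2 dominant w)
    also have "\<dots> \<le> 3 * norm a" using norm_ge_zero[of a] by linarith
    finally show "cmod (g' a w) \<le> 3 * norm a" .
  next
    fix a :: "nat \<Rightarrow>\<^sub>C complex"
    have "cmod (g a 0 - 0) \<le> 2 * (norm a / 16)"
    proof (rule geometric_perturbation_bound[OF g])
      show "cmod (apply_bcontfun a k * U k 0 - (if k = 0 then 0 else 0)) \<le> norm a / 16 * (1/2) ^ k" for k
        using term_bound[OF U_small[of 0 k], where a = a and i = k] by simp
    qed simp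
    also have "\<dots> \<le> norm a" using norm_ge_zero[of a] by linarith
    finally show "cmod (g a 0) \<le> norm a" by (simp only: diff_zero)
    have "\<exists>n. norm a / 2 \<le> cmod (apply_bcontfun a n)"
    proof (rule ccontr)
      assume neg: "\<nexists>n. norm a / 2 \<le> cmod (apply_bcontfun a n)"
      then have "norm a \<le> norm a / 2" by (intro norm_bound) (auto simp: not_le less_imp_le)
      then have "norm a = 0" using norm_ge_zero[of a] by linarith
      then show False using neg by simp
    qed
    then obtain n where n: "norm a / 2 \<le> cmod (apply_bcontfun a n)" by blast
    have zn: "cmod (z n) < 1" using z(1)[of n] Z(2) by auto
    have "norm a / 2 * (3/4) \<le> cmod (apply_bcontfun a n * u n (z n))"
      unfolding norm_mult using n z(4)[of n] by (intro mult_mono) auto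
    moreover have "cmod (g' a (z n) - apply_bcontfun a n * u n (z n)) \<le> norm a / 8"
      using off_annulus[OF zn z(2,3)] by (intro dominant[OF zn]) auto
    ultimately have "norm a / 4 \<le> cmod (g' a (z n))"
      using norm_triangle_ineq2[of "apply_bcontfun a n * u n (z n)" "g' a (z n)"]
      by (simp add: norm_minus_commute)
    then show "\<exists>z\<in>Z. norm a / 4 \<le> cmod (g' a z)" using z(1) by blast
  qed
qed

section \<open>Elements of the function spaces\<close>

lemma clinear_functional_has_derivative:
  fixes f :: "'a::complex_normed_vector \<Rightarrow> complex"
  assumes "\<And>u v. f (u + v) = f u + f v" "\<And>c v. f (c *\<^sub>C v) = c * f v" "\<And>v. cmod (f v) \<le> norm v"
  shows "(f has_derivative f) (at x)"
proof (rule bounded_linear_imp_has_derivative)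
  show "bounded_linear f"
  proof (rule bounded_linear_intro[of f 1])
    fix r :: real and v
    show "f (r *\<^sub>R v) = r *\<^sub>R f v"
      using assms(2)[of "of_real r" v] by (simp add: scaleC_of_real scaleR_conv_of_real)
  qed (use assms(1,3) in auto)
qed

lemma clinear_functional_cholomorphic:
  fixes f :: "'a::complex_normed_vector \<Rightarrow> complex"
  assumes "\<And>u v. f (u + v) = f u + f v" "\<And>c v. f (c *\<^sub>C v) = c * f v" "\<And>v. cmod (f v) \<le> norm v"
  shows "cholomorphic_on f U"
  using clinear_functional_has_derivative[of f, OF assms] assms(2)
  unfolding cholomorphic_on_def scaleC_complex_def by blast

lemma clinear_functional_diff:
  fixes f :: "'a::complex_normed_vector \<Rightarrow> complex"
  assumes "\<And>u v. f (u + v) = f u + f v"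
  shows "f (u - v) = f u - f v"
  using assms[of "u - v" v] by simp

lemma hol_lip_exists:
  fixes f :: "'a::complex_normed_vector \<Rightarrow> complex"
  assumes "cholomorphic_on f (ball 0 1)" "C-lipschitz_on (ball 0 1) f"
  shows "\<exists>F. \<forall>x\<in>ball 0 1. hl_apply F x = f x"
proof -
  let ?f = "\<lambda>x. if x \<in> ball 0 1 then f x else 0"
  have "cholomorphic_on ?f (ball 0 1)"
    by (rule cholomorphic_on_cong[OF assms(1)]) auto
  moreover have "C-lipschitz_on (ball 0 1) ?f"
    by (rule lipschitz_on_transform[OF assms(2)]) auto
  ultimately have "hl_apply (Abs_hol_lip ?f) = ?f"
    by (intro Abs_hol_lip_inverse) auto
  then show ?thesis by (intro exI[of _ "Abs_hol_lip ?f"]) simp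
qed

lemma hol_inf_exists:
  fixes f :: "'a::complex_normed_vector \<Rightarrow> complex"
  assumes "cholomorphic_on f (ball 0 1)" "\<And>x. x \<in> ball 0 1 \<Longrightarrow> cmod (f x) \<le> M"
  shows "\<exists>F. \<forall>x\<in>ball 0 1. hi_apply F x = f x"
proof -
  let ?f = "\<lambda>x. if x \<in> ball 0 1 then f x else 0"
  have "cholomorphic_on ?f (ball 0 1)"
    by (rule cholomorphic_on_cong[OF assms(1)]) auto
  moreover have "bounded (?f ` ball 0 1)"
    using assms(2) by (auto simp: bounded_iff intro!: exI[of _ M])
  ultimately have "hi_apply (Abs_hol_inf ?f) = ?f"
    by (intro Abs_hol_inf_inverse) auto
  then show ?thesis by (intro exI[of _ "Abs_hol_inf ?f"]) simp
qed

section \<open>Compact operators\<close>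

lemma bounded_clinear_add: "bounded_clinear T \<Longrightarrow> T (x + y) = T x + T y"
  and bounded_clinear_scaleC: "bounded_clinear T \<Longrightarrow> T (c *\<^sub>C x) = c *\<^sub>C T x"
  unfolding bounded_clinear_def Vector_Spaces.linear_iff by blast+

lemma bounded_clinear_diff: "bounded_clinear T \<Longrightarrow> T (x - y) = T x - T y"
  using bounded_clinear_add[of T "x - y" y] by simp

lemma compact_operator_finite_net:
  assumes "compact_operator T" "e > 0"
  shows "\<exists>F. finite F \<and> F \<subseteq> cball 0 1 \<and> (\<forall>f\<in>cball 0 1. \<exists>f0\<in>F. norm (T f - T f0) < e)"
proof -
  have "compact (closure (T ` cball 0 1))"
    using assms(1) by (simp add: compact_operator_def)
  then obtain K where K: "finite K" "K \<subseteq> T ` cball 0 1" "T ` cball 0 1 \<subseteq> (\<Union>x\<in>K. ball x e)"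
    using finite_net_of_compact_closure[OF _ assms(2)] by metis
  then obtain F where F: "F \<subseteq> cball 0 1" "finite F" "K = T ` F"
    using finite_subset_image by metis
  have "\<exists>f0\<in>F. norm (T f - T f0) < e" if f: "f \<in> cball 0 1" for f
  proof -
    have "T f \<in> (\<Union>x\<in>K. ball x e)" using K(3) f by blast
    then show ?thesis using F(3) by (auto simp: dist_norm norm_minus_commute)
  qed
  with F(1,2) show ?thesis by blast
qed

lemma compact_operator_if_finite_nets:
  fixes T :: "'a::complex_normed_vector \<Rightarrow> 'b::complex_normed_vector"
  assumes T: "bounded_clinear T" and comp: "complete (UNIV :: 'b set)"
    and net: "\<And>e. e > 0 \<Longrightarrow> \<exists>F. finite F \<and> (\<forall>f\<in>cball 0 1. \<exists>f0\<in>F. norm (T f - T f0) < e)"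
  shows "compact_operator T"
  unfolding compact_operator_def
proof (intro conjI T compact_closure_if_finite_nets comp)
  fix e :: real assume e: "e > 0"
  obtain F where F: "finite F" "\<forall>f\<in>cball 0 1. \<exists>f0\<in>F. norm (T f - T f0) < e"
    using net[OF e] by blast
  have "T ` cball 0 1 \<subseteq> (\<Union>x\<in>T ` F. ball x e)"
  proof (rule image_subsetI)
    fix f :: 'a assume "f \<in> cball 0 1"
    then show "T f \<in> (\<Union>x\<in>T ` F. ball x e)"
      using F(2) by (force simp: dist_norm norm_minus_commute)
  qed
  with F(1) show "\<exists>k. finite k \<and> T ` cball 0 1 \<subseteq> (\<Union>x\<in>k. ball x e)" by blast
qed

lemma linf_separated_sequence:
  obtains u :: "nat \<Rightarrow> nat \<Rightarrow>\<^sub>C complex" where "\<And>k. norm (u k) \<le> 1" "\<And>j k. j \<noteq> k \<Longrightarrow> 1 \<le> norm (u j - u k)"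
proof -
  define u where "u k = Bcontfun (\<lambda>i :: nat. if i = k then 1 else 0 :: complex)" for k
  have "(\<lambda>i :: nat. if i = k then 1 else 0 :: complex) \<in> bcontfun" for k
    by (auto simp: bcontfun_def bounded_iff)
  then have u: "apply_bcontfun (u k) = (\<lambda>i. if i = k then 1 else 0)" for k
    unfolding u_def by (rule Bcontfun_inverse)
  show ?thesis
  proof (rule that[of u])
    show "norm (u k) \<le> 1" for k
      by (rule norm_bound) (simp add: u)
    show "1 \<le> norm (u j - u k)" if "j \<noteq> k" for j k
      using norm_bounded[of "u j - u k" j] that by (simp add: u minus_bcontfun.rep_eq)
  qed
qed

text \<open>If the operator were bounded below on a copy of \<open>\<ell>\<^sub>\<infinity>\<close>, the images of the unit vectors would be uniformly
separated, so a finite net of small radius would have to place two of them near the same point.\<close>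

lemma compact_operator_not_fixes_linf:
  assumes T: "compact_operator T"
  shows "\<not> fixes_copy_of_linf T"
proof
  assume "fixes_copy_of_linf T"
  then obtain G and J :: "(nat \<Rightarrow>\<^sub>C complex) \<Rightarrow> 'a" where J: "clinear_iso J UNIV G" and TG: "clinear_iso T G (T ` G)"
    by (auto simp: fixes_copy_of_linf_def)
  obtain cJ CJ where cJ: "cJ > 0" "CJ > 0" "\<And>a. cJ * norm a \<le> norm (J a)" "\<And>a. norm (J a) \<le> CJ * norm a"
    using clinear_iso_bounds[OF J] by (metis UNIV_I)
  obtain cT CT where cT: "cT > 0" "\<And>x. x \<in> G \<Longrightarrow> cT * norm x \<le> norm (T x)"
    using clinear_iso_bounds[OF TG] by metis
  have J_add: "J (a + b) = J a + J b" for a b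
    using J by (simp add: clinear_iso_def)
  have J_diff: "J (a - b) = J a - J b" for a b
    using J_add[of "a - b" b] by simp
  have JG: "J a \<in> G" for a
    using J by (auto simp: clinear_iso_def homeomorphism_def)
  have blin: "bounded_clinear T" using T by (simp add: compact_operator_def)
  obtain u :: "nat \<Rightarrow> nat \<Rightarrow>\<^sub>C complex" where u: "\<And>k. norm (u k) \<le> 1" "\<And>j k. j \<noteq> k \<Longrightarrow> 1 \<le> norm (u j - u k)"
    using linf_separated_sequence by blast
  define x where "x k = complex_of_real (inverse CJ) *\<^sub>C J (u k)" for k
  have x_ball: "x k \<in> cball 0 1" for k
  proof -
    have "norm (J (u k)) \<le> CJ * 1"
      using order_trans[OF cJ(4)[of "u k"] mult_left_mono[OF u(1)[of k], of CJ]] cJ(2) by simp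
    then show ?thesis using cJ(2) by (simp add: x_def norm_scaleC norm_divide field_simps del: of_real_inverse)
  qed
  define e where "e = cT * cJ / CJ"
  have e: "e > 0" using cJ cT by (simp add: e_def)
  have sep: "e \<le> norm (T (x j) - T (x k))" if "j \<noteq> k" for j k
  proof -
    have "cJ * 1 \<le> cJ * norm (u j - u k)"
      using u(2)[OF that] cJ(1) by (intro mult_left_mono) auto
    also have "\<dots> \<le> norm (J (u j - u k))" by (rule cJ(3))
    finally have "cT * cJ \<le> norm (T (J (u j - u k)))"
      using cT(2)[OF JG, of "u j - u k"] cT(1) by (smt (verit) mult_left_mono mult.right_neutral)
    moreover have "T (x j) - T (x k) = complex_of_real (inverse CJ) *\<^sub>C T (J (u j - u k))"
      unfolding x_def J_diff bounded_clinear_diff[OF blin] bounded_clinear_scaleC[OF blin]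
        complex_vector.scale_right_diff_distrib ..
    ultimately show ?thesis
      using cJ(2) by (simp add: e_def norm_scaleC norm_divide field_simps del: of_real_inverse)
  qed
  have "e / 2 > 0" using e by simp
  then obtain F where F: "finite F" "\<forall>f\<in>cball 0 1. \<exists>f0\<in>F. norm (T f - T f0) < e / 2"
    using compact_operator_finite_net[OF T] by blast
  then have "\<forall>k. \<exists>f0\<in>F. norm (T (x k) - T f0) < e / 2" using x_ball by blast
  then obtain c where c: "\<And>k. c k \<in> F" "\<And>k. norm (T (x k) - T (c k)) < e / 2" by metis
  have "\<not> inj c"
    using F(1) c(1) by (metis finite_imageD finite_subset image_subsetI infinite_UNIV_nat)
  then obtain j k where jk: "j \<noteq> k" "c j = c k" by (auto simp: inj_def)
  have "dist (T (x j)) (T (x k)) < e"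
    using c(2)[of j] c(2)[of k] jk(2) unfolding dist_norm[symmetric] by metric
  with sep[OF jk(1)] show False by (simp add: dist_norm)
qed

section \<open>Composition operators\<close>

text \<open>Transposition of the evaluation matrix. Norming functionals restrict to members of the unit ball of
Lipschitz functions, so two values of \<open>\<phi>\<close> at which each of these members nearly takes one value are close in norm.\<close>

lemma compact_comp_hol_lip_imp_relatively_compact:
  fixes \<phi> :: "('y::complex_banach, 'x::complex_banach) hol_lip"
  assumes \<phi>: "hl_apply \<phi> ` ball 0 1 \<subseteq> ball 0 1"
    and T: "compact_operator (comp_hol_lip \<phi> :: ('x, complex) hol_lip \<Rightarrow> ('y, complex) hol_lip)"
  shows "compact (closure (hl_apply \<phi> ` ball 0 1))"
proof (rule compact_closure_if_finite_nets)
  fix e :: real assume e: "e > 0"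
  let ?T = "comp_hol_lip \<phi> :: ('x, complex) hol_lip \<Rightarrow> ('y, complex) hol_lip"
  have \<phi>_in: "hl_apply \<phi> y \<in> ball 0 1" if "y \<in> ball 0 1" for y using \<phi> that by blast
  have "\<exists>B0. finite B0 \<and> B0 \<subseteq> ball 0 1 \<and> (\<forall>y\<in>ball 0 1. \<exists>y0\<in>B0. \<forall>f\<in>cball 0 1.
      cmod (hl_apply f (hl_apply \<phi> y) - hl_apply f (hl_apply \<phi> y0)) < e)"
  proof (rule finite_net_transpose[where M = 1])
    fix f :: "('x, complex) hol_lip" and y :: 'y
    assume f: "f \<in> cball 0 1" and y: "y \<in> ball 0 1"
    show "cmod (hl_apply f (hl_apply \<phi> y)) \<le> 1"
      using hl_norm_le[OF \<phi>_in[OF y], of f] f by simp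
  next
    fix e :: real assume e: "e > 0"
    obtain F where F: "finite F" "F \<subseteq> cball 0 1"
      "\<forall>f\<in>cball 0 1. \<exists>f0\<in>F. norm (?T f - ?T f0) < e"
      using compact_operator_finite_net[OF T e] by (elim exE conjE) (rule that, assumption+)
    have "cmod (hl_apply f (hl_apply \<phi> y) - hl_apply f0 (hl_apply \<phi> y)) < e"
      if "norm (?T f - ?T f0) < e" "y \<in> ball 0 1" for f f0 y
      using hl_norm_le[OF that(2), of "?T f - ?T f0"] that
      by (simp add: hl_apply_simps comp_hol_lip_apply[OF \<phi>])
    then show "\<exists>A0. finite A0 \<and> A0 \<subseteq> cball 0 1 \<and> (\<forall>f\<in>cball 0 1. \<exists>f0\<in>A0. \<forall>y\<in>ball 0 1.
        cmod (hl_apply f (hl_apply \<phi> y) - hl_apply f0 (hl_apply \<phi> y)) < e)"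
      using F by (intro exI[of _ F]) blast
  qed (rule e)
  then obtain B0 where B0: "finite B0" "B0 \<subseteq> ball 0 1" "\<And>y. y \<in> ball 0 1 \<Longrightarrow> \<exists>y0\<in>B0. \<forall>f\<in>cball 0 1.
      cmod (hl_apply f (hl_apply \<phi> y) - hl_apply f (hl_apply \<phi> y0)) < e" by blast
  have "hl_apply \<phi> ` ball 0 1 \<subseteq> (\<Union>x\<in>hl_apply \<phi> ` B0. ball x e)"
  proof (rule image_subsetI)
    fix y :: 'y assume y: "y \<in> ball 0 1"
    then obtain y0 where y0: "y0 \<in> B0" "\<And>f :: ('x, complex) hol_lip. f \<in> cball 0 1 \<Longrightarrow>
      cmod (hl_apply f (hl_apply \<phi> y) - hl_apply f (hl_apply \<phi> y0)) < e"
      using B0(3) by blast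
    let ?v = "hl_apply \<phi> y - hl_apply \<phi> y0"
    obtain f where f: "\<And>u v. f (u + v) = f u + f v" "\<And>c v. f (c *\<^sub>C v) = c * f v"
      "\<And>v. cmod (f v) \<le> norm v" "f ?v = of_real (norm ?v)"
      using Hahn_Banach_norming_functional[of ?v] by metis
    have f_diff: "f u - f v = f (u - v)" for u v
      using clinear_functional_diff[of f, OF f(1)] by simp
    have "1-lipschitz_on (ball 0 1) f"
      using f(3) by (intro lipschitz_onI) (auto simp: dist_norm f_diff)
    then obtain F where F: "\<And>x. x \<in> ball 0 1 \<Longrightarrow> hl_apply F x = f x"
      using hol_lip_exists[OF clinear_functional_cholomorphic[OF f(1-3)]] by blast
    have "norm F \<le> 1 + cmod (hl_apply F 0)"
      using f(3) by (intro hl_norm_bound) (auto simp: F f_diff)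
    moreover have "cmod (hl_apply F 0) = 0" using F[of 0] f(3)[of 0] by simp
    ultimately have "F \<in> cball 0 1" by simp
    from y0(2)[OF this] have "cmod (f ?v) < e"
      using F \<phi>_in[OF y] \<phi>_in[of y0] y0(1) B0(2) by (auto simp: f_diff)
    then have "hl_apply \<phi> y \<in> ball (hl_apply \<phi> y0) e"
      by (simp add: f(4) dist_norm norm_minus_commute)
    then show "hl_apply \<phi> y \<in> (\<Union>x\<in>hl_apply \<phi> ` B0. ball x e)"
      using y0(1) by blast
  qed
  then show "\<exists>k. finite k \<and> hl_apply \<phi> ` ball 0 1 \<subseteq> (\<Union>x\<in>k. ball x e)"
    using B0(1) by blast
qed (rule complete_UNIV)

lemma field_derivative_le_lipschitz:
  fixes k :: "complex \<Rightarrow> complex"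
  assumes d: "(k has_field_derivative d) (at s)" and U: "open U" "s \<in> U"
    and L: "\<And>w. w \<in> U \<Longrightarrow> cmod (k w - k s) \<le> L * cmod (w - s)"
  shows "cmod d \<le> L"
proof (rule tendsto_upperbound)
  show "((\<lambda>w. cmod ((k w - k s) / (w - s))) \<longlongrightarrow> cmod d) (at s)"
    using d unfolding has_field_derivative_iff by (rule tendsto_norm)
  have "\<forall>\<^sub>F w in at s. w \<in> U \<and> w \<noteq> s"
    using U by (auto simp: eventually_at_topological)
  then show "\<forall>\<^sub>F w in at s. cmod ((k w - k s) / (w - s)) \<le> L"
    by eventually_elim (use L in \<open>auto simp: norm_divide divide_le_eq\<close>)
qed simp

text \<open>The disc through \<open>y0\<close> reduces the claim to the unit disc. The lower bound compares the Lipschitz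
constant of \<open>g a \<circ> h\<close> with its derivative \<open>g' a (h w) h' w\<close> at a point \<open>w\<close> where \<open>h'\<close> is at least \<open>c\<close> and
\<open>g' a (h w)\<close> is at least a quarter of the norm of \<open>a\<close>.\<close>

lemma comp_hol_lip_fixes_linf:
  fixes \<phi> :: "('y::complex_banach, 'x::complex_banach) hol_lip"
  assumes \<phi>: "hl_apply \<phi> ` ball 0 1 \<subseteq> ball 0 1"
    and y0: "norm y0 \<le> 1" "norm (lip_ext \<phi> y0) = 1"
  shows "fixes_copy_of_linf (comp_hol_lip \<phi> :: ('x, complex) hol_lip \<Rightarrow> ('y, complex) hol_lip)"
proof -
  let ?T = "comp_hol_lip \<phi> :: ('x, complex) hol_lip \<Rightarrow> ('y, complex) hol_lip"
  have \<phi>_in: "hl_apply \<phi> y \<in> ball 0 1" if "y \<in> ball 0 1" for y using \<phi> that by blast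
  have line: "w *\<^sub>C y0 \<in> ball 0 1" if "cmod w < 1" for w
  proof -
    have "cmod w * norm y0 \<le> cmod w" using y0(1) by (intro mult_left_le) auto
    then show ?thesis using that by (simp add: norm_scaleC)
  qed
  have line_c: "w *\<^sub>C y0 \<in> cball 0 1" if "cmod w \<le> 1" for w
    using mult_mono[OF that y0(1)] by (simp add: norm_scaleC)
  obtain f where f: "\<And>u v. f (u + v) = f u + f v" "\<And>c v. f (c *\<^sub>C v) = c * f v"
    "\<And>v. cmod (f v) \<le> norm v" "f (lip_ext \<phi> y0) = 1"
    using Hahn_Banach_norming_functional[of "lip_ext \<phi> y0"] y0(2) by (metis of_real_1)
  have f_hol: "cholomorphic_on f U" for U
    by (rule clinear_functional_cholomorphic[OF f(1-3)])
  have f_in: "cmod (f x) < 1" if "x \<in> ball 0 1" for x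
    using f(3)[of x] that by simp
  have f_diff: "f u - f v = f (u - v)" for u v
    using clinear_functional_diff[of f, OF f(1)] by simp
  define h where "h w = f (lip_ext \<phi> (w *\<^sub>C y0))" for w
  have h_eq: "h w = f (hl_apply \<phi> (w *\<^sub>C y0))" if "cmod w < 1" for w
    using lip_ext[of \<phi>] line[OF that] by (simp add: h_def)
  have "(\<lambda>w. f (hl_apply \<phi> (0 + w *\<^sub>C y0))) holomorphic_on ball 0 1"
    by (rule cholomorphic_along_line[OF cholomorphic_on_compose[OF hl_holomorphic f_hol subset_UNIV]])
      (use line in auto)
  then have h_hol: "h holomorphic_on ball 0 1"
    by (rule holomorphic_transform) (simp add: h_eq)
  have h_less: "cmod (h w) < 1" if "cmod w < 1" for w
    using h_eq[OF that] f_in[OF \<phi>_in[OF line[OF that]]] by simp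
  have h1: "h 1 = 1" by (simp add: h_def scaleC_one f(4))
  have f_cont: "continuous_on U f" for U
    by (intro continuous_at_imp_continuous_on ballI
        has_derivative_continuous[OF clinear_functional_has_derivative[OF f(1-3)]])
  obtain C where C: "C-lipschitz_on (cball 0 1) (lip_ext \<phi>)" using lip_ext by blast
  have h_cont: "continuous_on (cball 0 1) h"
    unfolding h_def
    by (intro continuous_on_compose2[OF f_cont[of UNIV]]
        continuous_on_compose2[OF lipschitz_on_continuous_on[OF C]]
        bounded_linear.continuous_on[OF bounded_linear_scaleC_left] continuous_on_id)
      (use line_c in auto)
  obtain c where c: "c > 0"
    "\<And>r. 0 \<le> r \<Longrightarrow> r < 1 \<Longrightarrow> \<exists>s. r < s \<and> s < 1 \<and> c \<le> cmod (deriv h (of_real s))"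
    using radial_derivative_large[OF h_hol h_less h_cont h1] by metis
  \<comment> \<open>The images of the points where the derivative of \<open>h\<close> is large accumulate at \<open>h 1 = 1\<close>.\<close>
  define Z where "Z = {h w | w. cmod w < 1 \<and> c \<le> cmod (deriv h w)}"
  have Z_ball: "Z \<subseteq> ball 0 1" using h_less by (auto simp: Z_def)
  have Z_1: "1 \<in> closure Z"
    unfolding closure_approachable
  proof (intro allI impI)
    fix e :: real assume "e > 0"
    then obtain d where d: "d > 0" "\<And>w. w \<in> cball 0 1 \<Longrightarrow> dist w 1 < d \<Longrightarrow> dist (h w) (h 1) < e"
      using h_cont unfolding continuous_on_iff by (metis mem_cball_0 norm_one order_refl)
    obtain s where s: "max 0 (1 - d) < s" "s < 1" "c \<le> cmod (deriv h (of_real s))"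
      using c(2)[of "max 0 (1 - d)"] d(1) by auto
    have "dist (complex_of_real s) 1 = 1 - s"
      using s norm_of_real[where 'a = complex, of "s - 1"] by (simp add: dist_norm)
    then have "dist (h (of_real s)) 1 < e"
      using d(2)[of "of_real s"] s h1 by simp
    moreover have "h (of_real s) \<in> Z" using s unfolding Z_def by fastforce
    ultimately show "\<exists>z\<in>Z. dist z 1 < e" by blast
  qed
  obtain g g' :: "(nat \<Rightarrow>\<^sub>C complex) \<Rightarrow> complex \<Rightarrow> complex" where
    g_add: "\<And>a b w. cmod w < 1 \<Longrightarrow> g (a + b) w = g a w + g b w" and
    g_scale: "\<And>c a w. cmod w < 1 \<Longrightarrow> g (c *\<^sub>C a) w = c * g a w" and
    g_deriv: "\<And>a w. cmod w < 1 \<Longrightarrow> (g a has_field_derivative g' a w) (at w)" and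
    g'_le: "\<And>a w. cmod w < 1 \<Longrightarrow> cmod (g' a w) \<le> 3 * norm a" and
    g_0: "\<And>a. cmod (g a 0) \<le> norm a" and
    g'_ge: "\<And>a. \<exists>z\<in>Z. norm a / 4 \<le> cmod (g' a z)"
    by (fact linf_interpolation[OF Z_1 Z_ball])
  have g_lip: "cmod (g a v - g a w) \<le> 3 * norm a * cmod (v - w)" if "cmod v < 1" "cmod w < 1" for a v w
    by (rule field_differentiable_bound[OF convex_ball, of 0 1 "g a" "g' a"])
      (use that g'_le in \<open>auto intro: has_field_derivative_at_within g_deriv\<close>)
  have gf_lip: "cmod (g a (f u) - g a (f v)) \<le> 3 * norm a * norm (u - v)"
    if "u \<in> ball 0 1" "v \<in> ball 0 1" for a u v
  proof -
    have "cmod (g a (f u) - g a (f v)) \<le> 3 * norm a * cmod (f u - f v)"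
      using f_in that by (intro g_lip) auto
    also have "\<dots> \<le> 3 * norm a * norm (u - v)"
      unfolding f_diff by (intro mult_left_mono f(3)) simp
    finally show ?thesis .
  qed
  have "\<exists>F. \<forall>x\<in>ball 0 1. hl_apply F x = g a (f x)" for a
  proof (rule hol_lip_exists)
    have "g a holomorphic_on ball 0 1"
      unfolding holomorphic_on_open[OF open_ball] by (intro ballI exI, rule g_deriv) simp
    then have "cholomorphic_on (g a) (ball 0 1)" by (simp add: cholomorphic_on_complex)
    then show "cholomorphic_on (\<lambda>x. g a (f x)) (ball 0 1)"
      by (intro cholomorphic_on_compose[OF f_hol]) (use f_in in auto)
    show "(3 * norm a)-lipschitz_on (ball 0 1) (\<lambda>x. g a (f x))"
      using gf_lip by (intro lipschitz_onI) (auto simp: dist_norm)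
  qed
  then obtain J :: "(nat \<Rightarrow>\<^sub>C complex) \<Rightarrow> ('x, complex) hol_lip" where
    J: "\<And>a x. x \<in> ball 0 1 \<Longrightarrow> hl_apply (J a) x = g a (f x)" by metis
  have J_add: "J (a + b) = J a + J b" for a b
    by (rule hl_eqI) (simp add: J hl_apply_simps g_add[OF f_in])
  have J_scale: "J (k *\<^sub>C a) = k *\<^sub>C J a" for k a
    by (rule hl_eqI) (simp add: J hl_apply_simps g_scale[OF f_in] scaleC_complex_def)
  have J_le: "norm (J a) \<le> 4 * norm a" for a
  proof -
    have "norm (J a) \<le> 3 * norm a + cmod (hl_apply (J a) 0)"
      using gf_lip by (intro hl_norm_bound) (auto simp: J)
    moreover have "f 0 = 0" using f(3)[of 0] by simp
    ultimately show ?thesis using g_0[of a] by (simp add: J)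
  qed
  have TJ_ge: "c / 4 * norm a \<le> norm (?T (J a))" for a
  proof -
    obtain w where w: "cmod w < 1" "c \<le> cmod (deriv h w)" "norm a / 4 \<le> cmod (g' a (h w))"
      using g'_ge[of a] by (auto simp: Z_def)
    have TJ: "hl_apply (?T (J a)) (v *\<^sub>C y0) = g a (h v)" if "cmod v < 1" for v
      using line[OF that] \<phi>_in[OF line[OF that]]
      by (simp add: comp_hol_lip_apply[OF \<phi>] J h_eq[OF that])
    have "(h has_field_derivative deriv h w) (at w)"
      using w(1) by (intro holomorphic_derivI[OF h_hol]) auto
    then have "((\<lambda>v. g a (h v)) has_field_derivative g' a (h w) * deriv h w) (at w)"
      by (rule DERIV_chain2[where g = h, OF g_deriv[OF h_less[OF w(1)]]])
    then have "cmod (g' a (h w) * deriv h w) \<le> norm (?T (J a))"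
    proof (rule field_derivative_le_lipschitz[OF _ open_ball[of 0 1]])
      show "w \<in> ball 0 1" using w(1) by simp
      fix v :: complex assume "v \<in> ball 0 1"
      then have v: "cmod v < 1" by simp
      have "cmod (g a (h v) - g a (h w)) \<le> norm (?T (J a)) * norm (v *\<^sub>C y0 - w *\<^sub>C y0)"
        using hl_diff_le[OF line[OF v] line[OF w(1)], of "?T (J a)"] by (simp add: TJ v w(1))
      also have "norm (v *\<^sub>C y0 - w *\<^sub>C y0) \<le> cmod (v - w)"
        using y0(1) by (simp add: norm_scaleC mult_left_le flip: complex_vector.scale_left_diff_distrib)
      finally show "cmod (g a (h v) - g a (h w)) \<le> norm (?T (J a)) * cmod (v - w)"
        by (simp add: mult_left_mono)
    qed
    moreover have "norm a / 4 * c \<le> cmod (g' a (h w) * deriv h w)"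
      unfolding norm_mult using w c(1) by (intro mult_mono) auto
    ultimately show ?thesis by (simp add: mult.commute)
  qed
  have blin: "bounded_clinear ?T" by (rule bounded_clinear_comp_hol_lip[OF \<phi>])
  then obtain K where K: "\<And>x. norm (?T x) \<le> K * norm x"
    unfolding bounded_clinear_def by blast
  have K': "norm (?T x) \<le> (\<bar>K\<bar> + 1) * norm x" for x
  proof -
    have "K * norm x \<le> (\<bar>K\<bar> + 1) * norm x" by (intro mult_right_mono) auto
    with K[of x] show ?thesis by linarith
  qed
  have isoJ: "clinear_iso J UNIV (range J)"
  proof (rule clinear_isoI)
    show "0 < c / 4 / (\<bar>K\<bar> + 1)" using c(1) by simp
    show "c / 4 / (\<bar>K\<bar> + 1) * norm a \<le> norm (J a)" for a
      using order_trans[OF TJ_ge[of a] K'[of "J a"]] by (simp add: field_simps)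
  qed (auto simp: J_add J_scale intro: J_le)
  have "clinear_iso ?T (range J) (?T ` range J)"
  proof (rule clinear_isoI)
    show "complex_vector.subspace (range J)" using isoJ by (simp add: clinear_iso_def)
    show "0 < c / 16" using c(1) by simp
    show "c / 16 * norm x \<le> norm (?T x)" if "x \<in> range J" for x
    proof -
      obtain a where a: "x = J a" using \<open>x \<in> range J\<close> by blast
      have "c / 16 * norm x \<le> c / 16 * (4 * norm a)"
        unfolding a using c(1) by (intro mult_left_mono J_le) simp
      also have "\<dots> \<le> norm (?T x)" using TJ_ge[of a] a by simp
      finally show ?thesis .
    qed
  qed (auto simp: bounded_clinear_add[OF blin] bounded_clinear_scaleC[OF blin] intro: K)
  with isoJ show ?thesis unfolding fixes_copy_of_linf_def by blast
qed

lemma lip_ext_bound_finite_cdim: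
  fixes \<phi> :: "('y::complex_banach, 'x::complex_banach) hol_lip"
  assumes "finite_cdim TYPE('y)" and less: "\<And>y. y \<in> cball 0 1 \<Longrightarrow> norm (lip_ext \<phi> y) < 1"
  shows "\<exists>r<1. \<forall>y\<in>ball 0 1. norm (hl_apply \<phi> y) \<le> r"
proof -
  obtain C where C: "C-lipschitz_on (cball 0 1) (lip_ext \<phi>)" using lip_ext by blast
  have "continuous_on (cball 0 1) (\<lambda>y. norm (lip_ext \<phi> y))"
    by (intro continuous_on_norm lipschitz_on_continuous_on[OF C])
  then obtain y1 where y1: "y1 \<in> cball 0 1" "\<And>y. y \<in> cball 0 1 \<Longrightarrow> norm (lip_ext \<phi> y) \<le> norm (lip_ext \<phi> y1)"
    using continuous_attains_sup[OF finite_cdim_compact_cball[OF assms(1)], of 1] by fastforce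
  have "norm (hl_apply \<phi> y) \<le> norm (lip_ext \<phi> y1)" if "y \<in> ball 0 1" for y
    using y1(2)[of y] lip_ext[of \<phi>] that by auto
  with less[OF y1(1)] show ?thesis by blast
qed

lemma ball_around_smaller_cball: "x \<in> cball 0 r \<Longrightarrow> ball x (1 - r) \<subseteq> ball (0::'a::real_normed_vector) 1"
proof
  fix z assume "x \<in> cball 0 r" "z \<in> ball x (1 - r)"
  then show "z \<in> ball 0 1"
    using norm_triangle_sub[of z x] by (simp add: dist_norm norm_minus_commute)
qed

text \<open>Transposition of the evaluation matrix, now from points to functions: by the Cauchy estimates the unit ball of
bounded holomorphic functions is equi-Lipschitz on the ball of radius \<open>r\<close>.\<close>

lemma compact_comp_hol_inf:
  fixes \<phi> :: "('y::complex_banach, 'x::complex_banach) hol_lip"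
  assumes \<phi>: "hl_apply \<phi> ` ball 0 1 \<subseteq> ball 0 1"
    and r: "r < 1" "\<And>y. y \<in> ball 0 1 \<Longrightarrow> norm (hl_apply \<phi> y) \<le> r"
    and comp: "compact (closure (hl_apply \<phi> ` ball 0 1))"
  shows "compact_operator (comp_hol_inf \<phi> :: 'x hol_inf \<Rightarrow> 'y hol_inf)"
proof (rule compact_operator_if_finite_nets[OF bounded_clinear_comp_hol_inf[OF \<phi>] complete_hol_inf])
  fix e :: real assume e: "e > 0"
  have \<phi>_in: "hl_apply \<phi> y \<in> ball 0 1" if "y \<in> ball 0 1" for y using \<phi> that by blast
  have "\<exists>F. finite F \<and> F \<subseteq> cball 0 1 \<and> (\<forall>f\<in>cball 0 1. \<exists>f0\<in>F. \<forall>y\<in>ball 0 1.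
      cmod (hi_apply f (hl_apply \<phi> y) - hi_apply f0 (hl_apply \<phi> y)) < e / 2)"
  proof (rule finite_net_transpose[where M = 1])
    fix f :: "'x hol_inf" and y :: 'y assume "f \<in> cball 0 1" "y \<in> ball 0 1"
    then show "cmod (hi_apply f (hl_apply \<phi> y)) \<le> 1"
      using hi_norm_le[OF \<phi>_in, of y f] by simp
  next
    fix e :: real assume e: "e > 0"
    define d where "d = e * (1 - r) / 2"
    have d: "d > 0" using e r(1) by (simp add: d_def)
    obtain K where K: "finite K" "K \<subseteq> hl_apply \<phi> ` ball 0 1" "hl_apply \<phi> ` ball 0 1 \<subseteq> (\<Union>x\<in>K. ball x d)"
      using finite_net_of_compact_closure[OF comp d] by metis
    obtain A0 where A0: "A0 \<subseteq> ball 0 1" "finite A0" "K = hl_apply \<phi> ` A0"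
      using finite_subset_image[OF K(1,2)] by metis
    have close: "cmod (hi_apply f (hl_apply \<phi> y) - hi_apply f (hl_apply \<phi> y0)) < e"
      if f: "f \<in> cball 0 1" and y: "y \<in> ball 0 1" "y0 \<in> ball 0 1" "dist (hl_apply \<phi> y0) (hl_apply \<phi> y) < d"
      for f :: "'x hol_inf" and y y0
    proof -
      have "cmod (hi_apply f (hl_apply \<phi> y) - hi_apply f (hl_apply \<phi> y0))
          \<le> 2 * 1 / (1 - r) * norm (hl_apply \<phi> y - hl_apply \<phi> y0)"
      proof (rule cholomorphic_bounded_imp_lipschitz[OF hi_holomorphic _ convex_cball])
        show "cmod (hi_apply f z) \<le> 1" if "z \<in> ball 0 1" for z
          using hi_norm_le[OF that, of f] f by simp
        show "ball x (1 - r) \<subseteq> ball 0 1" if "x \<in> cball 0 r" for x :: 'x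
          using that by (rule ball_around_smaller_cball)
      qed (use r y in auto)
      also have "\<dots> < 2 * 1 / (1 - r) * d"
        using y(3) r(1) by (intro mult_strict_left_mono) (auto simp: dist_norm norm_minus_commute)
      also have "\<dots> = e" using r(1) by (simp add: d_def)
      finally show ?thesis .
    qed
    have "\<exists>y0\<in>A0. \<forall>f\<in>cball 0 1. cmod (hi_apply f (hl_apply \<phi> y) - hi_apply f (hl_apply \<phi> y0)) < e"
      if y: "y \<in> ball 0 1" for y
    proof -
      have "hl_apply \<phi> y \<in> (\<Union>x\<in>K. ball x d)" using K(3) y by blast
      then obtain y0 where "y0 \<in> A0" "dist (hl_apply \<phi> y0) (hl_apply \<phi> y) < d"
        using A0(3) by auto
      with close[OF _ y] A0(1) show ?thesis by blast
    qed
    with A0 show "\<exists>A0. finite A0 \<and> A0 \<subseteq> ball 0 1 \<and> (\<forall>y\<in>ball 0 1. \<exists>y0\<in>A0. \<forall>f\<in>cball 0 1.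
        cmod (hi_apply f (hl_apply \<phi> y) - hi_apply f (hl_apply \<phi> y0)) < e)" by blast
  qed (use e in simp)
  then obtain F where F: "finite F" "\<forall>f\<in>cball 0 1. \<exists>f0\<in>F. \<forall>y\<in>ball 0 1.
      cmod (hi_apply f (hl_apply \<phi> y) - hi_apply f0 (hl_apply \<phi> y)) < e / 2" by blast
  have "norm (comp_hol_inf \<phi> f - comp_hol_inf \<phi> f0) < e"
    if "\<forall>y\<in>ball 0 1. cmod (hi_apply f (hl_apply \<phi> y) - hi_apply f0 (hl_apply \<phi> y)) < e / 2"
    for f f0 :: "'x hol_inf"
  proof -
    have "norm (comp_hol_inf \<phi> f - comp_hol_inf \<phi> f0) \<le> e / 2"
      using that by (intro hi_norm_bound)
        (auto simp: hi_apply_simps comp_hol_inf_apply[OF \<phi>] intro!: less_imp_le)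
    then show ?thesis using e by simp
  qed
  then have "\<forall>f\<in>cball 0 1. \<exists>f0\<in>F. norm (comp_hol_inf \<phi> f - comp_hol_inf \<phi> f0) < e"
    using F(2) by meson
  with F(1) show "\<exists>F. finite F \<and> (\<forall>f\<in>cball 0 1. \<exists>f0\<in>F. norm (comp_hol_inf \<phi> f - comp_hol_inf \<phi> f0) < e)"
    by blast
qed

text \<open>Otherwise some sequence \<open>\<phi> (y n)\<close> converges to a unit vector \<open>x\<close>. For a functional \<open>f\<close> norming \<open>x\<close>, the functions
\<open>f\<^sup>m\<close> lie in the unit ball and tend to 0 pointwise on the open ball, so by compactness some composition with \<open>\<phi>\<close> has norm
below 1/2; but it is close to 1 in modulus at \<open>y n\<close> for large \<open>n\<close>.\<close>

lemma compact_comp_hol_inf_imp_bound: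
  fixes \<phi> :: "('y::complex_banach, 'x::complex_banach) hol_lip"
  assumes \<phi>: "hl_apply \<phi> ` ball 0 1 \<subseteq> ball 0 1" and dim: "finite_cdim TYPE('x)"
    and T: "compact_operator (comp_hol_inf \<phi> :: 'x hol_inf \<Rightarrow> 'y hol_inf)"
  shows "\<exists>r<1. \<forall>y\<in>ball 0 1. norm (hl_apply \<phi> y) \<le> r"
proof (rule ccontr)
  note [simp] = comp_hol_inf_apply[OF \<phi>]
  assume "\<not> ?thesis"
  then have none: "\<exists>y\<in>ball 0 1. r < norm (hl_apply \<phi> y)" if "r < 1" for r
    using that by (meson not_le)
  have "\<forall>n. \<exists>y\<in>ball 0 1. 1 - inverse (real (Suc n)) < norm (hl_apply \<phi> y)"
    using none by simp
  then obtain y where y: "\<And>n. y n \<in> ball 0 1" "\<And>n. 1 - inverse (real (Suc n)) < norm (hl_apply \<phi> (y n))"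
    by metis
  have \<phi>_in: "hl_apply \<phi> y \<in> ball 0 1" if "y \<in> ball 0 1" for y using \<phi> that by blast
  have "hl_apply \<phi> (y n) \<in> cball 0 1" for n
    using \<phi>_in[OF y(1)[of n]] by simp
  then obtain x s where s: "strict_mono s" "((\<lambda>n. hl_apply \<phi> (y n)) \<circ> s) \<longlonglongrightarrow> x"
    using seq_compactE[of "cball 0 1" "\<lambda>n. hl_apply \<phi> (y n)"] finite_cdim_compact_cball[OF dim, of 1]
    unfolding compact_eq_seq_compact_metric by metis
  then have s: "strict_mono s" "(\<lambda>n. hl_apply \<phi> (y (s n))) \<longlonglongrightarrow> x"
    by (auto simp: o_def)
  have "(\<lambda>n. norm (hl_apply \<phi> (y n))) \<longlonglongrightarrow> 1"
  proof (rule tendsto_sandwich)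
    show "(\<lambda>n. 1 - inverse (real (Suc n))) \<longlonglongrightarrow> 1"
      using tendsto_diff[OF tendsto_const LIMSEQ_inverse_real_of_nat, of 1] by simp
    show "\<forall>\<^sub>F n in sequentially. norm (hl_apply \<phi> (y n)) \<le> 1"
      using \<phi>_in[OF y(1)] by (auto simp: less_imp_le)
    show "\<forall>\<^sub>F n in sequentially. 1 - inverse (real (Suc n)) \<le> norm (hl_apply \<phi> (y n))"
      using y(2) by (intro always_eventually allI less_imp_le)
  qed simp
  then have "(\<lambda>n. norm (hl_apply \<phi> (y (s n)))) \<longlonglongrightarrow> 1"
    using LIMSEQ_subseq_LIMSEQ[OF _ s(1)] by (fastforce simp: o_def)
  then have x: "norm x = 1"
    using LIMSEQ_unique[OF tendsto_norm[OF s(2)]] by blast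
  obtain f where f: "\<And>u v. f (u + v) = f u + f v" "\<And>c v. f (c *\<^sub>C v) = c * f v"
    "\<And>v. cmod (f v) \<le> norm v" "f x = 1"
    using Hahn_Banach_norming_functional[of x] x by (metis of_real_1)
  have f_in: "cmod (f v) < 1" if "v \<in> ball 0 1" for v
    using f(3)[of v] that by simp
  have "\<exists>F. \<forall>v\<in>ball 0 1. hi_apply F v = f v ^ m" for m
  proof (rule hol_inf_exists)
    have "cholomorphic_on (\<lambda>z::complex. z ^ m) UNIV"
      unfolding cholomorphic_on_complex[OF open_UNIV] by (intro holomorphic_intros)
    then show "cholomorphic_on (\<lambda>v. f v ^ m) (ball 0 1)"
      by (intro cholomorphic_on_compose[OF clinear_functional_cholomorphic[OF f(1-3)]]) auto
    show "cmod (f v ^ m) \<le> 1" if "v \<in> ball 0 1" for v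
      using f_in[OF that] by (simp add: norm_power power_le_one)
  qed
  then obtain F where F: "\<And>m v. v \<in> ball 0 1 \<Longrightarrow> hi_apply (F m) v = f v ^ m" by metis
  have "norm (F m) \<le> 1" for m
    using f_in by (intro hi_norm_bound) (simp add: F norm_power power_le_one less_imp_le)
  then have "comp_hol_inf \<phi> (F m) \<in> closure (comp_hol_inf \<phi> ` cball 0 1)" for m
    by (intro closure_subset[THEN subsetD] imageI) simp
  moreover have "compact (closure (comp_hol_inf \<phi> ` cball (0::'x hol_inf) 1))"
    using T by (simp add: compact_operator_def)
  ultimately obtain g t where t: "strict_mono t" "((\<lambda>m. comp_hol_inf \<phi> (F m)) \<circ> t) \<longlonglongrightarrow> g"
    using seq_compactE[of _ "\<lambda>m. comp_hol_inf \<phi> (F m)"] unfolding compact_eq_seq_compact_metric by metis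
  then have t: "strict_mono t" "(\<lambda>m. comp_hol_inf \<phi> (F (t m))) \<longlonglongrightarrow> g"
    by (auto simp: o_def)
  have "g = 0"
  proof (rule hi_eqI)
    fix z :: 'y assume z: "z \<in> ball 0 1"
    have "(\<lambda>m. hi_apply (comp_hol_inf \<phi> (F (t m))) z) \<longlonglongrightarrow> hi_apply g z"
      unfolding tendsto_iff
    proof (intro allI impI)
      fix e :: real assume "e > 0"
      with t(2) have "\<forall>\<^sub>F m in sequentially. dist (comp_hol_inf \<phi> (F (t m))) g < e"
        by (simp add: tendsto_iff)
      then show "\<forall>\<^sub>F m in sequentially. dist (hi_apply (comp_hol_inf \<phi> (F (t m))) z) (hi_apply g z) < e"
      proof eventually_elim
        case (elim m)
        then show ?case
          using hi_norm_le[OF z, of "comp_hol_inf \<phi> (F (t m)) - g"] by (simp add: dist_norm hi_apply_simps z)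
      qed
    qed
    moreover have "(\<lambda>m. hi_apply (comp_hol_inf \<phi> (F (t m))) z) \<longlonglongrightarrow> 0"
    proof -
      have "(\<lambda>m. f (hl_apply \<phi> z) ^ m) \<longlonglongrightarrow> 0"
        using f_in[OF \<phi>_in[OF z]] by (rule LIMSEQ_power_zero)
      then show ?thesis
        using LIMSEQ_subseq_LIMSEQ[OF _ t(1)] z \<phi>_in[OF z] by (fastforce simp: o_def F)
    qed
    ultimately show "hi_apply g z = hi_apply 0 z"
      using LIMSEQ_unique by (fastforce simp: hi_apply_simps)
  qed
  then obtain m where m: "norm (comp_hol_inf \<phi> (F (t m))) < 1 / 2"
    using LIMSEQ_D[OF t(2), of "1/2"] by auto
  have "isCont f x"
    by (rule has_derivative_continuous[OF clinear_functional_has_derivative[OF f(1-3)]])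
  then have "(\<lambda>n. f (hl_apply \<phi> (y (s n)))) \<longlonglongrightarrow> 1"
    using isCont_tendsto_compose[OF _ s(2)] f(4) by metis
  then have "(\<lambda>n. cmod (f (hl_apply \<phi> (y (s n))) ^ t m)) \<longlonglongrightarrow> cmod (1 ^ t m)"
    by (intro tendsto_intros)
  then have "cmod (1 ^ t m) \<le> 1 / 2"
  proof (rule tendsto_upperbound)
    have "cmod (f (hl_apply \<phi> (y (s n))) ^ t m) \<le> 1 / 2" for n
      using hi_norm_le[OF y(1)[of "s n"], of "comp_hol_inf \<phi> (F (t m))"] m y(1)[of "s n"]
        \<phi>_in[OF y(1)[of "s n"]] by (simp add: F)
    then show "\<forall>\<^sub>F n in sequentially. cmod (f (hl_apply \<phi> (y (s n))) ^ t m) \<le> 1 / 2" by simp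
  qed simp
  then show False by simp
qed

text \<open>Lipschitz functions in the unit ball have finite uniform nets, again by transposition, as the ball of \<open>X\<close> is totally
bounded. If \<open>f - f0\<close> is below \<open>t\<close> on the unit ball, then by the Cauchy estimates its Lipschitz constant on the ball of
radius \<open>r\<close> is at most \<open>2 t / (1 - r)\<close>, so composing with \<open>\<phi>\<close> keeps the Lipschitz norm of order \<open>t\<close>.\<close>

lemma compact_comp_hol_lip:
  fixes \<phi> :: "('y::complex_banach, 'x::complex_banach) hol_lip"
  assumes \<phi>: "hl_apply \<phi> ` ball 0 1 \<subseteq> ball 0 1" and dim: "finite_cdim TYPE('x)"
    and r: "r < 1" "\<And>y. y \<in> ball 0 1 \<Longrightarrow> norm (hl_apply \<phi> y) \<le> r"
  shows "compact_operator (comp_hol_lip \<phi> :: ('x, complex) hol_lip \<Rightarrow> ('y, complex) hol_lip)"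
proof (rule compact_operator_if_finite_nets[OF bounded_clinear_comp_hol_lip[OF \<phi>] complete_hol_lip])
  fix e :: real assume e: "e > 0"
  note [simp] = comp_hol_lip_apply[OF \<phi>] hl_apply_simps
  have \<phi>_in: "hl_apply \<phi> y \<in> ball 0 1" if "y \<in> ball 0 1" for y using \<phi> that by blast
  define D where "D = 2 / (1 - r) * norm \<phi> + 1"
  have D: "D \<ge> 1" using r(1) by (simp add: D_def)
  define t where "t = e / (2 * D)"
  have t: "t > 0" using e D by (simp add: t_def)
  have comp: "compact (closure (ball (0::'x) 1))"
    using finite_cdim_compact_cball[OF dim, of 1] by simp
  have "\<exists>F. finite F \<and> F \<subseteq> cball 0 1 \<and> (\<forall>f\<in>cball 0 1. \<exists>f0\<in>F. \<forall>x\<in>ball (0::'x) 1.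
      cmod (hl_apply f x - hl_apply f0 x) < t)"
  proof (rule finite_net_transpose[where M = 1])
    fix f :: "('x, complex) hol_lip" and x :: 'x assume "f \<in> cball 0 1" "x \<in> ball 0 1"
    then show "cmod (hl_apply f x) \<le> 1" using hl_norm_le[of x f] by simp
  next
    fix e :: real assume e: "e > 0"
    obtain K where K: "finite K" "K \<subseteq> ball 0 1" "ball 0 1 \<subseteq> (\<Union>x\<in>K. ball (x::'x) e)"
      using finite_net_of_compact_closure[OF comp e] by metis
    have close: "cmod (hl_apply f x - hl_apply f x0) < e"
      if "f \<in> cball 0 1" "x \<in> ball 0 1" "x0 \<in> ball 0 1" "dist x0 x < e" for f :: "('x, complex) hol_lip" and x x0
    proof -
      have "cmod (hl_apply f x - hl_apply f x0) \<le> norm f * norm (x - x0)" by (rule hl_diff_le[OF that(2,3)])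
      also have "\<dots> \<le> norm (x - x0)" using that(1) by (intro mult_left_le_one_le) auto
      finally show ?thesis using that(4) by (simp add: dist_norm norm_minus_commute)
    qed
    have "\<exists>x0\<in>K. \<forall>f\<in>cball (0 :: ('x, complex) hol_lip) 1. cmod (hl_apply f x - hl_apply f x0) < e"
      if x: "x \<in> ball 0 1" for x
    proof -
      obtain x0 where "x0 \<in> K" "dist x0 x < e" using subsetD[OF K(3) x] by auto
      with close[OF _ x] K(2) show ?thesis by blast
    qed
    then show "\<exists>A0. finite A0 \<and> A0 \<subseteq> ball (0::'x) 1 \<and> (\<forall>x\<in>ball 0 1. \<exists>x0\<in>A0. \<forall>f\<in>cball 0 1.
        cmod (hl_apply f x - hl_apply f x0) < e)"
      using K(1,2) by (intro exI[of _ K]) blast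
  qed (rule t)
  then obtain F where F: "finite F" "\<forall>f\<in>cball 0 1. \<exists>f0\<in>F. \<forall>x\<in>ball (0::'x) 1.
      cmod (hl_apply f x - hl_apply f0 x) < t" by blast
  have "norm (comp_hol_lip \<phi> f - comp_hol_lip \<phi> f0) < e"
    if close: "\<forall>x\<in>ball 0 1. cmod (hl_apply f x - hl_apply f0 x) < t" for f f0 :: "('x, complex) hol_lip"
  proof -
    let ?g = "hl_apply (f - f0)"
    have "norm (comp_hol_lip \<phi> f - comp_hol_lip \<phi> f0)
        \<le> 2 * t / (1 - r) * norm \<phi> + cmod (hl_apply (comp_hol_lip \<phi> f - comp_hol_lip \<phi> f0) 0)"
    proof (rule hl_norm_bound)
      show "0 \<le> 2 * t / (1 - r) * norm \<phi>" using t r(1) by simp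
      fix y z :: 'y assume yz: "y \<in> ball 0 1" "z \<in> ball 0 1"
      have "cmod (?g (hl_apply \<phi> y) - ?g (hl_apply \<phi> z))
          \<le> 2 * t / (1 - r) * norm (hl_apply \<phi> y - hl_apply \<phi> z)"
      proof (rule cholomorphic_bounded_imp_lipschitz[OF hl_holomorphic _ convex_cball])
        show "cmod (?g x) \<le> t" if "x \<in> ball 0 1" for x
          using close that by (auto intro: less_imp_le)
        show "ball x (1 - r) \<subseteq> ball 0 1" if "x \<in> cball 0 r" for x :: 'x
          using that by (rule ball_around_smaller_cball)
      qed (use r yz in auto)
      also have "\<dots> \<le> 2 * t / (1 - r) * (norm \<phi> * norm (y - z))"
        using t r(1) by (intro mult_left_mono hl_diff_le yz) simp
      finally show "cmod (hl_apply (comp_hol_lip \<phi> f - comp_hol_lip \<phi> f0) y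
          - hl_apply (comp_hol_lip \<phi> f - comp_hol_lip \<phi> f0) z) \<le> 2 * t / (1 - r) * norm \<phi> * norm (y - z)"
        using yz by (simp add: mult.assoc)
    qed
    also have "cmod (hl_apply (comp_hol_lip \<phi> f - comp_hol_lip \<phi> f0) 0) \<le> t"
      using close \<phi>_in[of 0] by (auto intro: less_imp_le)
    also have "2 * t / (1 - r) * norm \<phi> + t = t * D" by (simp add: D_def algebra_simps)
    also have "\<dots> = e / 2" using D by (simp add: t_def)
    finally show ?thesis using e by simp
  qed
  then have "\<forall>f\<in>cball 0 1. \<exists>f0\<in>F. norm (comp_hol_lip \<phi> f - comp_hol_lip \<phi> f0) < e"
    using F(2) by meson
  with F(1) show "\<exists>F :: ('x, complex) hol_lip set. finite F \<and>
      (\<forall>f\<in>cball 0 1. \<exists>f0\<in>F. norm (comp_hol_lip \<phi> f - comp_hol_lip \<phi> f0) < e)"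
    by blast
qed

lemma lip_ext_norm_le:
  fixes \<phi> :: "('y::complex_banach, 'x::complex_banach) hol_lip"
  assumes \<phi>: "hl_apply \<phi> ` ball 0 1 \<subseteq> ball 0 1" and y: "y \<in> cball 0 1"
  shows "norm (lip_ext \<phi> y) \<le> 1"
proof (rule continuous_on_closure_norm_le[of "ball (0::'y) 1"])
  obtain C where C: "C-lipschitz_on (cball 0 1) (lip_ext \<phi>)" using lip_ext by blast
  show "continuous_on (closure (ball 0 1)) (lip_ext \<phi>)"
    using lipschitz_on_continuous_on[OF C] by simp
  show "\<forall>y\<in>ball 0 1. norm (lip_ext \<phi> y) \<le> 1"
    using \<phi> lip_ext[of \<phi>] by (auto simp: image_subset_iff intro: less_imp_le)
  show "y \<in> closure (ball 0 1)" using y by simp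
qed

theorem theorem6p24:
  fixes \<phi> :: "('y::complex_banach, 'x::complex_banach) hol_lip"
  assumes "hl_apply \<phi> ` ball 0 1 \<subseteq> ball 0 1"
  shows
    "let S1 = compact_operator (comp_hol_lip \<phi> :: ('x, complex) hol_lip \<Rightarrow> ('y, complex) hol_lip);
         S2 = (\<not> fixes_copy_of_linf (comp_hol_lip \<phi> :: ('x, complex) hol_lip \<Rightarrow> ('y, complex) hol_lip) \<and>
               compact (closure (hl_apply \<phi> ` ball 0 1)));
         S3 = ((\<forall>y\<in>cball 0 1. norm (lip_ext \<phi> y) < 1) \<and>
               compact (closure (hl_apply \<phi> ` ball 0 1)));
         S4 = compact_operator (comp_hol_inf \<phi> :: 'x hol_inf \<Rightarrow> 'y hol_inf)
     in (S1 \<longrightarrow> S2) \<and> (S2 \<longrightarrow> S3) \<and>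
        (finite_cdim TYPE('y) \<longrightarrow> S3 \<longrightarrow> S4) \<and>
        (finite_cdim TYPE('x) \<longrightarrow> S4 \<longrightarrow> S1) \<and>
        (finite_cdim TYPE('x) \<and> finite_cdim TYPE('y) \<longrightarrow>
           (S1 \<longleftrightarrow> S2) \<and> (S2 \<longleftrightarrow> S3) \<and> (S3 \<longleftrightarrow> S4))"
proof -
  define S1 where "S1 = compact_operator (comp_hol_lip \<phi> :: ('x, complex) hol_lip \<Rightarrow> ('y, complex) hol_lip)"
  define S2 where "S2 = (\<not> fixes_copy_of_linf (comp_hol_lip \<phi> :: ('x, complex) hol_lip \<Rightarrow> ('y, complex) hol_lip) \<and>
               compact (closure (hl_apply \<phi> ` ball 0 1)))"
  define S3 where "S3 = ((\<forall>y\<in>cball 0 1. norm (lip_ext \<phi> y) < 1) \<and>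
               compact (closure (hl_apply \<phi> ` ball 0 1)))"
  define S4 where "S4 = compact_operator (comp_hol_inf \<phi> :: 'x hol_inf \<Rightarrow> 'y hol_inf)"
  have 12: "S1 \<longrightarrow> S2"
    unfolding S1_def S2_def
    using compact_operator_not_fixes_linf compact_comp_hol_lip_imp_relatively_compact[OF assms] by blast
  have 23: "S2 \<longrightarrow> S3"
  proof
    assume S2
    have "norm (lip_ext \<phi> y) < 1" if y: "y \<in> cball 0 1" for y
    proof (rule ccontr)
      assume "\<not> norm (lip_ext \<phi> y) < 1"
      then have "norm (lip_ext \<phi> y) = 1" using lip_ext_norm_le[OF assms y] by simp
      then show False
        using comp_hol_lip_fixes_linf[OF assms, of y] y \<open>S2\<close> by (simp add: S2_def)
    qed
    with \<open>S2\<close> show S3 by (simp add: S2_def S3_def)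
  qed
  have 34: "S3 \<longrightarrow> S4" if "finite_cdim TYPE('y)"
  proof
    assume S3
    then have "\<And>y. y \<in> cball 0 1 \<Longrightarrow> norm (lip_ext \<phi> y) < 1" by (simp add: S3_def)
    then obtain r where r: "r < 1" "\<forall>y\<in>ball 0 1. norm (hl_apply \<phi> y) \<le> r"
      using lip_ext_bound_finite_cdim[OF \<open>finite_cdim TYPE('y)\<close>, of \<phi>] by blast
    then show S4
      unfolding S4_def using \<open>S3\<close> r by (intro compact_comp_hol_inf[OF assms]) (auto simp: S3_def)
  qed
  have 41: "S4 \<longrightarrow> S1" if "finite_cdim TYPE('x)"
  proof
    assume S4
    then obtain r where r: "r < 1" "\<forall>y\<in>ball 0 1. norm (hl_apply \<phi> y) \<le> r"
      using compact_comp_hol_inf_imp_bound[OF assms \<open>finite_cdim TYPE('x)\<close>] unfolding S4_def by blast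
    then show S1
      unfolding S1_def using r by (intro compact_comp_hol_lip[OF assms that]) auto
  qed
  show ?thesis
    unfolding Let_def S1_def[symmetric] S2_def[symmetric] S3_def[symmetric] S4_def[symmetric]
    using 12 23 34 41 by blast
qed

end
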